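(* Fix integers $d,m,n$ with $n\geq 3$ and $d\geq m>1$. Let $\delta:= \left\lfloor\frac{m+n}{n+1}\right\rfloor^n$. Then $\mathcal{T}^n_{d,m}$ is contained in the closure of $V^n_{d,\delta}$. Equivalently, if $X\subset\mathbf{P}^n$ is a hypersurface of degree $d$ with an ordinary $m$-fold point and no further singularities, then $\delta_X\geq \delta$.
   Context: We work over $\mathbf{C}$. $V^n_{d,\delta}\subset \mathbf{P}(\mathbf{C}[x_0,\dots,x_n]_d)$ denotes the Severi variety of degree $d$ hypersurfaces in $\mathbf{P}^n$ with $\delta$ nodes (precisely $\delta$ nodes and no other singularities); a node is an ordinary double point. The closure is taken in $\mathbf{P}(\mathbf{C}[x_0,\dots,x_n]_d)$. For a singular hypersurface $X\subset\mathbf{P}^n$ of degree $d$, $\delta_X$ is the maximal value of $\delta$ such that the point corresponding to $X$ lies in the closure of $V^n_{d,\delta}$. An ordinary $m$-fold point of a hypersurface in $\mathbf{P}^n$ is an isolated singularity of multiplicity $m$ whose tangent cone is a cone over a smooth hypersurface of degree $m$ in $\mathbf{P}^{n-1}$. $\mathcal{T}^n_{d,m}\subset \mathbf{P}(\mathbf{C}[x_0,\dots,x_n]_d)$ denotes the locus of hypersurfaces in $\mathbf{P}^n$ of degree $d$ with an ordinary $m$-fold point as singularity and no further singularities. *)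

theory Defs
  imports "HOL-Analysis.Analysis" "HOL-Library.Poly_Mapping"
begin

text \<open>
  Points of projective space, and polynomials, are finitely supported functions. Coordinates are
  indexed by a set \<open>I\<close> in an arbitrary type, so that the same definitions serve
  \<open>P^n\<close> (with \<open>I = {..n}\<close>), the projectivised tangent space at one of its points
  (with \<open>I = {..n} - {i}\<close>) and the space of hypersurfaces (with \<open>I\<close> the set of
  monomials of degree \<open>d\<close> in \<open>x_0, ..., x_n\<close>).
\<close>

type_synonym 'i cpoly = "('i \<Rightarrow>\<^sub>0 nat) \<Rightarrow>\<^sub>0 complex"

abbreviation "lookup \<equiv> Poly_Mapping.lookup"
abbreviation "keys \<equiv> Poly_Mapping.keys"


section \<open>Polynomials\<close>

definition mdeg :: "('i \<Rightarrow>\<^sub>0 nat) \<Rightarrow> nat" where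
  "mdeg a = (\<Sum>i\<in>keys a. lookup a i)"

definition monomials :: "'i set \<Rightarrow> nat \<Rightarrow> ('i \<Rightarrow>\<^sub>0 nat) set" where
  "monomials I d = {a. keys a \<subseteq> I \<and> mdeg a = d}"

text \<open>Includes the zero polynomial.\<close>

definition form :: "'i set \<Rightarrow> nat \<Rightarrow> 'i cpoly \<Rightarrow> bool" where
  "form I d F \<longleftrightarrow> keys F \<subseteq> monomials I d"

definition const_poly :: "complex \<Rightarrow> 'i cpoly" where
  "const_poly c = Poly_Mapping.single 0 c"

definition var_poly :: "'i \<Rightarrow> 'i cpoly" where
  "var_poly i = Poly_Mapping.single (Poly_Mapping.single i 1) 1"

definition eval_poly :: "'i cpoly \<Rightarrow> ('i \<Rightarrow> complex) \<Rightarrow> complex" where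
  "eval_poly F v = (\<Sum>a\<in>keys F. lookup F a * (\<Prod>i\<in>keys a. v i ^ lookup a i))"

definition subst_poly :: "'i cpoly \<Rightarrow> ('i \<Rightarrow> 'j cpoly) \<Rightarrow> 'j cpoly" where
  "subst_poly F s = (\<Sum>a\<in>keys F. const_poly (lookup F a) * (\<Prod>i\<in>keys a. s i ^ lookup a i))"

text \<open>The subtraction of exponents is truncated, but only in terms with coefficient zero.\<close>

definition pdiff :: "'i \<Rightarrow> 'i cpoly \<Rightarrow> 'i cpoly" where
  "pdiff i F = (\<Sum>a\<in>keys F.
     Poly_Mapping.single (a - Poly_Mapping.single i 1) (of_nat (lookup a i) * lookup F a))"

definition hom_part :: "nat \<Rightarrow> 'i cpoly \<Rightarrow> 'i cpoly" where
  "hom_part k F = (\<Sum>a | a \<in> keys F \<and> mdeg a = k. Poly_Mapping.single a (lookup F a))"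


section \<open>Projective space\<close>

definition nonzero_vectors :: "'i set \<Rightarrow> ('i \<Rightarrow>\<^sub>0 complex) set" where
  "nonzero_vectors I = {v. v \<noteq> 0 \<and> keys v \<subseteq> I}"

definition proj_point :: "('i \<Rightarrow>\<^sub>0 complex) \<Rightarrow> ('i \<Rightarrow>\<^sub>0 complex) set" where
  "proj_point v = {Poly_Mapping.map ((*) c) v | c. c \<noteq> 0}"

text \<open>
  The topology is generated by the principal open sets \<open>G \<noteq> 0\<close> for homogeneous \<open>G\<close>;
  the form \<open>G = 1\<close> of degree 0 makes the whole projective space open.
\<close>

definition zariski_topology :: "'i set \<Rightarrow> ('i \<Rightarrow>\<^sub>0 complex) set topology" where
  "zariski_topology I = topology_generated_by
     {proj_point ` {v \<in> nonzero_vectors I. eval_poly G (lookup v) \<noteq> 0} | G. \<exists>e. form I e G}"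


section \<open>Singularities of hypersurfaces\<close>

definition singular_locus :: "'i set \<Rightarrow> 'i cpoly \<Rightarrow> ('i \<Rightarrow>\<^sub>0 complex) set set" where
  "singular_locus I F = proj_point ` {v \<in> nonzero_vectors I.
     eval_poly F (lookup v) = 0 \<and> (\<forall>i\<in>I. eval_poly (pdiff i F) (lookup v) = 0)}"

text \<open>
  The equation of the hypersurface \<open>F = 0\<close> in the affine chart \<open>x_i = 1\<close>, translated so
  that the point represented by \<open>p\<close> becomes the origin. The variable \<open>x_i\<close> does not
  occur in it.
\<close>

definition local_equation :: "'i cpoly \<Rightarrow> ('i \<Rightarrow>\<^sub>0 complex) \<Rightarrow> 'i \<Rightarrow> 'i cpoly" where
  "local_equation F p i =
     subst_poly F (\<lambda>j. if j = i then 1 else var_poly j + const_poly (lookup p j / lookup p i))"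

definition mult_at_origin :: "'i cpoly \<Rightarrow> nat" where
  "mult_at_origin f = (LEAST k. hom_part k f \<noteq> 0)"

definition tangent_cone :: "'i cpoly \<Rightarrow> 'i cpoly" where
  "tangent_cone f = hom_part (mult_at_origin f) f"

text \<open>
  The elements \<open>p \<in> P\<close> are the vectors representing \<open>P\<close>, and the \<open>i \<in> keys p\<close>
  are the charts \<open>x_i \<noteq> 0\<close> that contain \<open>P\<close>; the condition does not depend on the choice
  of either. Isolatedness is expressed by \<open>P\<close> not being an accumulation point of the
  singular locus.
\<close>

definition ordinary_point :: "nat \<Rightarrow> nat \<Rightarrow> nat cpoly \<Rightarrow> (nat \<Rightarrow>\<^sub>0 complex) set \<Rightarrow> bool" where
  "ordinary_point n m F P \<longleftrightarrow>
     P \<in> singular_locus {..n} F \<and>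
     P \<notin> zariski_topology {..n} derived_set_of singular_locus {..n} F \<and>
     (\<exists>p\<in>P. \<exists>i\<in>keys p.
        mult_at_origin (local_equation F p i) = m \<and>
        singular_locus ({..n} - {i}) (tangent_cone (local_equation F p i)) = {})"

abbreviation node :: "nat \<Rightarrow> nat cpoly \<Rightarrow> (nat \<Rightarrow>\<^sub>0 complex) set \<Rightarrow> bool" where
  "node n \<equiv> ordinary_point n 2"


section \<open>Loci of hypersurfaces\<close>

text \<open>
  A hypersurface of degree \<open>d\<close> in \<open>P^n\<close> is a point of the projective space with
  coordinates indexed by \<open>monomials {..n} d\<close>; its representatives are its equations.
\<close>

definition severi :: "nat \<Rightarrow> nat \<Rightarrow> nat \<Rightarrow> nat cpoly set set" where
  "severi n d k = proj_point ` {F \<in> nonzero_vectors (monomials {..n} d).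
     finite (singular_locus {..n} F) \<and> card (singular_locus {..n} F) = k \<and>
     (\<forall>P\<in>singular_locus {..n} F. node n F P)}"

definition severi_closure :: "nat \<Rightarrow> nat \<Rightarrow> nat \<Rightarrow> nat cpoly set set" where
  "severi_closure n d k = zariski_topology (monomials {..n} d) closure_of severi n d k"

definition ordinary_locus :: "nat \<Rightarrow> nat \<Rightarrow> nat \<Rightarrow> nat cpoly set set" where
  "ordinary_locus n d m = proj_point ` {F \<in> nonzero_vectors (monomials {..n} d).
     \<exists>P. singular_locus {..n} F = {P} \<and> ordinary_point n m F P}"

text \<open>
  The maximal \<open>k\<close> such that \<open>X\<close> lies in the closure of \<open>severi n d k\<close>. It is taken in
  \<open>enat\<close>, where the supremum of a finite nonempty set is its maximum, so that the definition does
  not rest on the boundedness of the number of nodes of a hypersurface of degree \<open>d\<close>.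
\<close>

definition max_nodes :: "nat \<Rightarrow> nat \<Rightarrow> nat cpoly set \<Rightarrow> enat" where
  "max_nodes n d X = (SUP k\<in>{k. X \<in> severi_closure n d k}. enat k)"

end

theory Submission
  imports Defs
begin

text \<open>
  Put \<open>k = \<lfloor>(m + n) / (n + 1)\<rfloor>\<close>, so that \<open>\<delta> = k^n\<close> and \<open>m \<ge> (n + 1) k - n\<close>. The proof compares
  the hypersurfaces with an \<open>m\<close>-fold point with those of the form \<open>F = \<Sum> a_ij p_i p_j\<close>, where
  \<open>i\<close> and \<open>j\<close> run over \<open>1, ..., n\<close>, every \<open>p_j\<close> is a product of \<open>k\<close> linear forms and the \<open>a_ij\<close> are forms of degree \<open>d - 2k\<close>.
  Such an \<open>F\<close> is singular where all \<open>p_j\<close> vanish. For a general choice there are \<open>k^n\<close> common zeros,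
  one for each choice of a linear factor from every \<open>p_j\<close>; the \<open>p_j\<close> are local coordinates at each of
  them, and the matrix \<open>a + a^T\<close> is invertible there, so that they are nodes
  (\<open>node_singular\<close>, \<open>card_singular_locus\<close>). Two facts give the theorem.

  \<^item> A general such \<open>F\<close> lies in the Severi variety (\<open>product_quadric_nearby_severi\<close>). The conditions for
    this are open in the classical topology, by compactness of the unit sphere (\<open>full_rank_open\<close>,
    \<open>singular_only_on_base_open\<close>), and they hold for an explicit example with \<open>p_j = \<Prod> (x_j - t x_0)\<close>,
    \<open>0 \<le> t < k\<close> (\<open>singular_only_on_base_grid\<close>). If a polynomial \<open>G\<close> in the coefficients does not vanish
    at some \<open>F\<close>, its restriction to the segment from \<open>F\<close> to the example is a nonzero polynomial in one
    variable; so \<open>G\<close> is nonzero at points of the segment arbitrarily close to the example. Thus openness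
    at one point is all that a statement about Zariski closures needs.

  \<^item> Every hypersurface with an \<open>m\<close>-fold point is in the Zariski closure of these \<open>F\<close>
    (\<open>reached_by_product_quadrics\<close>). Let the point be \<open>[1:0:...:0]\<close>. The monomials that occur have
    degree at least \<open>m\<close> in \<open>x_1, ..., x_n\<close>, so each is divisible by some \<open>x_i^k x_j^k\<close>, except for
    \<open>x_0^(d-m) x_j^k \<Prod> x_l^(k-1)\<close> when \<open>m = (n + 1) k - n\<close>. Hence they lie in the square of the ideal
    \<open>(x_1^k, ..., x_n^k)\<close> up to these \<open>n\<close> exceptions, and an exception is the first-order variation of
    \<open>b_j p_j^2\<close> when \<open>p_j = x_j^k\<close> moves to \<open>x_j^(k-1) (x_j + \<epsilon> x_l)\<close>, with a suitable monomial \<open>b_j\<close>.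
    So the differential of \<open>(a, p) \<mapsto> F\<close> at a suitable point maps onto the forms that vanish to order
    at least \<open>m\<close>, and a polynomial that vanishes on the image vanishes on all of them
    (\<open>polynomial_vanishes_by_tangent_directions\<close>).
\<close>

section \<open>Finitely supported functions\<close>

lemma poly_mapping_sum_singles: "F = (\<Sum>a\<in>keys F. Poly_Mapping.single a (lookup F a))"
proof (rule poly_mapping_eqI)
  fix b
  show "lookup F b = lookup (\<Sum>a\<in>keys F. Poly_Mapping.single a (lookup F a)) b"
    by (simp add: lookup_sum lookup_single when_def in_keys_iff sum.delta)
qed

lemma poly_mapping_additive_induct [case_names single add]:
  assumes single: "\<And>a c. a \<in> keys F \<or> c = 0 \<Longrightarrow> P (Poly_Mapping.single a c)"
    and add: "\<And>f g. P f \<Longrightarrow> P g \<Longrightarrow> P (f + g)"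
  shows "P (F :: 'a \<Rightarrow>\<^sub>0 'b::comm_monoid_add)"
proof -
  have "P (\<Sum>a\<in>A. Poly_Mapping.single a (lookup F a))" if "finite A" "A \<subseteq> keys F" for A
    using that
  proof (induction A rule: finite_induct)
    case empty
    then show ?case using single[of undefined 0] by simp
  next
    case (insert a A)
    then show ?case by (auto intro!: add single)
  qed
  then show ?thesis using poly_mapping_sum_singles[of F] by (metis finite_keys order_refl)
qed

section \<open>Evaluation and substitution\<close>

definition monomial_value :: "('i \<Rightarrow> 'r::comm_ring_1) \<Rightarrow> ('i \<Rightarrow>\<^sub>0 nat) \<Rightarrow> 'r" where
  "monomial_value s a = (\<Prod>i\<in>keys a. s i ^ lookup a i)"

lemma monomial_value_superset:
  "finite B \<Longrightarrow> keys a \<subseteq> B \<Longrightarrow> monomial_value s a = (\<Prod>i\<in>B. s i ^ lookup a i)"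
  unfolding monomial_value_def by (rule prod.mono_neutral_left) (auto simp: in_keys_iff)

lemma monomial_value_add:
  "monomial_value s (a + b) = monomial_value s a * monomial_value s b"
proof -
  let ?B = "keys a \<union> keys b"
  have "monomial_value s (a + b) = (\<Prod>i\<in>?B. s i ^ lookup (a + b) i)"
    by (rule monomial_value_superset) (auto simp: keys_add)
  also have "\<dots> = (\<Prod>i\<in>?B. s i ^ lookup a i) * (\<Prod>i\<in>?B. s i ^ lookup b i)"
    by (simp add: lookup_add power_add prod.distrib)
  also have "\<dots> = monomial_value s a * monomial_value s b"
    by (subst (1 2) monomial_value_superset[where B = ?B]) auto
  finally show ?thesis .
qed

lemma monomial_value_zero [simp]: "monomial_value s 0 = 1"
  by (simp add: monomial_value_def)

lemma monomial_value_single [simp]: "monomial_value s (Poly_Mapping.single i k) = s i ^ k"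
  by (simp add: monomial_value_def)

text \<open>
  Evaluation at numbers and substitution of polynomials are the same construction over two coefficient
  rings; treating them together proves only once that both are ring homomorphisms.
\<close>

definition evaluate :: "(complex \<Rightarrow> 'r::comm_ring_1) \<Rightarrow> ('i \<Rightarrow> 'r) \<Rightarrow> 'i cpoly \<Rightarrow> 'r" where
  "evaluate h s F = (\<Sum>a\<in>keys F. h (lookup F a) * monomial_value s a)"

lemma eval_poly_evaluate: "eval_poly F v = evaluate id v F"
  by (simp add: eval_poly_def evaluate_def monomial_value_def)

lemma subst_poly_evaluate: "subst_poly F s = evaluate const_poly s F"
  by (simp add: subst_poly_def evaluate_def monomial_value_def)

locale ring_hom_1 =
  fixes h :: "'q::comm_ring_1 \<Rightarrow> 'r::comm_ring_1"
  assumes hom_add: "h (x + y) = h x + h y"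
    and hom_mult: "h (x * y) = h x * h y"
    and hom_one: "h 1 = 1"
begin

lemma hom_zero: "h 0 = 0"
  using hom_add[of 0 0] by simp

lemma hom_uminus: "h (- x) = - h x"
  using hom_add[of x "- x"] hom_zero by (simp add: eq_neg_iff_add_eq_0 add.commute)

lemma hom_diff: "h (x - y) = h x - h y"
  using hom_add[of x "- y"] hom_uminus by simp

lemma hom_power: "h (x ^ k) = h x ^ k"
  by (induction k) (simp_all add: hom_mult hom_one)

lemma hom_sum: "h (sum f A) = (\<Sum>x\<in>A. h (f x))"
  by (induction A rule: infinite_finite_induct) (simp_all add: hom_zero hom_add)

lemma hom_prod: "h (prod f A) = (\<Prod>x\<in>A. h (f x))"
  by (induction A rule: infinite_finite_induct) (simp_all add: hom_one hom_mult)

lemmas homs = hom_add hom_mult hom_one hom_zero hom_uminus hom_diff hom_power hom_sum hom_prod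

end

lemma evaluate_ring_hom:
  assumes "ring_hom_1 h"
  shows "ring_hom_1 (evaluate h s)"
proof -
  interpret ring_hom_1 h by fact
  have sing: "evaluate h s (Poly_Mapping.single a c) = h c * monomial_value s a" for a c
    by (simp add: evaluate_def hom_zero)
  have add: "evaluate h s (F + G) = evaluate h s F + evaluate h s G" for F G
    unfolding evaluate_def
    by (rule setsum_keys_plus_distrib) (auto simp: homs algebra_simps)
  have mult: "evaluate h s (F * G) = evaluate h s F * evaluate h s G" for F G
  proof (induction F rule: poly_mapping_additive_induct)
    case (single a c)
    show ?case
      by (induction G rule: poly_mapping_additive_induct)
        (simp_all add: sing mult_single hom_mult monomial_value_add add distrib_left
          distrib_right mult_ac)
  qed (simp add: distrib_right add)
  show ?thesis
    by unfold_locales (auto simp: add mult sing[of 0 1, simplified] hom_one)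
qed

lemma evaluate_comp:
  assumes "ring_hom_1 g"
  shows "g (evaluate h s F) = evaluate (g \<circ> h) (g \<circ> s) F"
proof -
  interpret ring_hom_1 g by fact
  show ?thesis by (simp add: evaluate_def homs monomial_value_def)
qed

interpretation const_poly: ring_hom_1 "const_poly :: complex \<Rightarrow> 'i cpoly"
  by unfold_locales (simp_all add: const_poly_def single_add mult_single)

interpretation eval_poly: ring_hom_1 "\<lambda>F. eval_poly F v"
  unfolding eval_poly_evaluate by (rule evaluate_ring_hom) (unfold_locales, auto)

interpretation subst_poly: ring_hom_1 "\<lambda>F. subst_poly F s"
  unfolding subst_poly_evaluate
  by (rule evaluate_ring_hom) (unfold_locales, auto simp: const_poly.homs)

lemma eval_poly_single: "eval_poly (Poly_Mapping.single a c) v = c * monomial_value v a"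
  by (simp add: eval_poly_def monomial_value_def)

lemma subst_poly_single:
  "subst_poly (Poly_Mapping.single a c) s = const_poly c * monomial_value s a"
  by (simp add: subst_poly_def monomial_value_def const_poly.hom_zero)

lemma eval_const_poly [simp]: "eval_poly (const_poly c) v = c"
  by (simp add: const_poly_def eval_poly_single)

lemma eval_var_poly [simp]: "eval_poly (var_poly i) v = v i"
  by (simp add: var_poly_def eval_poly_single)

lemma subst_const_poly [simp]: "subst_poly (const_poly c) s = const_poly c"
  by (subst (1) const_poly_def) (simp add: subst_poly_single)

lemma subst_var_poly [simp]: "subst_poly (var_poly i) s = s i"
  by (simp add: var_poly_def subst_poly_single const_poly.hom_one)

lemma eval_subst_poly: "eval_poly (subst_poly F s) v = eval_poly F (\<lambda>i. eval_poly (s i) v)"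
proof -
  have "(\<lambda>F. eval_poly F v) (evaluate const_poly s F)
      = evaluate ((\<lambda>F. eval_poly F v) \<circ> const_poly) ((\<lambda>F. eval_poly F v) \<circ> s) F"
    by (rule evaluate_comp) unfold_locales
  then show ?thesis
    by (simp add: subst_poly_evaluate eval_poly_evaluate[of F] o_def id_def)
qed

lemma subst_subst_poly:
  "subst_poly (subst_poly F s) t = subst_poly F (\<lambda>i. subst_poly (s i) t)"
proof -
  have "(\<lambda>F. subst_poly F t) (evaluate const_poly s F)
      = evaluate ((\<lambda>F. subst_poly F t) \<circ> const_poly) ((\<lambda>F. subst_poly F t) \<circ> s) F"
    by (rule evaluate_comp) unfold_locales
  then show ?thesis
    by (simp add: subst_poly_evaluate[of F] o_def)
qed

lemma single_eq_const_times: "Poly_Mapping.single a c = const_poly c * Poly_Mapping.single a 1"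
  by (simp add: const_poly_def mult_single)

lemma subst_var_polys: "subst_poly F var_poly = F"
proof -
  have "monomial_value var_poly a = Poly_Mapping.single a 1" for a :: "'a \<Rightarrow>\<^sub>0 nat"
  proof (induction a rule: poly_mapping_additive_induct)
    case (single i k)
    have "var_poly i ^ k = Poly_Mapping.single (Poly_Mapping.single i k) 1"
      by (induction k) (simp_all add: var_poly_def mult_single single_add[symmetric])
    then show ?case by simp
  qed (simp add: monomial_value_add mult_single)
  then show ?thesis
    by (induction F rule: poly_mapping_additive_induct)
      (simp_all add: subst_poly_single single_eq_const_times[symmetric] subst_poly.hom_add)
qed

lemma lookup_const_times: "lookup (const_poly c * F) a = c * lookup F a"
  by (induction F rule: poly_mapping_additive_induct)
    (simp_all add: const_poly_def mult_single lookup_single when_def lookup_add distrib_left)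

section \<open>Partial derivatives\<close>

lemma pdiff_add: "pdiff i (F + G) = pdiff i F + pdiff i G"
  unfolding pdiff_def
  by (rule setsum_keys_plus_distrib) (simp_all add: distrib_left single_add)

lemma pdiff_single: "pdiff i (Poly_Mapping.single a c)
    = Poly_Mapping.single (a - Poly_Mapping.single i 1) (of_nat (lookup a i) * c)"
  by (simp add: pdiff_def)

lemma minus_add_assoc_poly_mapping:
  assumes "lookup a i \<noteq> 0"
  shows "a + b - Poly_Mapping.single i (1::nat) = a - Poly_Mapping.single i 1 + b"
  using assms
  by (intro poly_mapping_eqI) (auto simp: lookup_minus lookup_add lookup_single when_def)

lemma pdiff_mult: "pdiff i (F * G) = pdiff i F * G + F * pdiff i G"
proof (induction F rule: poly_mapping_additive_induct)
  case (single a c)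
  show ?case
  proof (induction G rule: poly_mapping_additive_induct)
    case (single b d)
    have 1: "Poly_Mapping.single (a + b - Poly_Mapping.single i (Suc 0)) (of_nat (lookup a i) * (c * d))
       = Poly_Mapping.single (a - Poly_Mapping.single i (Suc 0) + b) (of_nat (lookup a i) * (c * d))"
      using minus_add_assoc_poly_mapping[of a i b] by (cases "lookup a i = 0") auto
    have 2: "Poly_Mapping.single (a + b - Poly_Mapping.single i (Suc 0)) (of_nat (lookup b i) * (c * d))
       = Poly_Mapping.single (a + (b - Poly_Mapping.single i (Suc 0))) (of_nat (lookup b i) * (c * d))"
      using minus_add_assoc_poly_mapping[of b i a] by (cases "lookup b i = 0") (auto simp: add.commute)
    have "pdiff i (Poly_Mapping.single a c * Poly_Mapping.single b d)
       = Poly_Mapping.single (a + b - Poly_Mapping.single i (Suc 0)) (of_nat (lookup a i) * (c * d))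
       + Poly_Mapping.single (a + b - Poly_Mapping.single i (Suc 0)) (of_nat (lookup b i) * (c * d))"
      by (simp add: pdiff_single mult_single lookup_add distrib_right single_add)
    then show ?case
      unfolding 1 2 by (simp add: pdiff_single mult_single mult_ac add.commute)
  qed (simp add: distrib_left pdiff_add)
qed (simp add: distrib_right pdiff_add)

lemma pdiff_const [simp]: "pdiff i (const_poly c) = 0"
  by (simp add: const_poly_def pdiff_single)

lemma pdiff_zero [simp]: "pdiff i 0 = 0"
  by (simp add: pdiff_def)

lemma pdiff_one [simp]: "pdiff i 1 = 0"
  using pdiff_const[of i 1] by (simp add: const_poly.hom_one)

lemma pdiff_var: "pdiff i (var_poly j) = (if i = j then 1 else 0)"
  by (auto simp: var_poly_def pdiff_single lookup_single)

lemma pdiff_sum: "pdiff i (sum f A) = (\<Sum>x\<in>A. pdiff i (f x))"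
  by (induction A rule: infinite_finite_induct) (simp_all add: pdiff_add)

lemma pdiff_prod:
  "finite A \<Longrightarrow> pdiff i (prod f A) = (\<Sum>x\<in>A. pdiff i (f x) * prod f (A - {x}))"
proof (induction A rule: finite_induct)
  case (insert y A)
  have "(\<Sum>x\<in>A. pdiff i (f x) * prod f (insert y A - {x}))
      = (\<Sum>x\<in>A. pdiff i (f x) * (f y * prod f (A - {x})))"
  proof (rule sum.cong)
    fix x assume "x \<in> A"
    then have "insert y A - {x} = insert y (A - {x})" using insert by auto
    then show "pdiff i (f x) * prod f (insert y A - {x}) = pdiff i (f x) * (f y * prod f (A - {x}))"
      using insert by simp
  qed simp
  then show ?case
    using insert by (simp add: pdiff_mult sum_distrib_left mult_ac)
qed simp

section \<open>Forms\<close>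

lemma mdeg_superset: "finite B \<Longrightarrow> keys a \<subseteq> B \<Longrightarrow> mdeg a = (\<Sum>i\<in>B. lookup a i)"
  unfolding mdeg_def by (rule sum.mono_neutral_left) (auto simp: in_keys_iff)

lemma mdeg_add: "mdeg (a + b) = mdeg a + mdeg b"
  by (simp add: mdeg_superset[of "keys a \<union> keys b"] keys_add lookup_add sum.distrib)

lemma mdeg_zero [simp]: "mdeg 0 = 0"
  by (simp add: mdeg_def)

lemma mdeg_single [simp]: "mdeg (Poly_Mapping.single i k) = k"
  by (simp add: mdeg_def)

lemma mdeg_eq_0_iff: "mdeg a = 0 \<longleftrightarrow> a = 0"
  by (auto simp: mdeg_def in_keys_iff intro!: poly_mapping_eqI)

lemma keys_add_nat: "keys (a + b) = keys a \<union> keys (b :: 'i \<Rightarrow>\<^sub>0 nat)"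
  by (auto simp: in_keys_iff lookup_add)

lemma form_single: "form I d (Poly_Mapping.single a c) \<longleftrightarrow> c = 0 \<or> keys a \<subseteq> I \<and> mdeg a = d"
  by (auto simp: form_def monomials_def)

lemma form_zero [simp]: "form I d 0"
  by (simp add: form_def)

lemma form_add: "form I d F \<Longrightarrow> form I d G \<Longrightarrow> form I d (F + G)"
  unfolding form_def using keys_add[of F G] by blast

lemma form_mult:
  assumes "form I d F" "form I e G"
  shows "form I (d + e) (F * G)"
  unfolding form_def
proof
  fix c assume "c \<in> keys (F * G)"
  then obtain a b where "c = a + b" "a \<in> keys F" "b \<in> keys G"
    using keys_mult[of F G] by blast
  then show "c \<in> monomials I (d + e)"
    using assms by (auto simp: form_def monomials_def keys_add_nat mdeg_add)
qed

lemma form_const: "form I 0 (const_poly c)"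
  by (simp add: const_poly_def form_single)

lemma form_one: "form I 0 1"
  using form_const[of I 1] by (simp add: const_poly.hom_one)

lemma form_const_mult: "form I d F \<Longrightarrow> form I d (const_poly c * F)"
  using form_mult[OF form_const] by fastforce

lemma form_var: "i \<in> I \<Longrightarrow> form I 1 (var_poly i)"
  by (simp add: var_poly_def form_single)

lemma form_uminus: "form I d F \<Longrightarrow> form I d (- F)"
  by (auto simp: form_def in_keys_iff subset_iff)

lemma form_diff: "form I d F \<Longrightarrow> form I d G \<Longrightarrow> form I d (F - G)"
  using form_add[OF _ form_uminus] by fastforce

lemma form_sum: "(\<And>x. x \<in> A \<Longrightarrow> form I d (f x)) \<Longrightarrow> form I d (sum f A)"
  by (induction A rule: infinite_finite_induct) (simp_all add: form_add)

lemma form_power: "form I d F \<Longrightarrow> form I (k * d) (F ^ k)"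
  by (induction k) (simp_all add: form_one form_mult)

lemma form_prod: "(\<And>x. x \<in> A \<Longrightarrow> form I (d x) (f x)) \<Longrightarrow> form I (sum d A) (prod f A)"
  by (induction A rule: infinite_finite_induct) (simp_all add: form_mult form_one)

lemma form_pdiff:
  assumes "form I d F"
  shows "form I (d - 1) (pdiff i F)"
  unfolding pdiff_def
proof (rule form_sum)
  fix a assume "a \<in> keys F"
  then have a: "keys a \<subseteq> I" "mdeg a = d" using assms by (auto simp: form_def monomials_def)
  show "form I (d - 1)
      (Poly_Mapping.single (a - Poly_Mapping.single i 1) (of_nat (lookup a i) * lookup F a))"
  proof (cases "lookup a i = 0")
    case False
    have "a = (a - Poly_Mapping.single i 1) + Poly_Mapping.single i 1"
      using False by (intro poly_mapping_eqI) (auto simp: lookup_minus lookup_add lookup_single when_def)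
    then have "mdeg a = mdeg (a - Poly_Mapping.single i 1) + 1"
      by (metis mdeg_add mdeg_single)
    then show ?thesis using a by (auto simp: form_single in_keys_iff lookup_minus)
  qed (simp)
qed

lemma form_induct [consumes 1, case_names single add]:
  assumes "form I d F"
    and "\<And>a c. a \<in> monomials I d \<Longrightarrow> P (Poly_Mapping.single a c)"
    and "P 0"
    and "\<And>F G. P F \<Longrightarrow> P G \<Longrightarrow> P (F + G)"
  shows "P F"
  by (induction F rule: poly_mapping_additive_induct)
    (use assms in \<open>auto simp: form_def\<close>)

lemma form_subst:
  assumes F: "form I d F" and s: "\<And>i. i \<in> I \<Longrightarrow> form J 1 (s i)"
  shows "form J d (subst_poly F s)"
  using F
proof (induction rule: form_induct)
  case (single a c)
  then have "(\<Sum>i\<in>keys a. lookup a i) = d" "keys a \<subseteq> I" by (auto simp: monomials_def mdeg_def)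
  moreover have "form J (\<Sum>i\<in>keys a. lookup a i) (monomial_value s a)"
    unfolding monomial_value_def
    using s \<open>keys a \<subseteq> I\<close> by (intro form_prod) (metis form_power mult.right_neutral subset_iff)
  ultimately show ?case
    by (simp add: subst_poly_single form_const_mult)
qed (simp_all add: subst_poly.homs form_add)

lemma eval_form_scale:
  assumes "form I d F"
  shows "eval_poly F (\<lambda>i. c * v i) = c ^ d * eval_poly F v"
  using assms
proof (induction rule: form_induct)
  case (single a b)
  have "(\<Prod>i\<in>keys a. c ^ lookup a i) = c ^ d"
    using single by (simp add: monomials_def mdeg_def flip: power_sum)
  then show ?case
    by (simp add: eval_poly_single monomial_value_def power_mult_distrib prod.distrib)
qed (simp_all add: eval_poly.homs algebra_simps)

lemma linear_form_expand:
  assumes "finite I" "form I 1 F"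
  shows "F = (\<Sum>i\<in>I. const_poly (lookup F (Poly_Mapping.single i 1)) * var_poly i)"
proof (rule poly_mapping_eqI)
  fix a
  have 1: "lookup (\<Sum>i\<in>I. const_poly (lookup F (Poly_Mapping.single i 1)) * var_poly i) a
     = (\<Sum>i\<in>I. lookup F (Poly_Mapping.single i 1) * (1 when Poly_Mapping.single i 1 = a))"
    by (simp add: lookup_sum lookup_const_times var_poly_def lookup_single)
  show "lookup F a = lookup (\<Sum>i\<in>I. const_poly (lookup F (Poly_Mapping.single i 1)) * var_poly i) a"
  proof (cases "\<exists>i\<in>I. a = Poly_Mapping.single i 1")
    case True
    then obtain i where i: "i \<in> I" "a = Poly_Mapping.single i 1" by blast
    have "Poly_Mapping.single j (1::nat) = a \<longleftrightarrow> j = i" for j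
      unfolding i by (metis inj_single injD lookup_single_eq lookup_single_not_eq one_neq_zero)
    then show ?thesis unfolding 1 using i assms(1) by (simp add: when_def if_distrib[of "\<lambda>x. _ * x"] cong: if_cong)
  next
    case False
    have "lookup F a = 0"
    proof (rule ccontr)
      assume "lookup F a \<noteq> 0"
      then have a: "keys a \<subseteq> I" "mdeg a = 1"
        using assms by (auto simp: form_def monomials_def in_keys_iff)
      then have s: "(\<Sum>i\<in>keys a. lookup a i) = 1" by (simp add: mdeg_def)
      then obtain i where i: "i \<in> keys a" "lookup a i = 1" "\<forall>j\<in>keys a. j \<noteq> i \<longrightarrow> lookup a j = 0"
        using sum_eq_1_iff[of "keys a" "lookup a"] by auto
      then have "a = Poly_Mapping.single i 1"
        by (intro poly_mapping_eqI) (metis in_keys_iff lookup_single_eq lookup_single_not_eq)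
      then show False using False a i by blast
    qed
    then show ?thesis unfolding 1 using False by (auto simp: when_def intro!: sum.neutral)
  qed
qed

lemma eval_linear_form:
  assumes "finite I" "form I 1 F"
  shows "eval_poly F v = (\<Sum>i\<in>I. lookup F (Poly_Mapping.single i 1) * v i)"
  by (subst linear_form_expand[OF assms]) (simp add: eval_poly.homs)

lemma pdiff_linear_form:
  assumes "finite I" "form I 1 F" "i \<in> I"
  shows "pdiff i F = const_poly (lookup F (Poly_Mapping.single i 1))"
  by (subst linear_form_expand[OF assms(1,2)])
    (simp add: pdiff_sum pdiff_mult pdiff_var assms if_distrib[of "\<lambda>x. _ * x"] cong: if_cong)

text \<open>
  Induction over the ring operations instead of the monomials. It suits statements in which both sides
  are derivations, such as the next lemma.
\<close>

lemma cpoly_ring_induct [case_names const var add mult]: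
  assumes const: "\<And>c. P (const_poly c)" and var: "\<And>i. P (var_poly i)"
    and add: "\<And>F G. P F \<Longrightarrow> P G \<Longrightarrow> P (F + G)" and mult: "\<And>F G. P F \<Longrightarrow> P G \<Longrightarrow> P (F * G)"
  shows "P F"
proof -
  have 0: "P 0" and 1: "P 1"
    using const[of 0] const[of 1] by (simp_all add: const_poly.homs)
  have sum: "P (sum f A)" if "\<And>x. x \<in> A \<Longrightarrow> P (f x)" for f and A :: "('a \<Rightarrow>\<^sub>0 nat) set"
    using that by (induction A rule: infinite_finite_induct) (auto intro: 0 add)
  have prod: "P (prod f A)" if "\<And>x. x \<in> A \<Longrightarrow> P (f x)" for f and A :: "'a set"
    using that by (induction A rule: infinite_finite_induct) (auto intro: 1 mult)
  have power: "P (f ^ k)" if "P f" for f and k :: nat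
    using that by (induction k) (auto intro: 1 mult)
  have "P (subst_poly F var_poly)"
    unfolding subst_poly_def by (intro sum mult const prod power var)
  then show ?thesis by (simp add: subst_var_polys)
qed

text \<open>
  Connects the formal partial derivatives with analysis in one variable: a restriction of a polynomial
  to a coordinate line can be differentiated in whatever form it is known.
\<close>

lemma eval_poly_has_partial_derivative:
  "((\<lambda>y. eval_poly F (x(j := y))) has_field_derivative eval_poly (pdiff j F) (x(j := y))) (at y)"
proof (induction F rule: cpoly_ring_induct)
  case (var i)
  then show ?case by (auto simp: pdiff_var eval_poly.homs)
next
  case (add F G)
  then show ?case by (auto simp: pdiff_add eval_poly.homs intro: DERIV_add)
next
  case (mult F G)
  then show ?case
    using DERIV_mult[OF mult] by (simp add: pdiff_mult eval_poly.homs add.commute mult.commute)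
qed (simp add: eval_poly.homs)

lemma eval_pdiff_prod_at_zero:
  assumes "finite A" "t \<in> A" "eval_poly (f t) x = 0"
  shows "eval_poly (pdiff i (prod f A)) x
    = eval_poly (pdiff i (f t)) x * (\<Prod>u\<in>A - {t}. eval_poly (f u) x)"
proof -
  have "eval_poly (pdiff i (prod f A)) x
      = (\<Sum>u\<in>A. eval_poly (pdiff i (f u)) x * (\<Prod>v\<in>A - {u}. eval_poly (f v) x))"
    by (simp add: pdiff_prod assms eval_poly.homs)
  also have "\<dots> = (\<Sum>u\<in>A. if u = t then eval_poly (pdiff i (f t)) x * (\<Prod>v\<in>A - {t}. eval_poly (f v) x) else 0)"
  proof (rule sum.cong[OF refl])
    fix u assume "u \<in> A"
    have "(\<Prod>v\<in>A - {u}. eval_poly (f v) x) = 0" if "u \<noteq> t"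
      using that assms by (intro prod_zero) auto
    then show "eval_poly (pdiff i (f u)) x * (\<Prod>v\<in>A - {u}. eval_poly (f v) x)
      = (if u = t then eval_poly (pdiff i (f t)) x * (\<Prod>v\<in>A - {t}. eval_poly (f v) x) else 0)"
      by simp
  qed
  also have "\<dots> = eval_poly (pdiff i (f t)) x * (\<Prod>u\<in>A - {t}. eval_poly (f u) x)"
    using assms by simp
  finally show ?thesis .
qed

section \<open>Homogeneous parts\<close>

lemma lookup_hom_part: "lookup (hom_part k F) a = (if mdeg a = k then lookup F a else 0)"
proof -
  have "finite {a \<in> keys F. mdeg a = k}" by simp
  then have "lookup (hom_part k F) a = (if a \<in> {a \<in> keys F. mdeg a = k} then lookup F a else 0)"
    unfolding hom_part_def by (simp add: lookup_sum lookup_single when_def)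
  then show ?thesis by (auto simp: in_keys_iff)
qed

lemma hom_part_add: "hom_part k (F + G) = hom_part k F + hom_part k G"
  by (rule poly_mapping_eqI) (simp add: lookup_hom_part lookup_add)

lemma hom_part_zero [simp]: "hom_part k 0 = 0"
  by (rule poly_mapping_eqI) (simp add: lookup_hom_part)

lemma hom_part_sum: "hom_part k (sum f A) = (\<Sum>x\<in>A. hom_part k (f x))"
  by (induction A rule: infinite_finite_induct) (simp_all add: hom_part_add)

lemma hom_part_form: "form I r F \<Longrightarrow> hom_part k F = (if k = r then F else 0)"
  by (rule poly_mapping_eqI) (auto simp: lookup_hom_part form_def monomials_def in_keys_iff subset_iff)

text \<open>
  Multiplying a form of degree \<open>r\<close> by \<open>B\<close> adds to its degree everywhere except at the constant term
  of \<open>B\<close>. This computes the tangent cone of a quadratic expression in functions without constant term.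
\<close>

lemma hom_part_times_form:
  assumes Q: "form I r Q" and k: "k \<le> r"
  shows "hom_part k (B * Q) = (if k = r then const_poly (lookup B 0) * Q else 0)"
proof (induction B rule: poly_mapping_additive_induct)
  case (single b c)
  have Q': "form UNIV r Q" using Q by (auto simp: form_def monomials_def)
  have "form UNIV (mdeg b) (Poly_Mapping.single b c)" by (simp add: form_single)
  from form_mult[OF this Q'] have *: "form UNIV (mdeg b + r) (Poly_Mapping.single b c * Q)" .
  show ?case
  proof (cases "b = 0")
    case True
    then show ?thesis using hom_part_form[OF *, of k] by (simp add: const_poly_def)
  next
    case False
    then have "mdeg b \<noteq> 0" by (simp add: mdeg_eq_0_iff)
    then show ?thesis
      using hom_part_form[OF *, of k] k False by (simp add: lookup_single const_poly.homs)
  qed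
next
  case (add f g)
  then show ?case
    by (simp add: distrib_right hom_part_add lookup_add const_poly.hom_add)
qed

lemma lookup_zero_eq_eval: "lookup F 0 = eval_poly F (\<lambda>_. 0)"
proof (induction F rule: poly_mapping_additive_induct)
  case (single a c)
  have "monomial_value (\<lambda>_. 0 :: complex) a = 0" if "a \<noteq> 0"
    using that by (auto simp: monomial_value_def in_keys_iff intro!: poly_mapping_eqI)
  then show ?case by (cases "a = 0") (simp_all add: eval_poly_single lookup_single)
qed (simp add: lookup_add eval_poly.homs)

section \<open>Homogeneous linear systems\<close>

text \<open>
  Gaussian elimination of one unknown by one equation. Rows and columns are arbitrary finite sets, since
  the systems below arise by deleting rows.
\<close>

lemma homogeneous_system_nontrivial_solution:
  fixes A :: "'r \<Rightarrow> 'c \<Rightarrow> complex"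
  assumes "finite R" "finite C" "card R < card C"
  shows "\<exists>x. (\<exists>j\<in>C. x j \<noteq> 0) \<and> (\<forall>j. j \<notin> C \<longrightarrow> x j = 0) \<and> (\<forall>r\<in>R. (\<Sum>j\<in>C. A r j * x j) = 0)"
  using assms
proof (induction R arbitrary: A C rule: finite_induct)
  case empty
  then obtain j where "j \<in> C" by (metis card.empty card_gt_0_iff ex_in_conv)
  then show ?case by (intro exI[of _ "\<lambda>i. if i = j then 1 else 0"]) auto
next
  case (insert r R)
  show ?case
  proof (cases "\<forall>j\<in>C. A r j = 0")
    case True
    have "card R < card C" using insert by simp
    from insert.IH[OF insert.prems(1) this, of A] True show ?thesis by auto
  next
    case False
    then obtain p where p: "p \<in> C" "A r p \<noteq> 0" by blast
    let ?B = "\<lambda>t j. A t j - A t p * A r j / A r p"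
    have "card R < card (C - {p})" using insert p by simp
    from insert.IH[OF _ this, of ?B] insert.prems
    obtain x where x: "\<exists>j\<in>C - {p}. x j \<noteq> 0" "\<forall>j. j \<notin> C - {p} \<longrightarrow> x j = 0"
      "\<forall>t\<in>R. (\<Sum>j\<in>C - {p}. ?B t j * x j) = 0" by auto
    define c where "c = - (\<Sum>j\<in>C - {p}. A r j * x j) / A r p"
    have split: "(\<Sum>j\<in>C. A t j * (x(p := c)) j) = A t p * c + (\<Sum>j\<in>C - {p}. A t j * x j)" for t
      using p insert.prems(1) by (simp add: sum.remove)
    have "(\<Sum>j\<in>C. A t j * (x(p := c)) j) = 0" if "t \<in> R" for t
    proof -
      have "0 = (\<Sum>j\<in>C - {p}. A t j * x j) - A t p / A r p * (\<Sum>j\<in>C - {p}. A r j * x j)"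
        using x(3) that by (simp add: sum_subtractf sum_distrib_left algebra_simps)
      then show ?thesis unfolding split by (simp add: c_def)
    qed
    moreover have "(\<Sum>j\<in>C. A r j * (x(p := c)) j) = 0"
      unfolding split using p by (simp add: c_def)
    ultimately show ?thesis
      using x(1,2) p by (intro exI[of _ "x(p := c)"]) auto
  qed
qed

section \<open>Polynomial one-parameter families\<close>

definition polynomial_function :: "(complex \<Rightarrow> complex) \<Rightarrow> bool" where
  "polynomial_function f \<longleftrightarrow> (\<exists>p. \<forall>s. f s = poly p s)"

lemma polynomial_function_const: "polynomial_function (\<lambda>s. c)"
  unfolding polynomial_function_def by (rule exI[of _ "[:c:]"]) simp

lemma polynomial_function_id: "polynomial_function (\<lambda>s. s)"
  unfolding polynomial_function_def by (rule exI[of _ "[:0, 1:]"]) simp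

lemma polynomial_function_add:
  "polynomial_function f \<Longrightarrow> polynomial_function g \<Longrightarrow> polynomial_function (\<lambda>s. f s + g s)"
  unfolding polynomial_function_def by (metis poly_add)

lemma polynomial_function_mult:
  "polynomial_function f \<Longrightarrow> polynomial_function g \<Longrightarrow> polynomial_function (\<lambda>s. f s * g s)"
  unfolding polynomial_function_def by (metis poly_mult)

text \<open>
  Applies to polynomial functions of one parameter and, later, of two.
\<close>

locale function_ring =
  fixes R :: "('p \<Rightarrow> complex) \<Rightarrow> bool"
  assumes const: "R (\<lambda>s. c)"
    and add: "R f \<Longrightarrow> R g \<Longrightarrow> R (\<lambda>s. f s + g s)"
    and mult: "R f \<Longrightarrow> R g \<Longrightarrow> R (\<lambda>s. f s * g s)"
begin

lemma sum: "(\<And>x. x \<in> A \<Longrightarrow> R (f x)) \<Longrightarrow> R (\<lambda>s. \<Sum>x\<in>A. f x s)"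
  by (induction A rule: infinite_finite_induct) (simp_all add: const add)

lemma prod: "(\<And>x. x \<in> A \<Longrightarrow> R (f x)) \<Longrightarrow> R (\<lambda>s. \<Prod>x\<in>A. f x s)"
  by (induction A rule: infinite_finite_induct) (simp_all add: const mult)

lemma power: "R f \<Longrightarrow> R (\<lambda>s. f s ^ k)"
  by (induction k) (simp_all add: const mult)

lemma eval_poly:
  assumes "\<And>a. R (\<lambda>s. f s a)"
  shows "R (\<lambda>s. eval_poly G (f s))"
  unfolding eval_poly_def by (intro sum mult const prod power assms)

end

interpretation polynomial_function: function_ring polynomial_function
  by unfold_locales
    (simp_all add: polynomial_function_const polynomial_function_add polynomial_function_mult)

text \<open>
  A polynomial whose coefficients depend polynomially on \<open>s\<close> is a polynomial in \<open>s\<close> over the polynomial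
  ring, evaluated at the constant \<open>s\<close>. In this form, closure under sums and products is immediate.
\<close>

definition polynomial_family :: "(complex \<Rightarrow> 'i cpoly) \<Rightarrow> bool" where
  "polynomial_family Q \<longleftrightarrow> (\<exists>q. \<forall>s. Q s = poly q (const_poly s))"

lemma polynomial_family_const: "polynomial_family (\<lambda>s. F)"
  unfolding polynomial_family_def by (rule exI[of _ "[:F:]"]) simp

lemma polynomial_family_param: "polynomial_family const_poly"
  unfolding polynomial_family_def by (rule exI[of _ "[:0, 1:]"]) simp

lemma polynomial_family_add:
  "polynomial_family P \<Longrightarrow> polynomial_family Q \<Longrightarrow> polynomial_family (\<lambda>s. P s + Q s)"
  unfolding polynomial_family_def by (metis poly_add)

lemma polynomial_family_mult:
  "polynomial_family P \<Longrightarrow> polynomial_family Q \<Longrightarrow> polynomial_family (\<lambda>s. P s * Q s)"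
  unfolding polynomial_family_def by (metis poly_mult)

lemma polynomial_family_sum:
  "(\<And>x. x \<in> A \<Longrightarrow> polynomial_family (f x)) \<Longrightarrow> polynomial_family (\<lambda>s. \<Sum>x\<in>A. f x s)"
  by (induction A rule: infinite_finite_induct)
    (simp_all add: polynomial_family_const polynomial_family_add)

lemma polynomial_family_prod:
  "(\<And>x. x \<in> A \<Longrightarrow> polynomial_family (f x)) \<Longrightarrow> polynomial_family (\<lambda>s. \<Prod>x\<in>A. f x s)"
  by (induction A rule: infinite_finite_induct)
    (simp_all add: polynomial_family_const polynomial_family_mult)

definition segment :: "'i cpoly \<Rightarrow> 'i cpoly \<Rightarrow> complex \<Rightarrow> 'i cpoly" where
  "segment F G s = F + const_poly s * (G - F)"

lemma segment_0 [simp]: "segment F G 0 = F"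
  by (simp add: segment_def const_poly.homs)

lemma segment_1 [simp]: "segment F G 1 = G"
  by (simp add: segment_def const_poly.homs)

lemma polynomial_family_segment: "polynomial_family (segment F G)"
  unfolding segment_def[abs_def]
  by (intro polynomial_family_add polynomial_family_mult polynomial_family_const
      polynomial_family_param)

lemma form_segment: "form I d F \<Longrightarrow> form I d G \<Longrightarrow> form I d (segment F G s)"
  unfolding segment_def by (intro form_add form_const_mult form_diff)

lemma polynomial_family_induct [consumes 1, case_names zero step]:
  assumes "polynomial_family Q"
    and "P (\<lambda>s. 0)"
    and "\<And>F Q. polynomial_family Q \<Longrightarrow> P Q \<Longrightarrow> P (\<lambda>s. F + const_poly s * Q s)"
  shows "P Q"
proof -
  from assms(1) obtain q where Q: "Q = (\<lambda>s. poly q (const_poly s))"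
    unfolding polynomial_family_def by auto
  have "P (\<lambda>s. poly q (const_poly s))"
  proof (induction q)
    case (pCons F q)
    have "polynomial_family (\<lambda>s. poly q (const_poly s))"
      unfolding polynomial_family_def by blast
    from assms(3)[OF this pCons(2), of F] show ?case by simp
  qed (simp add: assms(2))
  then show ?thesis by (simp add: Q)
qed

lemma polynomial_family_pdiff: "polynomial_family Q \<Longrightarrow> polynomial_family (\<lambda>s. pdiff i (Q s))"
proof (induction rule: polynomial_family_induct)
  case (step F Q)
  then show ?case
    by (simp add: pdiff_add pdiff_mult)
      (intro polynomial_family_add polynomial_family_mult polynomial_family_const
        polynomial_family_param)
qed (simp add: polynomial_family_const)

lemma polynomial_function_lookup:
  "polynomial_family Q \<Longrightarrow> polynomial_function (\<lambda>s. lookup (Q s) a)"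
proof (induction rule: polynomial_family_induct)
  case (step F Q)
  then show ?case
    by (simp add: lookup_add lookup_const_times)
      (intro polynomial_function_add polynomial_function_mult polynomial_function_const
        polynomial_function_id)
qed (simp add: polynomial_function_const)

lemma tendsto_eval_poly:
  assumes "\<And>i. ((\<lambda>r. X r i) \<longlongrightarrow> x i) \<F>"
  shows "((\<lambda>r. eval_poly F (X r)) \<longlongrightarrow> eval_poly F x) \<F>"
  unfolding eval_poly_def by (intro tendsto_intros assms)

lemma tendsto_eval_poly_family:
  assumes "polynomial_family Q" "(S \<longlongrightarrow> s) \<F>" "\<And>i. ((\<lambda>r. X r i) \<longlongrightarrow> x i) \<F>"
  shows "((\<lambda>r. eval_poly (Q (S r)) (X r)) \<longlongrightarrow> eval_poly (Q s) x) \<F>"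
  using assms(1)
proof (induction rule: polynomial_family_induct)
  case (step F Q)
  then show ?case
    by (simp add: eval_poly.homs) (intro tendsto_intros tendsto_eval_poly assms)
qed (simp add: eval_poly.homs)

section \<open>Compactness\<close>

lemma convergent_subsequence_coordinates:
  fixes X :: "nat \<Rightarrow> 'i \<Rightarrow> complex"
  assumes "finite I" "\<And>r i. i \<in> I \<Longrightarrow> norm (X r i) \<le> 1" "\<And>r i. i \<notin> I \<Longrightarrow> X r i = 0"
  shows "\<exists>\<rho> x. strict_mono (\<rho> :: nat \<Rightarrow> nat) \<and> (\<forall>i. (\<lambda>r. X (\<rho> r) i) \<longlonglongrightarrow> x i)"
proof -
  have "\<exists>\<rho> x. strict_mono (\<rho> :: nat \<Rightarrow> nat) \<and> (\<forall>i\<in>I. (\<lambda>r. X (\<rho> r) i) \<longlonglongrightarrow> x i)"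
    using assms(1,2)
  proof (induction I rule: finite_induct)
    case empty
    show ?case using strict_mono_id by auto
  next
    case (insert j I)
    have "\<exists>\<rho> x. strict_mono (\<rho> :: nat \<Rightarrow> nat) \<and> (\<forall>i\<in>I. (\<lambda>r. X (\<rho> r) i) \<longlonglongrightarrow> x i)"
      using insert by simp
    then obtain \<rho> x where \<rho>: "strict_mono (\<rho> :: nat \<Rightarrow> nat)"
      "\<And>i. i \<in> I \<Longrightarrow> (\<lambda>r. X (\<rho> r) i) \<longlonglongrightarrow> x i" by blast
    have "bounded (range (\<lambda>r. X (\<rho> r) j))"
      using insert.prems by (intro boundedI[where B = 1]) auto
    then obtain l \<sigma> where \<sigma>: "strict_mono (\<sigma> :: nat \<Rightarrow> nat)" "((\<lambda>r. X (\<rho> r) j) \<circ> \<sigma>) \<longlonglongrightarrow> l"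
      using bounded_imp_convergent_subsequence by blast
    have "(\<lambda>r. X ((\<rho> \<circ> \<sigma>) r) i) \<longlonglongrightarrow> (x(j := l)) i" if "i \<in> insert j I" for i
    proof (cases "i = j")
      case False
      then show ?thesis
        using that LIMSEQ_subseq_LIMSEQ[OF \<rho>(2) \<sigma>(1), of i] by (simp add: o_def)
    qed (use \<sigma> in \<open>simp add: o_def\<close>)
    then show ?case using strict_mono_o[OF \<rho>(1) \<sigma>(1)] by blast
  qed
  then obtain \<rho> x where \<rho>: "strict_mono (\<rho> :: nat \<Rightarrow> nat)"
    "\<And>i. i \<in> I \<Longrightarrow> (\<lambda>r. X (\<rho> r) i) \<longlonglongrightarrow> x i" by blast
  have "(\<lambda>r. X (\<rho> r) i) \<longlonglongrightarrow> (if i \<in> I then x i else 0)" for i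
    using \<rho>(2) assms(3) by (cases "i \<in> I") auto
  then show ?thesis using \<rho>(1) by (intro exI[of _ \<rho>] exI[of _ "\<lambda>i. if i \<in> I then x i else 0"]) auto
qed

text \<open>
  Vectors are plain functions here, because limits are taken coordinatewise; the support condition makes
  them the coordinate vectors of a finite-dimensional space.
\<close>

definition nonzero_on :: "'i set \<Rightarrow> ('i \<Rightarrow> complex) \<Rightarrow> bool" where
  "nonzero_on I x \<longleftrightarrow> (\<forall>i. i \<notin> I \<longrightarrow> x i = 0) \<and> (\<exists>i. x i \<noteq> 0)"

definition unit_on :: "'i set \<Rightarrow> ('i \<Rightarrow> complex) \<Rightarrow> bool" where
  "unit_on I x \<longleftrightarrow> (\<forall>i. i \<notin> I \<longrightarrow> x i = 0) \<and> (\<Sum>i\<in>I. norm (x i)) = 1"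

lemma unit_on_imp_nonzero_on: "unit_on I x \<Longrightarrow> nonzero_on I x"
  unfolding unit_on_def nonzero_on_def by (metis norm_zero sum.neutral zero_neq_one)

lemma normalize_nonzero_on:
  assumes "nonzero_on I x" "finite I"
  obtains c where "c \<noteq> 0" "unit_on I (\<lambda>i. c * x i)"
proof -
  define N where "N = (\<Sum>i\<in>I. norm (x i))"
  have "N > 0"
  proof -
    obtain i where "x i \<noteq> 0" "i \<in> I" using assms unfolding nonzero_on_def by blast
    then show ?thesis using assms unfolding N_def by (intro sum_pos2[of I i]) auto
  qed
  have "(\<Sum>i\<in>I. norm (complex_of_real (1 / N) * x i)) = (1 / N) * (\<Sum>i\<in>I. norm (x i))"
    using \<open>N > 0\<close> unfolding sum_distrib_left
    by (intro sum.cong refl) (simp only: norm_mult norm_of_real, simp)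
  also have "\<dots> = 1" using \<open>N > 0\<close> by (simp flip: N_def)
  finally show ?thesis
    using assms \<open>N > 0\<close>
    by (intro that[of "of_real (1 / N)"]) (auto simp: unit_on_def nonzero_on_def)
qed

lemma unit_on_subsequence:
  fixes X :: "nat \<Rightarrow> 'i \<Rightarrow> complex"
  assumes "finite I" "\<And>r. unit_on I (X r)"
  obtains \<rho> x where "strict_mono (\<rho> :: nat \<Rightarrow> nat)" "\<And>i. (\<lambda>r. X (\<rho> r) i) \<longlonglongrightarrow> x i" "unit_on I x"
proof -
  have "norm (X r i) \<le> 1" if "i \<in> I" for r i
    using assms that member_le_sum[of i I "\<lambda>i. norm (X r i)"] by (simp add: unit_on_def)
  moreover have "X r i = 0" if "i \<notin> I" for r i
    using assms that by (simp add: unit_on_def)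
  ultimately obtain \<rho> x where \<rho>: "strict_mono (\<rho> :: nat \<Rightarrow> nat)" "\<And>i. (\<lambda>r. X (\<rho> r) i) \<longlonglongrightarrow> x i"
    using convergent_subsequence_coordinates[OF assms(1), of X] by blast
  have "x i = 0" if "i \<notin> I" for i
    using \<rho>(2)[of i] \<open>\<And>r i. i \<notin> I \<Longrightarrow> X r i = 0\<close>[OF that] LIMSEQ_unique[OF _ tendsto_const] by auto
  moreover have "(\<lambda>r. \<Sum>i\<in>I. norm (X (\<rho> r) i)) \<longlonglongrightarrow> (\<Sum>i\<in>I. norm (x i))"
    by (intro tendsto_intros \<rho>)
  then have "(\<Sum>i\<in>I. norm (x i)) = 1"
    using assms(2) LIMSEQ_unique[OF _ tendsto_const] by (simp add: unit_on_def)
  ultimately show ?thesis using \<rho> by (intro that) (auto simp: unit_on_def)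
qed

section \<open>Quadratic expressions in several polynomials\<close>

definition quadric :: "nat \<Rightarrow> (nat \<Rightarrow> nat \<Rightarrow> 'i cpoly) \<Rightarrow> (nat \<Rightarrow> 'i cpoly) \<Rightarrow> 'i cpoly" where
  "quadric n a P = (\<Sum>j=1..n. \<Sum>l=1..n. a j l * P j * P l)"

lemma eval_quadric:
  "eval_poly (quadric n a P) x
     = (\<Sum>j=1..n. \<Sum>l=1..n. eval_poly (a j l) x * eval_poly (P j) x * eval_poly (P l) x)"
  by (simp add: quadric_def eval_poly.homs)

lemma subst_quadric:
  "subst_poly (quadric n a P) s = quadric n (\<lambda>j l. subst_poly (a j l) s) (\<lambda>j. subst_poly (P j) s)"
  by (simp add: quadric_def subst_poly.homs)

text \<open>
  The first sum is quadratic in the values \<open>P j\<close>, the second linear. The linear term decides the behaviour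
  near the common zeros of the \<open>P j\<close>.
\<close>

lemma eval_pdiff_quadric:
  "eval_poly (pdiff i (quadric n a P)) x
     = (\<Sum>j=1..n. \<Sum>l=1..n. eval_poly (pdiff i (a j l)) x * eval_poly (P j) x * eval_poly (P l) x)
     + (\<Sum>j=1..n. eval_poly (P j) x * (\<Sum>l=1..n. eval_poly ((a j l + a l j) * pdiff i (P l)) x))"
proof -
  have "(\<Sum>j=1..n. \<Sum>l=1..n. eval_poly (a j l * pdiff i (P j) * P l) x)
      = (\<Sum>j=1..n. \<Sum>l=1..n. eval_poly (a l j * pdiff i (P l) * P j) x)"
    by (rule sum.swap)
  then show ?thesis
    by (simp add: quadric_def pdiff_sum pdiff_mult eval_poly.homs sum_distrib_left algebra_simps
        sum.distrib)
qed

lemma form_quadric: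
  assumes "\<And>j l. j \<in> {1..n} \<Longrightarrow> l \<in> {1..n} \<Longrightarrow> form I e (a j l)" "\<And>j. j \<in> {1..n} \<Longrightarrow> form I k (P j)"
  shows "form I (e + 2 * k) (quadric n a P)"
  unfolding quadric_def
proof (intro form_sum)
  fix j l assume "j \<in> {1..n}" "l \<in> {1..n}"
  then have "form I (e + k + k) (a j l * P j * P l)"
    by (intro form_mult assms)
  then show "form I (e + 2 * k) (a j l * P j * P l)"
    by (simp add: mult_2 add.assoc)
qed

lemma polynomial_family_quadric:
  assumes "\<And>j l. polynomial_family (a j l)" "\<And>j. polynomial_family (P j)"
  shows "polynomial_family (\<lambda>s. quadric n (\<lambda>j l. a j l s) (\<lambda>j. P j s))"
  unfolding quadric_def by (intro polynomial_family_sum polynomial_family_mult assms)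

section \<open>Open conditions on the base locus\<close>

text \<open>
  The matrix \<open>M\<close> (with rows \<open>R\<close> and columns \<open>1, ..., n\<close>) is injective at every common zero of the \<open>P j\<close>.
  Different \<open>M\<close> express that the \<open>P j\<close> have independent differentials, that the symmetrised matrix of
  coefficients \<open>a\<close> is invertible, and that the linear term of the gradient is injective in the values \<open>P j\<close>.
\<close>

definition full_rank :: "'r set \<Rightarrow> nat \<Rightarrow> ('r \<Rightarrow> nat \<Rightarrow> nat cpoly) \<Rightarrow> (nat \<Rightarrow> nat cpoly) \<Rightarrow> bool" where
  "full_rank R n M P \<longleftrightarrow> (\<forall>x w. nonzero_on {..n} x \<longrightarrow> (\<forall>j\<in>{1..n}. eval_poly (P j) x = 0) \<longrightarrow>
     (\<forall>i\<in>R. (\<Sum>j=1..n. w j * eval_poly (M i j) x) = 0) \<longrightarrow> (\<forall>j\<in>{1..n}. w j = 0))"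

definition singular_only_on_base ::
  "nat \<Rightarrow> (nat \<Rightarrow> nat \<Rightarrow> nat cpoly) \<Rightarrow> (nat \<Rightarrow> nat cpoly) \<Rightarrow> bool" where
  "singular_only_on_base n a P \<longleftrightarrow> (\<forall>x. nonzero_on {..n} x \<longrightarrow> eval_poly (quadric n a P) x = 0 \<longrightarrow>
     (\<forall>i\<le>n. eval_poly (pdiff i (quadric n a P)) x = 0) \<longrightarrow> (\<forall>j\<in>{1..n}. eval_poly (P j) x = 0))"

lemma full_rankD:
  assumes "full_rank R n M P" "nonzero_on {..n} x" "\<And>j. j \<in> {1..n} \<Longrightarrow> eval_poly (P j) x = 0"
    and "\<And>i. i \<in> R \<Longrightarrow> (\<Sum>j=1..n. w j * eval_poly (M i j) x) = 0" "j \<in> {1..n}"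
  shows "w j = 0"
  using assms unfolding full_rank_def by blast

abbreviation "transversal n P \<equiv> full_rank {..n} n (\<lambda>i j. pdiff i (P j)) P"

abbreviation "nondegenerate n a P \<equiv> full_rank {1..n} n (\<lambda>l j. a j l + a l j) P"

abbreviation "hessian_injective n a P \<equiv>
  full_rank {..n} n (\<lambda>i j. \<Sum>l=1..n. (a j l + a l j) * pdiff i (P l)) P"

lemma hessian_injectiveI:
  assumes "transversal n P" "nondegenerate n a P"
  shows "hessian_injective n a P"
  unfolding full_rank_def
proof (intro allI impI)
  fix x w
  assume x: "nonzero_on {..n} x" "\<forall>j\<in>{1..n}. eval_poly (P j) x = 0"
    and w: "\<forall>i\<in>{..n}. (\<Sum>j=1..n. w j * eval_poly (\<Sum>l=1..n. (a j l + a l j) * pdiff i (P l)) x) = 0"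
  let ?v = "\<lambda>l. \<Sum>j=1..n. w j * eval_poly (a j l + a l j) x"
  have "(\<Sum>l=1..n. ?v l * eval_poly (pdiff i (P l)) x) = 0" if "i \<in> {..n}" for i
  proof -
    have "(\<Sum>l=1..n. ?v l * eval_poly (pdiff i (P l)) x)
        = (\<Sum>l=1..n. \<Sum>j=1..n. w j * eval_poly ((a j l + a l j) * pdiff i (P l)) x)"
      by (simp add: sum_distrib_right eval_poly.homs mult.assoc)
    also have "\<dots> = (\<Sum>j=1..n. \<Sum>l=1..n. w j * eval_poly ((a j l + a l j) * pdiff i (P l)) x)"
      by (rule sum.swap)
    also have "\<dots> = 0"
      using w that by (simp add: eval_poly.homs sum_distrib_left)
    finally show ?thesis .
  qed
  then have v: "?v l = 0" if "l \<in> {1..n}" for l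
    using full_rankD[OF assms(1) x(1), of ?v l] x(2) that by blast
  show "\<forall>j\<in>{1..n}. w j = 0"
  proof
    fix j assume j: "j \<in> {1..n}"
    show "w j = 0"
      using full_rankD[OF assms(2) x(1), of w j] x(2) v j by blast
  qed
qed

text \<open>
  If the condition failed for parameters \<open>S r\<close> tending to \<open>s\<close>, there would be points and kernel vectors of
  norm one witnessing this. By compactness they accumulate at a witness for \<open>s\<close>. Homogeneity is what allows
  the points to be normalised.
\<close>

lemma full_rank_open:
  fixes S :: "nat \<Rightarrow> complex"
  assumes M: "\<And>i j. i \<in> R \<Longrightarrow> polynomial_family (M i j)"
    "\<And>i j s. i \<in> R \<Longrightarrow> j \<in> {1..n} \<Longrightarrow> form {..n} e (M i j s)"
    and P: "\<And>j. polynomial_family (P j)" "\<And>j s. j \<in> {1..n} \<Longrightarrow> form {..n} k (P j s)"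
    and S: "S \<longlonglongrightarrow> s"
    and rank: "full_rank R n (\<lambda>i j. M i j s) (\<lambda>j. P j s)"
  shows "\<forall>\<^sub>F r in sequentially. full_rank R n (\<lambda>i j. M i j (S r)) (\<lambda>j. P j (S r))"
proof (rule ccontr)
  assume "\<not> ?thesis"
  then obtain \<rho> where \<rho>: "strict_mono (\<rho> :: nat \<Rightarrow> nat)"
    and bad: "\<And>r. \<not> full_rank R n (\<lambda>i j. M i j (S (\<rho> r))) (\<lambda>j. P j (S (\<rho> r)))"
    using not_eventually_sequentiallyD by blast
  define bad_pair where "bad_pair r x w \<longleftrightarrow> unit_on {..n} x \<and> unit_on {1..n} w \<and>
      (\<forall>j\<in>{1..n}. eval_poly (P j (S (\<rho> r))) x = 0) \<and>
      (\<forall>i\<in>R. (\<Sum>j=1..n. w j * eval_poly (M i j (S (\<rho> r))) x) = 0)" for r x w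
  have "\<exists>x w. bad_pair r x w" for r
  proof -
    obtain x w where x: "nonzero_on {..n} x" "\<forall>j\<in>{1..n}. eval_poly (P j (S (\<rho> r))) x = 0"
      and w: "\<forall>i\<in>R. (\<Sum>j=1..n. w j * eval_poly (M i j (S (\<rho> r))) x) = 0" "\<exists>j\<in>{1..n}. w j \<noteq> 0"
      using bad[of r] unfolding full_rank_def by blast
    define w' where "w' j = (if j \<in> {1..n} then w j else 0)" for j
    obtain c where c: "unit_on {..n} (\<lambda>i. c * x i)"
      using normalize_nonzero_on[OF x(1)] by blast
    have "nonzero_on {1..n} w'"
    proof -
      obtain j where "j \<in> {1..n}" "w j \<noteq> 0" using w(2) by blast
      then have "w' j \<noteq> 0" by (simp add: w'_def)
      moreover have "w' i = 0" if "i \<notin> {1..n}" for i using that by (simp only: w'_def if_False)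
      ultimately show ?thesis unfolding nonzero_on_def by blast
    qed
    from normalize_nonzero_on[OF this finite_atLeastAtMost]
    obtain b where b: "unit_on {1..n} (\<lambda>i. b * w' i)" by blast
    have "(\<Sum>j=1..n. b * w' j * eval_poly (M i j (S (\<rho> r))) (\<lambda>i. c * x i)) = 0" if i: "i \<in> R" for i
    proof -
      have "(\<Sum>j=1..n. b * w' j * eval_poly (M i j (S (\<rho> r))) (\<lambda>i. c * x i))
          = (\<Sum>j=1..n. (b * c ^ e) * (w j * eval_poly (M i j (S (\<rho> r))) x))"
        by (intro sum.cong refl) (simp add: w'_def eval_form_scale[OF M(2)[OF i]] mult_ac)
      then show ?thesis using w(1) i by (simp flip: sum_distrib_left)
    qed
    moreover have "\<forall>j\<in>{1..n}. eval_poly (P j (S (\<rho> r))) (\<lambda>i. c * x i) = 0"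
      using x(2) by (simp add: eval_form_scale[OF P(2)])
    ultimately show ?thesis using b c unfolding bad_pair_def by blast
  qed
  then obtain X W where XW: "\<And>r. bad_pair r (X r) (W r)"
    by metis
  have X: "\<And>r. unit_on {..n} (X r)" and W: "\<And>r. unit_on {1..n} (W r)"
    and X0: "\<And>r j. j \<in> {1..n} \<Longrightarrow> eval_poly (P j (S (\<rho> r))) (X r) = 0"
    and W0: "\<And>r i. i \<in> R \<Longrightarrow> (\<Sum>j=1..n. W r j * eval_poly (M i j (S (\<rho> r))) (X r)) = 0"
    using XW unfolding bad_pair_def by blast+
  obtain \<sigma> x where \<sigma>: "strict_mono (\<sigma> :: nat \<Rightarrow> nat)"
    "\<And>i. (\<lambda>r. X (\<sigma> r) i) \<longlonglongrightarrow> x i" "unit_on {..n} x"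
    using unit_on_subsequence[of "{..n}" X] X by blast
  obtain \<tau> w where \<tau>: "strict_mono (\<tau> :: nat \<Rightarrow> nat)"
    "\<And>i. (\<lambda>r. W (\<sigma> (\<tau> r)) i) \<longlonglongrightarrow> w i" "unit_on {1..n} w"
    using unit_on_subsequence[of "{1..n}" "\<lambda>r. W (\<sigma> r)"] W by blast
  have x: "(\<lambda>r. X (\<sigma> (\<tau> r)) i) \<longlonglongrightarrow> x i" for i
    using LIMSEQ_subseq_LIMSEQ[OF \<sigma>(2) \<tau>(1)] by (simp add: o_def)
  have s: "(\<lambda>r. S (\<rho> (\<sigma> (\<tau> r)))) \<longlonglongrightarrow> s"
    using LIMSEQ_subseq_LIMSEQ[OF S strict_mono_o[OF strict_mono_o[OF \<rho> \<sigma>(1)] \<tau>(1)]]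
    by (simp add: o_def)
  have "eval_poly (P j s) x = 0" if "j \<in> {1..n}" for j
    using tendsto_eval_poly_family[where X = "\<lambda>r. X (\<sigma> (\<tau> r))" and x = x, OF P(1) s x, of j] X0[OF that]
    by (simp add: tendsto_const_iff)
  moreover have "(\<Sum>j=1..n. w j * eval_poly (M i j s) x) = 0" if i: "i \<in> R" for i
  proof -
    have "(\<lambda>r. \<Sum>j=1..n. W (\<sigma> (\<tau> r)) j * eval_poly (M i j (S (\<rho> (\<sigma> (\<tau> r))))) (X (\<sigma> (\<tau> r))))
        \<longlonglongrightarrow> (\<Sum>j=1..n. w j * eval_poly (M i j s) x)"
      by (intro tendsto_intros \<tau> tendsto_eval_poly_family[OF M(1)[OF i] s] x)
    then show ?thesis using W0[OF i] by (simp add: tendsto_const_iff)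
  qed
  ultimately have "w j = 0" if "j \<in> {1..n}" for j
    using full_rankD[OF rank unit_on_imp_nonzero_on[OF \<sigma>(3)]] that by blast
  then show False using \<tau>(3) by (simp add: unit_on_def)
qed

text \<open>
  A limit of singular points outside the base locus is a singular point for the limit parameter, so it lies
  on the base locus, where all \<open>P j\<close> tend to zero. Dividing the gradient by the norm of the vector
  \<open>(P 1, ..., P n)\<close> makes its quadratic term disappear in the limit and leaves a unit vector in the kernel of
  the linear term, against \<open>hessian_injective\<close>.
\<close>

lemma singular_only_on_base_open:
  fixes S :: "nat \<Rightarrow> complex"
  assumes a: "\<And>j l. polynomial_family (a j l)"
    "\<And>j l s. j \<in> {1..n} \<Longrightarrow> l \<in> {1..n} \<Longrightarrow> form {..n} e (a j l s)"
    and P: "\<And>j. polynomial_family (P j)" "\<And>j s. j \<in> {1..n} \<Longrightarrow> form {..n} k (P j s)"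
    and S: "S \<longlonglongrightarrow> s"
    and base: "singular_only_on_base n (\<lambda>j l. a j l s) (\<lambda>j. P j s)"
    and hess: "hessian_injective n (\<lambda>j l. a j l s) (\<lambda>j. P j s)"
  shows "\<forall>\<^sub>F r in sequentially. singular_only_on_base n (\<lambda>j l. a j l (S r)) (\<lambda>j. P j (S r))"
proof (rule ccontr)
  define F where "F s = quadric n (\<lambda>j l. a j l s) (\<lambda>j. P j s)" for s
  have F: "polynomial_family F"
    unfolding F_def[abs_def] by (intro polynomial_family_quadric a P)
  have F_form: "form {..n} (e + 2 * k) (F s)" for s
    unfolding F_def by (intro form_quadric a P)
  assume "\<not> ?thesis"
  then obtain \<rho> where \<rho>: "strict_mono (\<rho> :: nat \<Rightarrow> nat)"
    and bad: "\<And>r. \<not> singular_only_on_base n (\<lambda>j l. a j l (S (\<rho> r))) (\<lambda>j. P j (S (\<rho> r)))"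
    using not_eventually_sequentiallyD by blast
  \<comment> \<open>\<open>N\<close> is a scalar that turns the vector of the values \<open>P j\<close> into a unit vector \<open>w\<close>.\<close>
  define bad_triple where "bad_triple r x w N \<longleftrightarrow> unit_on {..n} x \<and> unit_on {1..n} w \<and> N \<noteq> 0 \<and>
      eval_poly (F (S (\<rho> r))) x = 0 \<and> (\<forall>i\<le>n. eval_poly (pdiff i (F (S (\<rho> r)))) x = 0) \<and>
      (\<forall>j\<in>{1..n}. w j = N * eval_poly (P j (S (\<rho> r))) x)" for r x w N
  have "\<exists>x w N. bad_triple r x w N" for r
  proof -
    obtain x where x: "nonzero_on {..n} x" "eval_poly (F (S (\<rho> r))) x = 0"
      "\<forall>i\<le>n. eval_poly (pdiff i (F (S (\<rho> r)))) x = 0"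
      and nz: "\<exists>j\<in>{1..n}. eval_poly (P j (S (\<rho> r))) x \<noteq> 0"
      using bad[of r] unfolding singular_only_on_base_def F_def by blast
    obtain c where c: "c \<noteq> 0" "unit_on {..n} (\<lambda>i. c * x i)"
      using normalize_nonzero_on[OF x(1)] by blast
    define v where "v j = (if j \<in> {1..n} then eval_poly (P j (S (\<rho> r))) (\<lambda>i. c * x i) else 0)" for j
    have "nonzero_on {1..n} v"
    proof -
      obtain j where j: "j \<in> {1..n}" "eval_poly (P j (S (\<rho> r))) x \<noteq> 0" using nz by blast
      then have "v j \<noteq> 0" using c(1) unfolding v_def by (simp add: eval_form_scale[OF P(2)[OF j(1)]])
      moreover have "v i = 0" if "i \<notin> {1..n}" for i using that by (simp only: v_def if_False)
      ultimately show ?thesis unfolding nonzero_on_def by blast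
    qed
    from normalize_nonzero_on[OF this finite_atLeastAtMost]
    obtain N where N: "N \<noteq> 0" "unit_on {1..n} (\<lambda>i. N * v i)" by blast
    have "eval_poly (F (S (\<rho> r))) (\<lambda>i. c * x i) = 0"
      "\<forall>i\<le>n. eval_poly (pdiff i (F (S (\<rho> r)))) (\<lambda>i. c * x i) = 0"
      using x by (simp_all add: eval_form_scale[OF F_form] eval_form_scale[OF form_pdiff[OF F_form]])
    then show ?thesis using c N
      by (intro exI[of _ "\<lambda>i. c * x i"] exI[of _ "\<lambda>i. N * v i"] exI[of _ N])
        (auto simp: v_def bad_triple_def)
  qed
  then obtain X W N where XWN: "\<And>r. bad_triple r (X r) (W r) (N r)"
    by metis
  have X: "\<And>r. unit_on {..n} (X r)" and W: "\<And>r. unit_on {1..n} (W r)"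
    and N: "\<And>r. N r \<noteq> 0" "\<And>r j. j \<in> {1..n} \<Longrightarrow> W r j = N r * eval_poly (P j (S (\<rho> r))) (X r)"
    and X0: "\<And>r. eval_poly (F (S (\<rho> r))) (X r) = 0"
      "\<And>r i. i \<le> n \<Longrightarrow> eval_poly (pdiff i (F (S (\<rho> r)))) (X r) = 0"
    using XWN unfolding bad_triple_def by blast+
  obtain \<sigma> x where \<sigma>: "strict_mono (\<sigma> :: nat \<Rightarrow> nat)"
    "\<And>i. (\<lambda>r. X (\<sigma> r) i) \<longlonglongrightarrow> x i" "unit_on {..n} x"
    using unit_on_subsequence[of "{..n}" X] X by blast
  obtain \<tau> w where \<tau>: "strict_mono (\<tau> :: nat \<Rightarrow> nat)"
    "\<And>i. (\<lambda>r. W (\<sigma> (\<tau> r)) i) \<longlonglongrightarrow> w i" "unit_on {1..n} w"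
    using unit_on_subsequence[of "{1..n}" "\<lambda>r. W (\<sigma> r)"] W by blast
  let ?\<theta> = "\<lambda>r. \<sigma> (\<tau> r)"
  have x: "(\<lambda>r. X (?\<theta> r) i) \<longlonglongrightarrow> x i" for i
    using LIMSEQ_subseq_LIMSEQ[OF \<sigma>(2) \<tau>(1)] by (simp add: o_def)
  have s: "(\<lambda>r. S (\<rho> (?\<theta> r))) \<longlonglongrightarrow> s"
    using LIMSEQ_subseq_LIMSEQ[OF S strict_mono_o[OF strict_mono_o[OF \<rho> \<sigma>(1)] \<tau>(1)]]
    by (simp add: o_def)
  note lim = tendsto_eval_poly_family[where X = "\<lambda>r. X (?\<theta> r)" and x = x, OF _ s x]
  have "eval_poly (F s) x = 0"
    using lim[OF F] X0(1) by (simp add: tendsto_const_iff)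
  moreover have "eval_poly (pdiff i (F s)) x = 0" if "i \<le> n" for i
    using lim[OF polynomial_family_pdiff[OF F], of i] X0(2)[OF that] by (simp add: tendsto_const_iff)
  ultimately have Px: "eval_poly (P j s) x = 0" if "j \<in> {1..n}" for j
    using base unit_on_imp_nonzero_on[OF \<sigma>(3)] that
    unfolding singular_only_on_base_def F_def by blast
  let ?H = "\<lambda>i j s. \<Sum>l=1..n. (a j l s + a l j s) * pdiff i (P l s)"
  have H: "polynomial_family (?H i j)" for i j
    by (intro polynomial_family_sum polynomial_family_mult polynomial_family_add a
        polynomial_family_pdiff P)
  have "(\<Sum>j=1..n. w j * eval_poly (?H i j s) x) = 0" if i: "i \<in> {..n}" for i
  proof -
    let ?A = "\<lambda>r. \<Sum>j=1..n. \<Sum>l=1..n. eval_poly (pdiff i (a j l (S (\<rho> r)))) (X r) *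
      eval_poly (P j (S (\<rho> r))) (X r) * W r l"
    let ?B = "\<lambda>r. \<Sum>j=1..n. W r j * eval_poly (?H i j (S (\<rho> r))) (X r)"
    have "?A r + ?B r = 0" for r
    proof -
      have "?A r + ?B r = N r * eval_poly (pdiff i (F (S (\<rho> r)))) (X r)"
        unfolding F_def eval_pdiff_quadric distrib_left sum_distrib_left
        by (intro arg_cong2[where f = "(+)"] sum.cong refl)
          (simp_all add: N(2) eval_poly.homs sum_distrib_left mult_ac)
      then show ?thesis using X0(2) i by simp
    qed
    moreover have "(\<lambda>r. ?A (?\<theta> r) + ?B (?\<theta> r)) \<longlonglongrightarrow>
      (\<Sum>j=1..n. \<Sum>l=1..n. eval_poly (pdiff i (a j l s)) x * eval_poly (P j s) x * w l) +
      (\<Sum>j=1..n. w j * eval_poly (?H i j s) x)"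
      by (intro tendsto_intros lim \<tau>(2) polynomial_family_pdiff a P H)
    ultimately show ?thesis
      by (simp add: Px tendsto_const_iff)
  qed
  then have "w j = 0" if "j \<in> {1..n}" for j
    using full_rankD[OF hess unit_on_imp_nonzero_on[OF \<sigma>(3)] Px] that by blast
  then show False using \<tau>(3) by (simp add: unit_on_def)
qed

section \<open>An explicit nodal hypersurface\<close>

text \<open>
  The coefficients are chosen one after the other: \<open>c (n + 1)\<close> has to avoid \<open>0\<close> and the finitely many quotients
  \<open>- s / v\<close> of sums \<open>s\<close> that the earlier coefficients can produce.
\<close>

lemma generic_coefficients:
  fixes V :: "complex set" and n :: nat
  assumes "finite V"
  shows "\<exists>c. (\<forall>j. c j \<noteq> 0) \<and> (\<forall>v. (\<forall>j\<in>{1..n}. v j \<in> V) \<longrightarrow> (\<Sum>j=1..n. c j * v j) = 0 \<longrightarrow> (\<forall>j\<in>{1..n}. v j = 0))"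
proof (induction n)
  case 0
  show ?case by (intro exI[of _ "\<lambda>j. 1"]) auto
next
  case (Suc n)
  then obtain c where c: "\<And>j. c j \<noteq> 0"
    and IH: "\<And>v. (\<forall>j\<in>{1..n}. v j \<in> V) \<Longrightarrow> (\<Sum>j=1..n. c j * v j) = 0 \<Longrightarrow> (\<forall>j\<in>{1..n}. v j = 0)"
    by blast
  define S where "S = (\<lambda>v. \<Sum>j=1..n. c j * v j) ` (PiE {1..n} (\<lambda>_. V))"
  have "finite S" unfolding S_def using assms by (intro finite_imageI finite_PiE) auto
  then have "finite (insert 0 ((\<lambda>(s, v). - s / v) ` (S \<times> V)))"
    using assms by simp
  then obtain b where b: "b \<notin> insert 0 ((\<lambda>(s, v). - s / v) ` (S \<times> V))"
    using infinite_UNIV_char_0 ex_new_if_finite by blast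
  have "v j = 0" if v: "\<forall>j\<in>{1..Suc n}. v j \<in> V"
    and s: "(\<Sum>j=1..Suc n. (c(Suc n := b)) j * v j) = 0" and j: "j \<in> {1..Suc n}" for v j
  proof -
    define s where "s = (\<Sum>j=1..n. c j * v j)"
    have "(\<Sum>j=1..n. (c(Suc n := b)) j * v j) = s"
      unfolding s_def by (rule sum.cong) auto
    then have sum: "s + b * v (Suc n) = 0"
      using s by simp
    have "s = (\<Sum>j=1..n. c j * restrict v {1..n} j)"
      unfolding s_def by (rule sum.cong) auto
    then have "s \<in> S"
      unfolding S_def using v by (intro image_eqI[where x = "restrict v {1..n}"]) auto
    have 0: "v (Suc n) = 0"
    proof (rule ccontr)
      assume "v (Suc n) \<noteq> 0"
      moreover have "b * v (Suc n) = - s"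
        using sum by (simp add: eq_neg_iff_add_eq_0 add.commute)
      ultimately have "b = - s / v (Suc n)"
        using nonzero_eq_divide_eq[of "v (Suc n)" b "- s"] by blast
      then have "b \<in> (\<lambda>(s, v). - s / v) ` (S \<times> V)"
        using \<open>s \<in> S\<close> v by (intro image_eqI[where x = "(s, v (Suc n))"]) auto
      then show False using b by blast
    qed
    then have "(\<Sum>j=1..n. c j * v j) = 0" using sum by (simp add: s_def)
    moreover have "\<forall>j\<in>{1..n}. v j \<in> V" using v by auto
    ultimately have IHv: "\<forall>j\<in>{1..n}. v j = 0" using IH by blast
    show ?thesis
    proof (cases "j = Suc n")
      case False
      then have "j \<in> {1..n}" using j by auto
      then show ?thesis using IHv by blast
    qed (simp add: 0)
  qed
  moreover have "(c(Suc n := b)) j \<noteq> 0" for j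
    using c b by auto
  ultimately show ?case by blast
qed

text \<open>
  The example is \<open>F = \<Sum> c_j (x_j^e + 2 x_0^e) p_j^2\<close> with \<open>p_j\<close> the product of \<open>x_j - t x_0\<close> for \<open>t < k\<close>. Its
  variables are separated: for fixed \<open>x_0\<close> it is a combination of values of one function of one variable,
  whose critical values are finite in number. Coefficients \<open>c_j\<close> that admit no relation between these
  critical values exclude singular points outside the grid. The factor \<open>x_j^e + 2 x_0^e\<close> raises the degree;
  it has no multiple roots and is nonzero on the grid because \<open>t^e + 2 > 0\<close>.
\<close>

definition grid_line :: "nat \<Rightarrow> nat \<Rightarrow> nat cpoly" where
  "grid_line j t = var_poly j - const_poly (of_nat t) * var_poly 0"

definition grid_base :: "nat \<Rightarrow> nat \<Rightarrow> nat cpoly" where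
  "grid_base k j = (\<Prod>t<k. grid_line j t)"

definition grid_weight :: "nat \<Rightarrow> (nat \<Rightarrow> complex) \<Rightarrow> nat \<Rightarrow> nat \<Rightarrow> nat cpoly" where
  "grid_weight e c j l = (if j = l
     then const_poly (c j) * (var_poly j ^ e + const_poly 2 * var_poly 0 ^ e) else 0)"

lemma form_grid_line: "j \<le> n \<Longrightarrow> form {..n} 1 (grid_line j t)"
  unfolding grid_line_def by (intro form_diff form_const_mult form_var) auto

lemma form_grid_base: "j \<le> n \<Longrightarrow> form {..n} k (grid_base k j)"
  using form_prod[of "{..<k}" "{..n}" "\<lambda>_. 1" "grid_line j"] form_grid_line
  unfolding grid_base_def by simp

lemma form_grid_weight: "j \<le> n \<Longrightarrow> form {..n} e (grid_weight e c j l)"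
  unfolding grid_weight_def
  using form_power[OF form_var[of _ "{..n}"], where k = e]
  by (auto intro!: form_add form_const_mult)

lemma eval_grid_base: "eval_poly (grid_base k j) x = (\<Prod>t<k. x j - of_nat t * x 0)"
  by (simp add: grid_base_def grid_line_def eval_poly.homs)

lemma eval_grid_weight: "eval_poly (grid_weight e c j j) x = c j * (x j ^ e + 2 * x 0 ^ e)"
  by (simp add: grid_weight_def eval_poly.homs)

lemma grid_point:
  assumes "nonzero_on {..n} x" "\<And>j. j \<in> {1..n} \<Longrightarrow> eval_poly (grid_base k j) x = 0"
  shows "x 0 \<noteq> 0" and "j \<in> {1..n} \<Longrightarrow> \<exists>t<k. x j = of_nat t * x 0"
proof -
  show *: "\<exists>t<k. x j = of_nat t * x 0" if "j \<in> {1..n}" for j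
    using assms(2)[OF that] by (auto simp: eval_grid_base)
  show "x 0 \<noteq> 0"
  proof
    assume "x 0 = 0"
    then have "x j = 0" for j
      using *[of j] assms(1) by (cases "j = 0"; cases "j \<le> n") (auto simp: nonzero_on_def)
    then show False using assms(1) by (simp add: nonzero_on_def)
  qed
qed

lemma transversal_grid: "transversal n (grid_base k)"
  unfolding full_rank_def
proof (intro allI impI ballI)
  fix x w j
  assume x: "nonzero_on {..n} x" "\<forall>j\<in>{1..n}. eval_poly (grid_base k j) x = 0"
    and w: "\<forall>i\<in>{..n}. (\<Sum>j=1..n. w j * eval_poly (pdiff i (grid_base k j)) x) = 0"
    and j: "j \<in> {1..n}"
  have x0: "x 0 \<noteq> 0" using grid_point(1)[OF x(1)] x(2) by blast
  obtain t where t: "t < k" "x j = of_nat t * x 0" using grid_point(2)[OF x(1) _ j] x(2) by blast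
  have "pdiff j (grid_base k l) = 0" if "l \<noteq> j" for l
    unfolding grid_base_def using that j
    by (simp add: pdiff_prod grid_line_def diff_conv_add_uminus pdiff_add pdiff_var pdiff_mult
        flip: const_poly.hom_uminus mult_minus_left)
  then have "(\<Sum>l=1..n. w l * eval_poly (pdiff j (grid_base k l)) x)
      = (\<Sum>l=1..n. if l = j then w j * eval_poly (pdiff j (grid_base k j)) x else 0)"
    by (intro sum.cong) (auto simp: eval_poly.homs)
  then have "w j * eval_poly (pdiff j (grid_base k j)) x = 0"
    using w j by simp
  moreover have "eval_poly (pdiff j (grid_base k j)) x \<noteq> 0"
  proof -
    have "pdiff j (grid_line j t) = 1"
      using j by (simp add: grid_line_def diff_conv_add_uminus pdiff_add pdiff_var pdiff_mult
        flip: const_poly.hom_uminus mult_minus_left)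
    then have "eval_poly (pdiff j (grid_base k j)) x = (\<Prod>u\<in>{..<k} - {t}. x j - of_nat u * x 0)"
      unfolding grid_base_def using t
      by (subst eval_pdiff_prod_at_zero[of _ t]) (simp_all add: eval_poly.homs grid_line_def)
    also have "\<dots> = (\<Prod>u\<in>{..<k} - {t}. (of_nat t - of_nat u) * x 0)"
      by (simp add: t left_diff_distrib)
    also have "\<dots> \<noteq> 0" using x0 by auto
    finally show ?thesis .
  qed
  ultimately show "w j = 0" by simp
qed

lemma of_nat_power_plus_2_nonzero: "(of_nat t :: complex) ^ e + 2 \<noteq> 0"
proof
  assume "(of_nat t :: complex) ^ e + 2 = 0"
  then have "(of_nat (t ^ e + 2) :: complex) = 0" by (simp add: add.commute)
  then have "t ^ e + 2 = 0" by (simp only: of_nat_eq_0_iff)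
  then show False by simp
qed

lemma nondegenerate_grid:
  assumes c: "\<And>j. c j \<noteq> 0"
  shows "nondegenerate n (grid_weight e c) (grid_base k)"
  unfolding full_rank_def
proof (intro allI impI ballI)
  fix x w j
  assume x: "nonzero_on {..n} x" "\<forall>j\<in>{1..n}. eval_poly (grid_base k j) x = 0"
    and w: "\<forall>l\<in>{1..n}. (\<Sum>j=1..n. w j * eval_poly (grid_weight e c j l + grid_weight e c l j) x) = 0"
    and j: "j \<in> {1..n}"
  have x0: "x 0 \<noteq> 0" using grid_point(1)[OF x(1)] x(2) by blast
  obtain t where t: "x j = of_nat t * x 0" using grid_point(2)[OF x(1) _ j] x(2) by blast
  have "(\<Sum>l=1..n. w l * eval_poly (grid_weight e c l j + grid_weight e c j l) x)
      = (\<Sum>l=1..n. if l = j then w j * (2 * eval_poly (grid_weight e c j j) x) else 0)"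
    by (intro sum.cong) (auto simp: eval_poly.homs grid_weight_def)
  then have "w j * (2 * eval_poly (grid_weight e c j j) x) = 0"
    using w j by simp
  moreover have "eval_poly (grid_weight e c j j) x = c j * (x 0 ^ e * (of_nat t ^ e + 2))"
    by (simp add: eval_grid_weight t power_mult_distrib algebra_simps)
  ultimately show "w j = 0"
    using c x0 of_nat_power_plus_2_nonzero by simp
qed

text \<open>
  The function of one variable through which the example depends on each \<open>x_j\<close> when \<open>x_0 = z\<close>.
\<close>

definition grid_profile :: "nat \<Rightarrow> nat \<Rightarrow> complex \<Rightarrow> complex poly" where
  "grid_profile e k z = (monom 1 e + [:2 * z ^ e:]) * (\<Prod>t<k. [:- of_nat t * z, 1:]) ^ 2"

lemma eval_quadric_grid:
  "eval_poly (quadric n (grid_weight e c) (grid_base k)) x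
     = (\<Sum>j=1..n. c j * poly (grid_profile e k (x 0)) (x j))"
proof -
  have "(\<Sum>l=1..n. eval_poly (grid_weight e c j l) x * eval_poly (grid_base k j) x * eval_poly (grid_base k l) x)
      = c j * poly (grid_profile e k (x 0)) (x j)" if j: "j \<in> {1..n}" for j
  proof -
    have "(\<Sum>l=1..n. eval_poly (grid_weight e c j l) x * eval_poly (grid_base k j) x * eval_poly (grid_base k l) x)
        = (\<Sum>l=1..n. if l = j then eval_poly (grid_weight e c j j) x * eval_poly (grid_base k j) x ^ 2 else 0)"
      by (intro sum.cong) (auto simp: grid_weight_def eval_poly.homs power2_eq_square)
    then show ?thesis
      using j by (simp add: eval_grid_weight eval_grid_base grid_profile_def poly_prod poly_monom
          algebra_simps)
  qed
  then show ?thesis unfolding eval_quadric by (rule sum.cong[OF refl])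
qed

lemma eval_pdiff_quadric_grid:
  assumes j: "j \<in> {1..n}"
  shows "eval_poly (pdiff j (quadric n (grid_weight e c) (grid_base k))) x
     = c j * poly (pderiv (grid_profile e k (x 0))) (x j)"
proof -
  let ?F = "quadric n (grid_weight e c) (grid_base k)"
  have "eval_poly ?F (x(j := y))
      = (\<Sum>l\<in>{1..n} - {j}. c l * poly (grid_profile e k (x 0)) (x l)) + c j * poly (grid_profile e k (x 0)) y" for y
    using j by (simp add: eval_quadric_grid sum.remove[of _ j])
  then have "((\<lambda>y. eval_poly ?F (x(j := y))) has_field_derivative
      c j * poly (pderiv (grid_profile e k (x 0))) (x j)) (at (x j))"
    by (auto intro!: derivative_eq_intros poly_DERIV)
  from DERIV_unique[OF this eval_poly_has_partial_derivative] show ?thesis by simp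
qed

text \<open>
  The multiple roots of the profile are the roots of its squared factor: the other factor \<open>X^e + 2\<close> has
  simple roots only, since for \<open>e > 0\<close> its derivative vanishes at most at \<open>0\<close>.
\<close>

lemma grid_profile_critical_zero:
  assumes "poly (grid_profile e k 1) v = 0" "poly (pderiv (grid_profile e k 1)) v = 0"
  shows "(\<Prod>t<k. v - of_nat t) = 0"
proof (rule ccontr)
  define p where "p = (\<Prod>t<k. [:- of_nat t * (1::complex), 1:])"
  define b where "b = monom 1 e + [:2 :: complex:]"
  have g: "grid_profile e k 1 = b * p ^ 2" by (simp add: grid_profile_def p_def b_def)
  assume "(\<Prod>t<k. v - of_nat t) \<noteq> 0"
  then have p: "poly p v \<noteq> 0" by (simp add: p_def poly_prod)
  then have b: "poly b v = 0" using assms(1) by (simp add: g)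
  have "poly (pderiv (b * p ^ 2)) v = poly (p ^ 2) v * poly (pderiv b) v"
    using b by (simp only: pderiv_mult poly_add poly_mult mult_zero_left add_0)
  then have "poly p v ^ 2 * poly (pderiv b) v = 0"
    using assms(2) by (simp only: g poly_power)
  then have "poly (pderiv b) v = 0" using p by simp
  then have "of_nat e * v ^ (e - 1) = 0"
    by (simp add: b_def pderiv_add pderiv_monom poly_monom pderiv_pCons)
  then have "e = 0 \<or> v = 0 \<and> e \<noteq> 0" by auto
  moreover have "v ^ e + 2 = 0" using b by (simp add: b_def poly_monom)
  ultimately show False by (auto simp: zero_power)
qed

lemma pderiv_grid_profile_nonzero:
  assumes "k \<ge> 1"
  shows "pderiv (grid_profile e k 1) \<noteq> 0"
proof
  assume "pderiv (grid_profile e k 1) = 0"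
  then have "Polynomial.degree (grid_profile e k 1) = 0"
    by (simp only: pderiv_eq_0_iff)
  then obtain b where b: "grid_profile e k 1 = [:b:]"
    by (rule degree_eq_zeroE)
  have "(\<Prod>t<k. - of_nat t :: complex) = 0"
    using assms by (intro prod_zero) (auto intro!: bexI[of _ 0])
  then have "poly (grid_profile e k 1) 0 = 0"
    by (simp add: grid_profile_def poly_prod)
  moreover have "poly (grid_profile e k 1) (of_nat k) \<noteq> 0"
    using of_nat_power_plus_2_nonzero[of k e]
    by (simp add: grid_profile_def poly_prod poly_monom)
  ultimately show False unfolding b by simp
qed

text \<open>
  At a singular point every \<open>x_j\<close> is critical for the profile. On \<open>x_0 = 0\<close> the profile is a multiple of
  \<open>X^(e+2k)\<close>, so that all \<open>x_j\<close> vanish. Elsewhere the point can be scaled to \<open>x_0 = 1\<close>. The equation of the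
  hypersurface is then a relation between critical values, which are therefore all zero, and the \<open>x_j\<close> are multiple roots of the profile.
\<close>

lemma singular_only_on_base_grid:
  assumes "k \<ge> 1"
  shows "\<exists>c. (\<forall>j. c j \<noteq> 0) \<and> singular_only_on_base n (grid_weight e c) (grid_base k)"
proof -
  let ?h = "grid_profile e k 1"
  let ?V = "poly ?h ` {v. poly (pderiv ?h) v = 0}"
  have "finite ?V"
    by (intro finite_imageI poly_roots_finite pderiv_grid_profile_nonzero assms)
  from generic_coefficients[OF this, of n] obtain c where c: "\<forall>j. c j \<noteq> 0"
    and gen: "\<forall>v. (\<forall>j\<in>{1..n}. v j \<in> ?V) \<longrightarrow> (\<Sum>j=1..n. c j * v j) = 0 \<longrightarrow> (\<forall>j\<in>{1..n}. v j = 0)"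
    by (elim exE conjE)
  let ?F = "quadric n (grid_weight e c) (grid_base k)"
  have F: "form {..n} (e + 2 * k) ?F"
    by (intro form_quadric form_grid_weight form_grid_base) auto
  have base: "eval_poly (grid_base k j) x = 0"
    if x: "nonzero_on {..n} x" and F0: "eval_poly ?F x = 0"
      and dF: "\<forall>i\<le>n. eval_poly (pdiff i ?F) x = 0" and j: "j \<in> {1..n}" for x j
  proof (cases "x 0 = 0")
    case True
    have crit: "poly (pderiv (grid_profile e k 0)) (x l) = 0" if "l \<in> {1..n}" for l
      using dF that eval_pdiff_quadric_grid[OF that, of e c k x] c True by simp
    have "grid_profile e k 0 = smult (1 + 2 * 0 ^ e) (monom 1 (e + 2 * k))"
      by (cases "e = 0") (simp_all add: grid_profile_def zero_power monom_altdef power_add mult.commute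
          flip: power_mult)
    then have "poly (pderiv (grid_profile e k 0)) v
        = (1 + 2 * 0 ^ e) * (of_nat (e + 2 * k) * v ^ (e + 2 * k - 1))" for v
      by (simp add: pderiv_smult pderiv_monom poly_monom)
    moreover have "(1 + 2 * 0 ^ e :: complex) \<noteq> 0" by (cases "e = 0") (auto simp: zero_power)
    moreover have "(of_nat (e + 2 * k) :: complex) \<noteq> 0" using assms by (subst of_nat_eq_0_iff) simp
    ultimately have "x l = 0" if "l \<in> {1..n}" for l
      using crit[OF that] by simp
    moreover have "l \<in> {1..n} \<or> l = 0 \<or> l \<notin> {..n}" for l by auto
    ultimately have "x l = 0" for l
      using True x unfolding nonzero_on_def by metis
    then show ?thesis using x by (simp add: nonzero_on_def)
  next
    case False
    let ?y = "\<lambda>i. (1 / x 0) * x i"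
    have "eval_poly ?F ?y = 0" using F0 by (subst eval_form_scale[OF F]) simp
    then have 0: "(\<Sum>l=1..n. c l * poly ?h (?y l)) = 0"
      using False by (simp add: eval_quadric_grid)
    have crit: "poly (pderiv ?h) (?y l) = 0" if "l \<in> {1..n}" for l
    proof -
      have "eval_poly (pdiff l ?F) ?y = 0"
        using dF that by (subst eval_form_scale[OF form_pdiff[OF F]]) simp
      then show ?thesis using eval_pdiff_quadric_grid[OF that, of e c k ?y] c False by simp
    qed
    then have "\<forall>l\<in>{1..n}. poly ?h (?y l) \<in> ?V" by blast
    then have "poly ?h (?y j) = 0" using gen[rule_format, of "\<lambda>l. poly ?h (?y l)" j] 0 j by blast
    then have "(\<Prod>t<k. ?y j - of_nat t) = 0"
      using grid_profile_critical_zero crit[OF j] by blast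
    then obtain t where t: "t < k" "?y j - of_nat t = 0"
      unfolding prod_zero_iff[OF finite_lessThan] by blast
    from t(2) have "x j - of_nat t * x 0 = 0" using False by (simp add: field_simps)
    then show ?thesis unfolding eval_grid_base using \<open>t < k\<close> by (intro prod_zero) auto
  qed
  have "singular_only_on_base n (grid_weight e c) (grid_base k)"
    unfolding singular_only_on_base_def by (intro allI impI ballI) (rule base)
  then show ?thesis using c by (intro exI[of _ c] conjI)
qed

section \<open>Projective points\<close>

lemma lookup_scale [simp]: "lookup (Poly_Mapping.map ((*) c) v) i = c * (lookup v i :: complex)"
  by (simp add: Poly_Mapping.map.rep_eq when_def)

lemma proj_point_self: "v \<in> proj_point v"
  unfolding proj_point_def by (auto intro!: exI[of _ 1] poly_mapping_eqI)

lemma proj_point_eqI: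
  assumes "c \<noteq> 0" "\<And>i. lookup w i = c * lookup v i"
  shows "proj_point w = proj_point v"
proof -
  have w: "w = Poly_Mapping.map ((*) c) v"
    using assms(2) by (intro poly_mapping_eqI) simp
  have "\<exists>b'. u = Poly_Mapping.map ((*) b') v \<and> b' \<noteq> 0"
    if "u = Poly_Mapping.map ((*) b) w" "b \<noteq> 0" for u b
    using that assms(1) by (intro exI[of _ "b * c"]) (auto simp: w intro!: poly_mapping_eqI)
  moreover have "\<exists>b'. u = Poly_Mapping.map ((*) b') w \<and> b' \<noteq> 0"
    if "u = Poly_Mapping.map ((*) b) v" "b \<noteq> 0" for u b
    using that assms(1) by (intro exI[of _ "b / c"]) (auto simp: w intro!: poly_mapping_eqI)
  ultimately show ?thesis unfolding proj_point_def by blast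
qed

lemma nonzero_on_lookup: "v \<in> nonzero_vectors I \<Longrightarrow> nonzero_on I (lookup v)"
  unfolding nonzero_vectors_def nonzero_on_def
  by (auto simp: in_keys_iff intro!: poly_mapping_eqI)

lemma nonzero_on_vector:
  assumes "finite I" "nonzero_on I x"
  obtains v where "v \<in> nonzero_vectors I" "lookup v = x"
proof -
  have "{i. x i \<noteq> 0} \<subseteq> I" using assms(2) by (auto simp: nonzero_on_def)
  then have "finite {i. x i \<noteq> 0}" using assms(1) finite_subset by blast
  then have l: "lookup (Abs_poly_mapping x) = x" by simp
  have "Abs_poly_mapping x \<noteq> 0"
    using assms(2) l unfolding nonzero_on_def by (metis lookup_zero)
  moreover have "keys (Abs_poly_mapping x) \<subseteq> I"
    using \<open>{i. x i \<noteq> 0} \<subseteq> I\<close> by (auto simp: in_keys_iff l)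
  ultimately show ?thesis using l by (intro that[of "Abs_poly_mapping x"]) (auto simp: nonzero_vectors_def)
qed

lemma openin_principal:
  assumes "form I e G"
  shows "openin (zariski_topology I) (proj_point ` {v \<in> nonzero_vectors I. eval_poly G (lookup v) \<noteq> 0})"
  unfolding zariski_topology_def by (rule topology_generated_by_Basis) (use assms in blast)

text \<open>
  Two vectors that are not proportional have a nonzero two by two minor. Expanding it along one of them
  gives a linear form that vanishes at this one only.
\<close>

lemma zariski_separation:
  assumes v: "v \<in> nonzero_vectors I" and w: "w \<in> nonzero_vectors I"
    and ne: "proj_point v \<noteq> proj_point w"
  shows "\<exists>T. openin (zariski_topology I) T \<and> proj_point v \<in> T \<and> proj_point w \<notin> T"
proof -
  have "\<exists>i j. lookup v i * lookup w j - lookup v j * lookup w i \<noteq> 0"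
  proof (rule ccontr)
    assume "\<not> ?thesis"
    then have *: "lookup v i * lookup w j = lookup v j * lookup w i" for i j by simp
    obtain i where i: "lookup w i \<noteq> 0"
      using nonzero_on_lookup[OF w] by (auto simp: nonzero_on_def)
    have eq: "lookup v j = (lookup v i / lookup w i) * lookup w j" for j
      using *[of i j] i by (simp add: field_simps)
    have "lookup v i / lookup w i \<noteq> 0"
      using eq nonzero_on_lookup[OF v] unfolding nonzero_on_def by (metis mult_zero_left)
    then show False using proj_point_eqI eq ne by blast
  qed
  then obtain i j where ij: "lookup v i * lookup w j - lookup v j * lookup w i \<noteq> 0" by blast
  define G where "G = const_poly (lookup w j) * var_poly i - const_poly (lookup w i) * var_poly j"
  have "i \<in> I \<and> j \<in> I \<or> lookup v i = 0 \<and> lookup w i = 0 \<or> lookup v j = 0 \<and> lookup w j = 0"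
    using nonzero_on_lookup[OF v] nonzero_on_lookup[OF w] by (auto simp: nonzero_on_def)
  then have "i \<in> I" "j \<in> I" using ij by auto
  then have G: "form I 1 G" unfolding G_def by (intro form_diff form_const_mult form_var)
  let ?T = "proj_point ` {v \<in> nonzero_vectors I. eval_poly G (lookup v) \<noteq> 0}"
  have "eval_poly G (lookup v) \<noteq> 0" using ij by (simp add: G_def eval_poly.homs mult.commute)
  then have "proj_point v \<in> ?T" using v by blast
  moreover have "proj_point w \<notin> ?T"
  proof
    assume "proj_point w \<in> ?T"
    then obtain u where u: "proj_point w = proj_point u" "eval_poly G (lookup u) \<noteq> 0" by blast
    then have "u \<in> proj_point w" using proj_point_self by blast
    then obtain c where c: "u = Poly_Mapping.map ((*) c) w" by (auto simp: proj_point_def)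
    have "eval_poly G (lookup u) = 0" by (simp add: c G_def eval_poly.homs)
    then show False using u by blast
  qed
  ultimately show ?thesis using openin_principal[OF G] by blast
qed

lemma finite_imp_not_in_derived_set:
  assumes "finite S" "S \<subseteq> proj_point ` nonzero_vectors I" "X \<in> proj_point ` nonzero_vectors I"
  shows "X \<notin> zariski_topology I derived_set_of S"
proof
  assume X: "X \<in> zariski_topology I derived_set_of S"
  define separates where
    "separates Y T \<longleftrightarrow> openin (zariski_topology I) T \<and> X \<in> T \<and> Y \<notin> T" for Y T
  have "\<forall>Y\<in>S - {X}. \<exists>T. separates Y T"
  proof
    fix Y assume Y: "Y \<in> S - {X}"
    obtain v w where "X = proj_point v" "Y = proj_point w" "v \<in> nonzero_vectors I" "w \<in> nonzero_vectors I"
      using assms(2,3) Y by blast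
    then show "\<exists>T. separates Y T"
      using zariski_separation[of v I w] Y unfolding separates_def by blast
  qed
  then obtain T where "\<forall>Y\<in>S - {X}. separates Y (T Y)"
    by (rule bchoice[THEN exE])
  then have T: "openin (zariski_topology I) (T Y)" "X \<in> T Y" "Y \<notin> T Y" if "Y \<in> S - {X}" for Y
    using that unfolding separates_def by blast+
  let ?U = "(\<Inter>Y\<in>S - {X}. T Y) \<inter> topspace (zariski_topology I)"
  have "openin (zariski_topology I) ?U"
    using assms(1) by (intro openin_INT T(1)) auto
  moreover have "X \<in> ?U" using T(2) X by (auto simp: in_derived_set_of)
  ultimately obtain Y where Y: "Y \<noteq> X" "Y \<in> S" "Y \<in> ?U"
    using X unfolding in_derived_set_of by metis
  then have "Y \<in> T Y" by blast
  then show False using T(3) Y by blast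
qed

section \<open>Zariski closure\<close>

text \<open>
  The principal open sets are closed under finite intersections, since principal open sets intersect in the
  one of the product; so they are not just a subbasis but a basis.
\<close>

lemma zariski_open_contains_principal:
  assumes "openin (zariski_topology I) T" "v \<in> nonzero_vectors I" "proj_point v \<in> T"
  shows "\<exists>e G. form I e G \<and> eval_poly G (lookup v) \<noteq> 0 \<and>
    (\<forall>w\<in>nonzero_vectors I. eval_poly G (lookup w) \<noteq> 0 \<longrightarrow> proj_point w \<in> T)"
proof -
  have "generate_topology_on
     {proj_point ` {v \<in> nonzero_vectors I. eval_poly G (lookup v) \<noteq> 0} | G. \<exists>e. form I e G} T"
    using assms(1) unfolding zariski_topology_def by (rule openin_topology_generated_by)
  then show ?thesis
    using assms(3)
  proof (induction rule: generate_topology_on.induct)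
    case Empty
    then show ?case by simp
  next
    case (Int S T)
    then obtain e G e' G' where "form I e G" "eval_poly G (lookup v) \<noteq> 0"
      "\<forall>w\<in>nonzero_vectors I. eval_poly G (lookup w) \<noteq> 0 \<longrightarrow> proj_point w \<in> S"
      "form I e' G'" "eval_poly G' (lookup v) \<noteq> 0"
      "\<forall>w\<in>nonzero_vectors I. eval_poly G' (lookup w) \<noteq> 0 \<longrightarrow> proj_point w \<in> T"
      by blast
    then show ?case
      by (intro exI[of _ "e + e'"] exI[of _ "G * G'"]) (auto simp: eval_poly.homs form_mult)
  next
    case (UN K)
    then obtain S where S: "S \<in> K" "proj_point v \<in> S" by blast
    from UN.IH[OF this] S(1) show ?case by blast
  next
    case (Basis S)
    then obtain G e where G: "S = proj_point ` {v \<in> nonzero_vectors I. eval_poly G (lookup v) \<noteq> 0}"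
      "form I e G" by blast
    then obtain u where u: "proj_point v = proj_point u" "eval_poly G (lookup u) \<noteq> 0"
      using Basis by blast
    then have "u \<in> proj_point v" using proj_point_self by blast
    then obtain c where c: "u = Poly_Mapping.map ((*) c) v" by (auto simp: proj_point_def)
    have "lookup u = (\<lambda>i. c * lookup v i)" by (auto simp: c)
    then have "eval_poly G (lookup v) \<noteq> 0" using u(2) eval_form_scale[OF G(2), of c "lookup v"] by auto
    then show ?case using G by blast
  qed
qed

text \<open>
  Multiplying \<open>G\<close> by a coordinate that is nonzero at \<open>v\<close> makes it vanish at the origin. This spares later
  arguments from having to exclude the zero vector.
\<close>

lemma in_zariski_closureI:
  assumes v: "v \<in> nonzero_vectors I"
    and S: "\<And>G. eval_poly G (lookup v) \<noteq> 0 \<Longrightarrow> eval_poly G (lookup 0) = 0 \<Longrightarrow>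
      \<exists>w\<in>nonzero_vectors I. eval_poly G (lookup w) \<noteq> 0 \<and> proj_point w \<in> S"
  shows "proj_point v \<in> zariski_topology I closure_of S"
  unfolding in_closure_of
proof (intro conjI allI impI)
  have "proj_point v \<in> proj_point ` {v \<in> nonzero_vectors I. eval_poly 1 (lookup v) \<noteq> 0}"
    using v by (auto simp: eval_poly.homs)
  then show "proj_point v \<in> topspace (zariski_topology I)"
    using openin_subset[OF openin_principal[OF form_one]] by blast
next
  fix T assume "proj_point v \<in> T \<and> openin (zariski_topology I) T"
  then obtain e G where G: "form I e G" "eval_poly G (lookup v) \<noteq> 0"
    "\<forall>w\<in>nonzero_vectors I. eval_poly G (lookup w) \<noteq> 0 \<longrightarrow> proj_point w \<in> T"
    using zariski_open_contains_principal[OF _ v] by blast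
  obtain i where i: "lookup v i \<noteq> 0"
    using nonzero_on_lookup[OF v] unfolding nonzero_on_def by blast
  obtain w where "w \<in> nonzero_vectors I" "eval_poly (var_poly i * G) (lookup w) \<noteq> 0" "proj_point w \<in> S"
    using S[of "var_poly i * G"] i G(2) by (auto simp: eval_poly.homs)
  then show "\<exists>y. y \<in> S \<and> y \<in> T" using G(3) by (auto simp: eval_poly.homs)
qed

section \<open>The singularities of a quadratic expression\<close>

lemma sum_only_two:
  fixes f :: "'a \<Rightarrow> complex"
  assumes "finite A" "r \<in> A" "t \<in> A" "r \<noteq> t" "\<And>i. i \<in> A - {r, t} \<Longrightarrow> f i = 0"
  shows "sum f A = f r + f t"
proof -
  have "sum f A = sum f {r, t}"
    using assms by (intro sum.mono_neutral_right) auto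
  then show ?thesis using assms by simp
qed

text \<open>
  The assumptions are those that hold for general \<open>a\<close> and \<open>L\<close>. They determine the singular locus of
  \<open>quadric n a P\<close> completely: it is the set of common zeros of the \<open>P j\<close>, a point of which is the same as a
  choice of one linear factor from each \<open>P j\<close>.
\<close>

locale nodal_system =
  fixes n k e :: nat
    and L :: "nat \<Rightarrow> nat \<Rightarrow> nat cpoly"
    and a :: "nat \<Rightarrow> nat \<Rightarrow> nat cpoly"
    and P :: "nat \<Rightarrow> nat cpoly"
  defines "P \<equiv> \<lambda>j. \<Prod>t<k. L j t"
  assumes n: "n \<ge> 1"
    and L: "\<And>j t. j \<in> {1..n} \<Longrightarrow> form {..n} 1 (L j t)"
    and a: "\<And>j l. j \<in> {1..n} \<Longrightarrow> l \<in> {1..n} \<Longrightarrow> form {..n} e (a j l)"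
    and base: "singular_only_on_base n a P"
    and transversal: "transversal n P"
    and nondegenerate: "nondegenerate n a P"
begin

abbreviation F :: "nat cpoly" where "F \<equiv> quadric n a P"

definition base_point :: "(nat \<Rightarrow> complex) \<Rightarrow> bool" where
  "base_point x \<longleftrightarrow> nonzero_on {..n} x \<and> (\<forall>j\<in>{1..n}. eval_poly (P j) x = 0)"

abbreviation coef :: "nat cpoly \<Rightarrow> nat \<Rightarrow> complex" where
  "coef G r \<equiv> lookup G (Poly_Mapping.single r 1)"

lemma form_P: "j \<in> {1..n} \<Longrightarrow> form {..n} k (P j)"
  using form_prod[of "{..<k}" "{..n}" "\<lambda>_. 1" "L j"] L unfolding P_def by simp

lemma form_F: "form {..n} (e + 2 * k) F"
  by (intro form_quadric a form_P)

lemma eval_L: "j \<in> {1..n} \<Longrightarrow> eval_poly (L j t) x = (\<Sum>r\<le>n. coef (L j t) r * x r)"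
  by (intro eval_linear_form L finite_atMost)

lemma eval_P: "eval_poly (P j) x = (\<Prod>t<k. eval_poly (L j t) x)"
  by (simp add: P_def eval_poly.homs)

text \<open>
  Where the factor \<open>L j t\<close> vanishes, the differential of \<open>P j\<close> is this multiple of the one of \<open>L j t\<close>.
\<close>

definition cofactor :: "nat \<Rightarrow> nat \<Rightarrow> (nat \<Rightarrow> complex) \<Rightarrow> complex" where
  "cofactor j t x = (\<Prod>u\<in>{..<k} - {t}. eval_poly (L j u) x)"

lemma eval_pdiff_P:
  assumes "j \<in> {1..n}" "t < k" "eval_poly (L j t) x = 0" "r \<le> n"
  shows "eval_poly (pdiff r (P j)) x = coef (L j t) r * cofactor j t x"
proof -
  have "pdiff r (L j t) = const_poly (coef (L j t) r)"
    using assms by (intro pdiff_linear_form[where I = "{..n}"] L) auto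
  then show ?thesis
    unfolding P_def cofactor_def using assms
    by (subst eval_pdiff_prod_at_zero[of _ t]) auto
qed

lemma base_pointD:
  assumes "base_point x" "j \<in> {1..n}"
  shows "\<exists>t<k. eval_poly (L j t) x = 0"
  using assms by (auto simp: base_point_def eval_P)

lemma full_rankD_base:
  assumes "full_rank R n M P" "base_point x" "\<And>i. i \<in> R \<Longrightarrow> (\<Sum>j=1..n. w j * eval_poly (M i j) x) = 0"
    and "j \<in> {1..n}"
  shows "w j = 0"
  using full_rankD[OF assms(1), of x w j] assms(2-) unfolding base_point_def by blast

lemma cofactor_nonzero:
  assumes x: "base_point x" and j: "j \<in> {1..n}" and t: "t < k" "eval_poly (L j t) x = 0"
  shows "cofactor j t x \<noteq> 0"
proof
  assume K: "cofactor j t x = 0"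
  define w where "w l = (if l = j then 1 else 0 :: complex)" for l
  have "(\<Sum>l=1..n. w l * eval_poly (pdiff r (P l)) x) = 0" if "r \<in> {..n}" for r
  proof -
    have "(\<Sum>l=1..n. w l * eval_poly (pdiff r (P l)) x)
        = (\<Sum>l=1..n. if l = j then eval_poly (pdiff r (P j)) x else 0)"
      by (rule sum.cong) (auto simp: w_def)
    also have "\<dots> = eval_poly (pdiff r (P j)) x" using j by simp
    also have "\<dots> = 0" using eval_pdiff_P[OF j t, of r] that K by simp
    finally show ?thesis .
  qed
  from full_rankD_base[OF transversal x this j] show False by (simp add: w_def)
qed

text \<open>
  If two factors of \<open>P j\<close> vanished at a base point, the differential of \<open>P j\<close> would be zero there, which
  transversality excludes.
\<close>

lemma vanishing_line_unique:
  assumes x: "base_point x" and j: "j \<in> {1..n}"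
    and "t < k" "eval_poly (L j t) x = 0" "u < k" "eval_poly (L j u) x = 0"
  shows "t = u"
proof (rule ccontr)
  assume "t \<noteq> u"
  then have "cofactor j t x = 0"
    unfolding cofactor_def using assms by (intro prod_zero) auto
  then show False using cofactor_nonzero assms by blast
qed

lemma euler_base:
  assumes x: "base_point x" and j: "j \<in> {1..n}"
  shows "(\<Sum>r\<le>n. x r * eval_poly (pdiff r (P j)) x) = 0"
proof -
  obtain t where t: "t < k" "eval_poly (L j t) x = 0" using base_pointD[OF x j] by blast
  have "(\<Sum>r\<le>n. x r * eval_poly (pdiff r (P j)) x) = (\<Sum>r\<le>n. coef (L j t) r * x r) * cofactor j t x"
    unfolding sum_distrib_right using eval_pdiff_P[OF j t] by (intro sum.cong) auto
  then show ?thesis using t(2) by (simp add: eval_L[OF j])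
qed

text \<open>
  The \<open>n\<close> differentials are independent and the point \<open>x\<close> itself is in their kernel by Euler's formula, so the
  kernel is the line through \<open>x\<close>. If it contained a vector \<open>v\<close> that is independent of \<open>x\<close>, some minor of
  \<open>(x, v)\<close> in columns \<open>r, t\<close> would be nonzero; a combination of the differentials whose other \<open>n - 1\<close>
  coordinates vanish exists for dimension reasons, and pairing it with \<open>x\<close> and \<open>v\<close> shows that its
  coordinates \<open>r\<close> and \<open>t\<close> vanish too.
\<close>

lemma tangent_kernel:
  assumes x: "base_point x" and v: "\<And>i. i \<notin> {..n} \<Longrightarrow> v i = 0"
    and ker: "\<And>j. j \<in> {1..n} \<Longrightarrow> (\<Sum>r\<le>n. v r * eval_poly (pdiff r (P j)) x) = 0"
  shows "\<exists>c. \<forall>r. v r = c * x r"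
proof (rule ccontr)
  assume not: "\<not> ?thesis"
  have x0: "nonzero_on {..n} x" using x by (simp add: base_point_def)
  then obtain r where r: "x r \<noteq> 0" "r \<le> n" unfolding nonzero_on_def by auto
  obtain t where t: "v t \<noteq> v r / x r * x t" using not by blast
  have "t \<le> n" using t v[of t] x0 unfolding nonzero_on_def by force
  have "t \<noteq> r" using t r by auto
  let ?D = "\<lambda>i j. eval_poly (pdiff i (P j)) x"
  have "card ({..n} - {r, t}) < card {1..n}"
    using r(2) \<open>t \<le> n\<close> \<open>t \<noteq> r\<close> n by (simp add: card_Diff_subset)
  from homogeneous_system_nontrivial_solution[OF _ _ this, of ?D]
  obtain w where w: "\<exists>j\<in>{1..n}. w j \<noteq> 0"
    and sol: "\<forall>i\<in>{..n} - {r, t}. (\<Sum>j=1..n. ?D i j * w j) = 0" by auto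
  define g where "g i = (\<Sum>j=1..n. w j * ?D i j)" for i
  have g0: "g i = 0" if "i \<in> {..n} - {r, t}" for i
    using sol that by (simp add: g_def mult.commute)
  have pair: "y r * g r + y t * g t = 0"
    if "\<And>j. j \<in> {1..n} \<Longrightarrow> (\<Sum>i\<le>n. y i * ?D i j) = 0" for y
  proof -
    have "(\<Sum>i\<le>n. y i * g i) = (\<Sum>i\<le>n. \<Sum>j=1..n. w j * (y i * ?D i j))"
      by (simp add: g_def sum_distrib_left mult_ac)
    also have "\<dots> = (\<Sum>j=1..n. w j * (\<Sum>i\<le>n. y i * ?D i j))"
      unfolding sum_distrib_left by (rule sum.swap)
    also have "\<dots> = 0" using that by simp
    finally have "(\<Sum>i\<le>n. y i * g i) = 0" .
    then show ?thesis
      using sum_only_two[of "{..n}" r t "\<lambda>i. y i * g i"] g0 r(2) \<open>t \<le> n\<close> \<open>t \<noteq> r\<close> by simp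
  qed
  have 1: "x r * g r + x t * g t = 0" by (rule pair) (rule euler_base[OF x])
  have 2: "v r * g r + v t * g t = 0" by (rule pair) (rule ker)
  have "(x r * v t - x t * v r) * g t = x r * (v r * g r + v t * g t) - v r * (x r * g r + x t * g t)"
    by (simp add: algebra_simps)
  also have "\<dots> = 0" by (simp add: 1 2)
  finally have "(x r * v t - x t * v r) * g t = 0" .
  moreover have "x r * v t - x t * v r \<noteq> 0" using t r by (simp add: field_simps)
  ultimately have gt: "g t = 0" by simp
  then have "g r = 0" using 1 r by simp
  with gt g0 have "g i = 0" if "i \<in> {..n}" for i
    using that by (cases "i = r \<or> i = t") auto
  then have "w j = 0" if "j \<in> {1..n}" for j
    using full_rankD_base[OF transversal x, of w] that unfolding g_def by blast
  then show False using w by blast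
qed

lemma base_point_unique:
  assumes x: "base_point x" and y: "base_point y"
    and s: "\<And>j. j \<in> {1..n} \<Longrightarrow> s j < k"
      "\<And>j. j \<in> {1..n} \<Longrightarrow> eval_poly (L j (s j)) x = 0" "\<And>j. j \<in> {1..n} \<Longrightarrow> eval_poly (L j (s j)) y = 0"
  shows "\<exists>c. c \<noteq> 0 \<and> (\<forall>r. y r = c * x r)"
proof -
  have "\<exists>c. \<forall>r. y r = c * x r"
  proof (rule tangent_kernel[OF x])
    show "y i = 0" if "i \<notin> {..n}" for i
      using y that by (simp add: base_point_def nonzero_on_def)
    fix j assume j: "j \<in> {1..n}"
    have "(\<Sum>r\<le>n. y r * eval_poly (pdiff r (P j)) x) = (\<Sum>r\<le>n. coef (L j (s j)) r * y r) * cofactor j (s j) x"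
      unfolding sum_distrib_right using eval_pdiff_P[OF j s(1)[OF j] s(2)[OF j]]
      by (intro sum.cong) auto
    then show "(\<Sum>r\<le>n. y r * eval_poly (pdiff r (P j)) x) = 0"
      using s(3)[OF j] by (simp add: eval_L[OF j])
  qed
  then obtain c where c: "\<forall>r. y r = c * x r" by blast
  moreover have "c \<noteq> 0"
    using y c unfolding base_point_def nonzero_on_def by auto
  ultimately show ?thesis by blast
qed

lemma base_point_exists:
  assumes s: "\<And>j. j \<in> {1..n} \<Longrightarrow> s j < k"
  shows "\<exists>x. base_point x \<and> (\<forall>j\<in>{1..n}. eval_poly (L j (s j)) x = 0)"
proof -
  have "card {1..n} < card {..n}" by simp
  from homogeneous_system_nontrivial_solution[OF _ _ this, of "\<lambda>j. coef (L j (s j))"]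
  obtain x where x: "\<exists>j\<in>{..n}. x j \<noteq> 0" "\<forall>j. j \<notin> {..n} \<longrightarrow> x j = 0"
    "\<forall>j\<in>{1..n}. (\<Sum>i\<le>n. coef (L j (s j)) i * x i) = 0" by auto
  have 0: "eval_poly (L j (s j)) x = 0" if "j \<in> {1..n}" for j
    using x(3) that by (simp add: eval_L[OF that])
  then have "eval_poly (P j) x = 0" if "j \<in> {1..n}" for j
    unfolding eval_P using that s[OF that] by (intro prod_zero) auto
  then have "base_point x" using x unfolding base_point_def nonzero_on_def by blast
  then show ?thesis using 0 by blast
qed

lemma singular_locus_eq:
  "singular_locus {..n} F = proj_point ` {v \<in> nonzero_vectors {..n}. base_point (lookup v)}"
proof -
  have "eval_poly F (lookup v) = 0 \<and> (\<forall>i\<in>{..n}. eval_poly (pdiff i F) (lookup v) = 0)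
      \<longleftrightarrow> base_point (lookup v)" if v: "v \<in> nonzero_vectors {..n}" for v
  proof
    assume "eval_poly F (lookup v) = 0 \<and> (\<forall>i\<in>{..n}. eval_poly (pdiff i F) (lookup v) = 0)"
    then show "base_point (lookup v)"
      using base nonzero_on_lookup[OF v] unfolding base_point_def singular_only_on_base_def by blast
  next
    assume "base_point (lookup v)"
    then have 0: "eval_poly (P j) (lookup v) = 0" if "j \<in> {1..n}" for j
      using that by (simp add: base_point_def)
    show "eval_poly F (lookup v) = 0 \<and> (\<forall>i\<in>{..n}. eval_poly (pdiff i F) (lookup v) = 0)"
      unfolding eval_quadric eval_pdiff_quadric using 0 by simp
  qed
  then show ?thesis unfolding singular_locus_def by (intro arg_cong[where f = "(`) proj_point"]) blast
qed

lemma base_point_lookup_exists: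
  assumes "s \<in> PiE {1..n} (\<lambda>_. {..<k})"
  shows "\<exists>v. v \<in> nonzero_vectors {..n} \<and> base_point (lookup v) \<and>
    (\<forall>j\<in>{1..n}. eval_poly (L j (s j)) (lookup v) = 0)"
proof -
  have "\<exists>x. base_point x \<and> (\<forall>j\<in>{1..n}. eval_poly (L j (s j)) x = 0)"
    using assms by (intro base_point_exists) auto
  then obtain x where x: "base_point x" "\<forall>j\<in>{1..n}. eval_poly (L j (s j)) x = 0" by blast
  then obtain v where "v \<in> nonzero_vectors {..n}" "lookup v = x"
    using nonzero_on_vector[of "{..n}" x] unfolding base_point_def by blast
  then show ?thesis using x by blast
qed

text \<open>
  Choice functions \<open>{1..n} \<rightarrow> {..<k}\<close> correspond to base points. A common zero of \<open>n\<close> linear forms in \<open>n + 1\<close>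
  variables exists, it is unique by \<open>base_point_unique\<close>, and it determines the chosen factors by
  \<open>vanishing_line_unique\<close>.
\<close>

lemma card_singular_locus:
  "finite (singular_locus {..n} F) \<and> card (singular_locus {..n} F) = k ^ n"
proof -
  let ?S = "PiE {1..n} (\<lambda>_. {..<k})"
  define meets where "meets s v \<longleftrightarrow> v \<in> nonzero_vectors {..n} \<and> base_point (lookup v) \<and>
    (\<forall>j\<in>{1..n}. eval_poly (L j (s j)) (lookup v) = 0)" for s v
  define z where "z s = (SOME v. meets s v)" for s
  have z: "meets s (z s)" if "s \<in> ?S" for s
    unfolding z_def using base_point_lookup_exists[OF that] unfolding meets_def by (rule someI_ex)
  have lt: "s j < k" if "s \<in> ?S" "j \<in> {1..n}" for s j using that by auto
  have "bij_betw (\<lambda>s. proj_point (z s)) ?S (singular_locus {..n} F)"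
  proof (rule bij_betw_imageI)
    show "inj_on (\<lambda>s. proj_point (z s)) ?S"
    proof (rule inj_onI)
      fix s s' assume s: "s \<in> ?S" "s' \<in> ?S" and eq: "proj_point (z s) = proj_point (z s')"
      have "z s' \<in> proj_point (z s)" using proj_point_self eq by blast
      then obtain c where c: "z s' = Poly_Mapping.map ((*) c) (z s)" by (auto simp: proj_point_def)
      have "s j = s' j" if j: "j \<in> {1..n}" for j
      proof (rule vanishing_line_unique[OF _ j lt[OF s(1) j] _ lt[OF s(2) j]])
        show "base_point (lookup (z s'))" "eval_poly (L j (s' j)) (lookup (z s')) = 0"
          using z[OF s(2)] j unfolding meets_def by blast+
        have "eval_poly (L j (s j)) (lookup (z s)) = 0"
          using z[OF s(1)] j unfolding meets_def by blast
        moreover have "lookup (z s') = (\<lambda>i. c * lookup (z s) i)" using c by auto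
        ultimately show "eval_poly (L j (s j)) (lookup (z s')) = 0"
          using eval_form_scale[OF L[OF j]] by simp
      qed
      then show "s = s'" using s by (intro PiE_ext)
    qed
    show "(\<lambda>s. proj_point (z s)) ` ?S = singular_locus {..n} F"
    proof
      show "(\<lambda>s. proj_point (z s)) ` ?S \<subseteq> singular_locus {..n} F"
        unfolding singular_locus_eq using z unfolding meets_def by blast
      show "singular_locus {..n} F \<subseteq> (\<lambda>s. proj_point (z s)) ` ?S"
      proof
        fix X assume "X \<in> singular_locus {..n} F"
        then obtain v where v: "X = proj_point v" "base_point (lookup v)"
          unfolding singular_locus_eq by blast
        have "\<forall>j\<in>{1..n}. \<exists>t. t < k \<and> eval_poly (L j t) (lookup v) = 0"
          using base_pointD[OF v(2)] by blast
        then obtain s where s: "\<forall>j\<in>{1..n}. s j < k \<and> eval_poly (L j (s j)) (lookup v) = 0"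
          by (rule bchoice[THEN exE])
        define s' where "s' = restrict s {1..n}"
        have s': "s' \<in> ?S" using s by (auto simp: s'_def)
        have "\<exists>c. c \<noteq> 0 \<and> (\<forall>r. lookup v r = c * lookup (z s') r)"
        proof (rule base_point_unique[of _ _ s])
          fix j assume j: "j \<in> {1..n}"
          then have "s' j = s j" by (simp add: s'_def)
          then show "eval_poly (L j (s j)) (lookup (z s')) = 0"
            using z[OF s'] j unfolding meets_def by metis
        qed (use s v z[OF s'] in \<open>auto simp: meets_def\<close>)
        then have "X = proj_point (z s')"
          using proj_point_eqI v(1) by blast
        then show "X \<in> (\<lambda>s. proj_point (z s)) ` ?S" using s' by blast
      qed
    qed
  qed
  moreover have "finite ?S" "card ?S = k ^ n"
    by (auto intro: finite_PiE simp: card_PiE)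
  ultimately show ?thesis
    using bij_betw_finite bij_betw_same_card by metis
qed

lemma base_point_scale:
  assumes "base_point x" "c \<noteq> 0"
  shows "base_point (\<lambda>i. c * x i)"
  using assms unfolding base_point_def nonzero_on_def by (auto simp: eval_form_scale[OF form_P])

text \<open>
  The equation at a base point \<open>q\<close>, in the affine chart \<open>x_i = 1\<close>. The factor \<open>L j (\<tau> j)\<close> is the one that
  vanishes at \<open>q\<close>. It becomes a linear form \<open>tangent j\<close> without constant term, whereas the other factors of
  \<open>P j\<close> contribute the constant \<open>cofactor j (\<tau> j) q\<close> in lowest order.
\<close>

context
  fixes q :: "nat \<Rightarrow> complex" and i :: nat and \<tau> :: "nat \<Rightarrow> nat"
  assumes q: "base_point q" and qi: "q i = 1"
    and \<tau>: "\<And>j. j \<in> {1..n} \<Longrightarrow> \<tau> j < k" "\<And>j. j \<in> {1..n} \<Longrightarrow> eval_poly (L j (\<tau> j)) q = 0"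
begin

definition chart :: "nat \<Rightarrow> nat cpoly" where
  "chart j = (if j = i then 1 else var_poly j + const_poly (q j))"

definition tangent :: "nat \<Rightarrow> nat cpoly" where
  "tangent j = (\<Sum>r\<in>{..n} - {i}. const_poly (coef (L j (\<tau> j)) r) * var_poly r)"

definition weight :: "nat \<Rightarrow> nat \<Rightarrow> complex" where
  "weight j l = eval_poly (a j l) q * cofactor j (\<tau> j) q * cofactor l (\<tau> l) q"

definition cone :: "nat cpoly" where
  "cone = quadric n (\<lambda>j l. const_poly (weight j l)) tangent"

lemma i_le: "i \<le> n"
  using q qi unfolding base_point_def nonzero_on_def by (metis atMost_iff zero_neq_one)

lemma form_tangent: "form ({..n} - {i}) 1 (tangent j)"
  unfolding tangent_def by (intro form_sum form_const_mult form_var)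

lemma subst_chart_line:
  assumes j: "j \<in> {1..n}"
  shows "subst_poly (L j (\<tau> j)) chart = tangent j"
proof -
  let ?c = "coef (L j (\<tau> j))"
  have "subst_poly (L j (\<tau> j)) chart = (\<Sum>r\<le>n. const_poly (?c r) * chart r)"
    by (subst linear_form_expand[OF finite_atMost L[OF j]]) (simp add: subst_poly.homs)
  also have "\<dots> = const_poly (?c i) + (\<Sum>r\<in>{..n} - {i}. const_poly (?c r) * chart r)"
    using i_le by (subst sum.remove[of _ i]) (auto simp: chart_def)
  also have "(\<Sum>r\<in>{..n} - {i}. const_poly (?c r) * chart r)
      = tangent j + const_poly (\<Sum>r\<in>{..n} - {i}. ?c r * q r)"
    unfolding tangent_def const_poly.hom_sum sum.distrib[symmetric]
    by (rule sum.cong) (auto simp: chart_def distrib_left const_poly.homs)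
  also have "const_poly (?c i) + (tangent j + const_poly (\<Sum>r\<in>{..n} - {i}. ?c r * q r))
      = tangent j + const_poly (\<Sum>r\<le>n. ?c r * q r)"
    using i_le by (subst sum.remove[of "{..n}" i]) (auto simp: qi const_poly.homs add_ac)
  also have "\<dots> = tangent j"
    using \<tau>(2)[OF j] by (simp add: eval_L[OF j] const_poly.hom_zero)
  finally show ?thesis .
qed

lemma lookup_subst_chart: "lookup (subst_poly G chart) 0 = eval_poly G q"
proof -
  have "(\<lambda>j. eval_poly (chart j) (\<lambda>_. 0)) = q"
    using qi by (auto simp: chart_def eval_poly.homs)
  then show ?thesis by (simp add: lookup_zero_eq_eval eval_subst_poly)
qed

lemma subst_chart_P:
  assumes j: "j \<in> {1..n}"
  shows "subst_poly (P j) chart = subst_poly (\<Prod>u\<in>{..<k} - {\<tau> j}. L j u) chart * tangent j"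
  unfolding P_def subst_chart_line[OF j, symmetric] subst_poly.hom_mult[symmetric]
  using \<tau>(1)[OF j] by (subst prod.remove[of _ "\<tau> j"]) (auto simp: mult.commute)

lemma hom_part_chart:
  assumes m: "m \<le> 2"
  shows "hom_part m (subst_poly F chart) = (if m = 2 then cone else 0)"
proof -
  let ?W = "\<lambda>j. \<Prod>u\<in>{..<k} - {\<tau> j}. L j u"
  have "hom_part m (subst_poly (a j l * P j * P l) chart)
      = (if m = 2 then const_poly (weight j l) * tangent j * tangent l else 0)"
    if j: "j \<in> {1..n}" and l: "l \<in> {1..n}" for j l
  proof -
    have "subst_poly (a j l * P j * P l) chart
        = subst_poly (a j l * ?W j * ?W l) chart * (tangent j * tangent l)"
      by (simp add: subst_poly.hom_mult subst_chart_P[OF j] subst_chart_P[OF l] mult_ac)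
    moreover have "form ({..n} - {i}) 2 (tangent j * tangent l)"
      using form_mult[OF form_tangent form_tangent] by (simp add: numeral_2_eq_2)
    moreover have "lookup (subst_poly (a j l * ?W j * ?W l) chart) 0 = weight j l"
      unfolding lookup_subst_chart by (simp add: eval_poly.homs weight_def cofactor_def)
    ultimately show ?thesis
      using m by (simp add: hom_part_times_form mult.assoc)
  qed
  then show ?thesis
    by (auto simp: quadric_def subst_poly.hom_sum hom_part_sum cone_def)
qed

text \<open>
  The gradient of the tangent cone at \<open>v\<close> consists of the rows other than \<open>i\<close> of the linear term of the
  gradient of \<open>F\<close> at \<open>q\<close>, applied to the vector of the values of \<open>tangent\<close> at \<open>v\<close> times the cofactors. Row \<open>i\<close> follows from the
  others by Euler's formula. Hence a singular point \<open>v\<close> of the cone is in the kernel of all the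
  differentials, that is, proportional to \<open>q\<close>; since \<open>v i = 0\<close> and \<open>q i = 1\<close>, it is zero.
\<close>

lemma singular_locus_cone: "singular_locus ({..n} - {i}) cone = {}"
proof -
  let ?K = "\<lambda>j. cofactor j (\<tau> j) q" and ?c = "\<lambda>j. coef (L j (\<tau> j))"
  have K: "?K j \<noteq> 0" if "j \<in> {1..n}" for j
    using cofactor_nonzero[OF q that \<tau>[OF that]] .
  have dP: "eval_poly (pdiff r (P j)) q = ?c j r * ?K j" if "j \<in> {1..n}" "r \<le> n" for j r
    using eval_pdiff_P[OF that(1) \<tau>[OF that(1)] that(2)] .
  have False
    if v: "v \<in> nonzero_vectors ({..n} - {i})"
      and sing: "\<forall>r\<in>{..n} - {i}. eval_poly (pdiff r cone) (lookup v) = 0" for v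
  proof -
    define u where "u j = eval_poly (tangent j) (lookup v) * ?K j" for j
    define g where "g r = (\<Sum>j=1..n. u j * eval_poly (\<Sum>l=1..n. (a j l + a l j) * pdiff r (P l)) q)" for r
    have vi: "lookup v i = 0" using v by (auto simp: nonzero_vectors_def in_keys_iff)
    have dT: "pdiff r (tangent l) = const_poly (?c l r)" if "r \<in> {..n} - {i}" for r l
      using that unfolding tangent_def
      by (simp add: pdiff_sum pdiff_mult pdiff_var if_distrib[of "\<lambda>x. _ * x"] cong: if_cong)
    have g0: "g r = 0" if r: "r \<in> {..n} - {i}" for r
    proof -
      have "eval_poly (pdiff r cone) (lookup v)
          = (\<Sum>j=1..n. eval_poly (tangent j) (lookup v) * (\<Sum>l=1..n. (weight j l + weight l j) * ?c l r))"
        unfolding cone_def eval_pdiff_quadric by (simp add: dT[OF r] eval_poly.homs)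
      also have "\<dots> = g r"
        unfolding g_def sum_distrib_left eval_poly.hom_sum
        using r by (intro sum.cong refl) (simp add: dP u_def weight_def eval_poly.homs algebra_simps)
      finally show ?thesis using sing r by simp
    qed
    have "(\<Sum>r\<le>n. q r * g r)
        = (\<Sum>r\<le>n. \<Sum>j=1..n. \<Sum>l=1..n. u j * eval_poly (a j l + a l j) q * (q r * eval_poly (pdiff r (P l)) q))"
      by (simp add: g_def sum_distrib_left eval_poly.homs mult_ac)
    also have "\<dots> = (\<Sum>j=1..n. \<Sum>r\<le>n. \<Sum>l=1..n. u j * eval_poly (a j l + a l j) q * (q r * eval_poly (pdiff r (P l)) q))"
      by (rule sum.swap)
    also have "\<dots> = (\<Sum>j=1..n. \<Sum>l=1..n. \<Sum>r\<le>n. u j * eval_poly (a j l + a l j) q * (q r * eval_poly (pdiff r (P l)) q))"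
      by (intro sum.cong refl sum.swap)
    also have "\<dots> = 0"
      using euler_base[OF q] by (simp flip: sum_distrib_left)
    finally have "(\<Sum>r\<le>n. q r * g r) = 0" .
    then have "q i * g i + (\<Sum>r\<in>{..n} - {i}. q r * g r) = 0"
      using i_le by (subst (asm) sum.remove[of _ i]) auto
    then have "g i = 0" using g0 qi by simp
    with g0 have "g r = 0" if "r \<in> {..n}" for r using that by (cases "r = i") auto
    then have u0: "u j = 0" if "j \<in> {1..n}" for j
      using full_rankD_base[OF hessian_injectiveI[OF transversal nondegenerate] q, of u j] that
      unfolding g_def by blast
    have "\<exists>c. \<forall>r. lookup v r = c * q r"
    proof (rule tangent_kernel[OF q])
      show "lookup v r = 0" if "r \<notin> {..n}" for r
        using v that by (auto simp: nonzero_vectors_def in_keys_iff)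
      fix j assume j: "j \<in> {1..n}"
      have "(\<Sum>r\<le>n. lookup v r * eval_poly (pdiff r (P j)) q) = (\<Sum>r\<le>n. ?c j r * lookup v r) * ?K j"
        unfolding sum_distrib_right using dP[OF j] by (intro sum.cong) auto
      also have "(\<Sum>r\<le>n. ?c j r * lookup v r) = eval_poly (tangent j) (lookup v)"
        unfolding tangent_def eval_poly.hom_sum using i_le vi
        by (subst sum.remove[of _ i]) (auto simp: eval_poly.homs)
      finally show "(\<Sum>r\<le>n. lookup v r * eval_poly (pdiff r (P j)) q) = 0"
        using u0[OF j] by (simp add: u_def)
    qed
    then obtain c where c: "\<And>r. lookup v r = c * q r" by blast
    then have "c = 0" using vi qi by simp
    then have "v = 0" using c by (intro poly_mapping_eqI) simp
    then show False using v by (simp add: nonzero_vectors_def)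
  qed
  then show ?thesis unfolding singular_locus_def by blast
qed

lemma cone_nonzero: "cone \<noteq> 0"
proof
  assume cone: "cone = 0"
  obtain r where "r \<in> {..n} - {i}"
    using n by (cases "i = 0") auto
  then have "Poly_Mapping.single r 1 \<in> nonzero_vectors ({..n} - {i})"
    using lookup_single_eq[of r "1::complex"] by (auto simp: nonzero_vectors_def simp del: lookup_single_eq)
  then have "proj_point (Poly_Mapping.single r 1) \<in> singular_locus ({..n} - {i}) cone"
    unfolding singular_locus_def cone by (auto simp: eval_poly.homs)
  then show False using singular_locus_cone by blast
qed

lemma mult_at_origin_chart: "mult_at_origin (subst_poly F chart) = 2"
  unfolding mult_at_origin_def
proof (rule Least_equality)
  show "hom_part 2 (subst_poly F chart) \<noteq> 0" by (simp add: hom_part_chart cone_nonzero)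
  fix m assume "hom_part m (subst_poly F chart) \<noteq> 0"
  then show "2 \<le> m" by (cases "m \<le> 2") (auto simp: hom_part_chart split: if_splits)
qed

lemma tangent_cone_chart: "tangent_cone (subst_poly F chart) = cone"
  by (simp add: tangent_cone_def mult_at_origin_chart hom_part_chart)

end

lemma node_singular:
  assumes X: "X \<in> singular_locus {..n} F"
  shows "node n F X"
proof -
  obtain v where v: "X = proj_point v" "v \<in> nonzero_vectors {..n}" "base_point (lookup v)"
    using X unfolding singular_locus_eq by blast
  then obtain i where i: "i \<in> keys v"
    using nonzero_on_lookup[OF v(2)] unfolding nonzero_on_def by (auto simp: in_keys_iff)
  then have vi: "lookup v i \<noteq> 0" by (simp add: in_keys_iff)
  define q where "q j = lookup v j / lookup v i" for j
  have q: "base_point q"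
    using base_point_scale[OF v(3), of "1 / lookup v i"] vi by (simp add: q_def[abs_def])
  have qi: "q i = 1" using vi by (simp add: q_def)
  have "\<forall>j\<in>{1..n}. \<exists>t. t < k \<and> eval_poly (L j t) q = 0"
    using base_pointD[OF q] by blast
  then obtain \<tau> where "\<forall>j\<in>{1..n}. \<tau> j < k \<and> eval_poly (L j (\<tau> j)) q = 0"
    by (rule bchoice[THEN exE])
  then have \<tau>: "\<tau> j < k" "eval_poly (L j (\<tau> j)) q = 0" if "j \<in> {1..n}" for j
    using that by blast+
  have chart: "chart q i j = (if j = i then 1 else var_poly j + const_poly (q j))" for j
    by (subst chart_def[OF q qi \<tau>]; (assumption | rule refl))
  have loc: "local_equation F v i = subst_poly F (chart q i)"
    unfolding local_equation_def
    by (intro arg_cong[where f = "subst_poly F"] ext) (simp add: chart q_def)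
  have "mult_at_origin (local_equation F v i) = 2"
    unfolding loc by (rule mult_at_origin_chart[OF q qi \<tau>])
  moreover have "singular_locus ({..n} - {i}) (tangent_cone (local_equation F v i)) = {}"
    unfolding loc
    by (subst tangent_cone_chart[OF q qi \<tau>]; (assumption | rule singular_locus_cone[OF q qi \<tau>]))
  moreover have "X \<notin> zariski_topology {..n} derived_set_of singular_locus {..n} F"
    using card_singular_locus v(1,2)
    by (intro finite_imp_not_in_derived_set) (auto simp: singular_locus_eq)
  ultimately show ?thesis
    unfolding ordinary_point_def using X i v(1) proj_point_self by blast
qed

theorem proj_point_in_severi:
  assumes "F \<noteq> 0"
  shows "proj_point F \<in> severi n (e + 2 * k) (k ^ n)"
  unfolding severi_def
  using assms form_F card_singular_locus node_singular
  by (intro imageI) (auto simp: nonzero_vectors_def form_def)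

end

section \<open>Nodal hypersurfaces near an arbitrary quadratic expression\<close>

text \<open>
  All data are moved along segments to the explicit example at \<open>s = 1\<close>. On this segment \<open>G\<close> is a polynomial
  in \<open>s\<close> that is nonzero at \<open>s = 0\<close>, so it has finitely many zeros, and nodality holds for all \<open>s\<close> close
  to \<open>1\<close>.
\<close>

theorem product_quadric_nearby_severi:
  fixes L :: "nat \<Rightarrow> nat \<Rightarrow> nat cpoly" and a :: "nat \<Rightarrow> nat \<Rightarrow> nat cpoly"
  assumes n: "n \<ge> 1" and k: "k \<ge> 1"
    and L: "\<And>j t. j \<in> {1..n} \<Longrightarrow> form {..n} 1 (L j t)"
    and a: "\<And>j l. j \<in> {1..n} \<Longrightarrow> l \<in> {1..n} \<Longrightarrow> form {..n} e (a j l)"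
    and G0: "eval_poly G (lookup 0) = 0"
    and G: "eval_poly G (lookup (quadric n a (\<lambda>j. \<Prod>t<k. L j t))) \<noteq> 0"
  shows "\<exists>F. F \<in> nonzero_vectors (monomials {..n} (e + 2 * k)) \<and> eval_poly G (lookup F) \<noteq> 0 \<and>
    proj_point F \<in> severi n (e + 2 * k) (k ^ n)"
proof -
  obtain c where c: "\<forall>j. c j \<noteq> 0" and base: "singular_only_on_base n (grid_weight e c) (grid_base k)"
    using singular_only_on_base_grid[OF k, of n e] by blast
  define L' where "L' j t s = segment (L j t) (grid_line j t) s" for j t s
  define A where "A j l s = segment (a j l) (grid_weight e c j l) s" for j l s
  define P where "P j s = (\<Prod>t<k. L' j t s)" for j s
  define F where "F s = quadric n (\<lambda>j l. A j l s) (\<lambda>j. P j s)" for s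
  have L'_form: "form {..n} 1 (L' j t s)" if "j \<in> {1..n}" for j t s
    unfolding L'_def using that by (intro form_segment L form_grid_line) auto
  have A_form: "form {..n} e (A j l s)" if "j \<in> {1..n}" "l \<in> {1..n}" for j l s
    unfolding A_def using that by (intro form_segment a form_grid_weight) auto
  have P_form: "form {..n} k (P j s)" if "j \<in> {1..n}" for j s
    using form_prod[of "{..<k}" "{..n}" "\<lambda>_. 1" "\<lambda>t. L' j t s"] L'_form[OF that] unfolding P_def by simp
  have A_fam: "polynomial_family (A j l)" for j l
    unfolding A_def[abs_def] by (rule polynomial_family_segment)
  have P_fam: "polynomial_family (P j)" for j
    unfolding P_def[abs_def] L'_def by (intro polynomial_family_prod polynomial_family_segment)
  have F_fam: "polynomial_family F"
    unfolding F_def[abs_def] by (intro polynomial_family_quadric A_fam P_fam)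
  have A1: "(\<lambda>j l. A j l 1) = grid_weight e c" by (simp add: A_def)
  have P1: "(\<lambda>j. P j 1) = grid_base k" by (rule ext) (simp add: P_def L'_def grid_base_def)
  have F0: "F 0 = quadric n a (\<lambda>j. \<Prod>t<k. L j t)" by (simp add: F_def A_def P_def L'_def)
  have "polynomial_function (\<lambda>s. eval_poly G (lookup (F s)))"
    by (intro polynomial_function.eval_poly polynomial_function_lookup F_fam)
  then obtain p where p: "\<And>s. eval_poly G (lookup (F s)) = poly p s"
    unfolding polynomial_function_def by blast
  have "p \<noteq> 0" using G p[of 0] unfolding F0 by auto
  define S where "S r = 1 + inverse (of_nat (Suc r) :: complex)" for r
  have S: "S \<longlonglongrightarrow> 1"
  proof -
    have "(\<lambda>r. of_real (inverse (real (Suc r))) :: complex) \<longlonglongrightarrow> of_real 0"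
      by (intro tendsto_of_real LIMSEQ_inverse_real_of_nat)
    then have "(\<lambda>r. inverse (of_nat (Suc r) :: complex)) \<longlonglongrightarrow> 0"
      by (simp del: of_nat_Suc)
    from tendsto_add[OF tendsto_const[of 1] this] show ?thesis by (simp add: S_def[abs_def])
  qed
  have "inj S" by (rule injI) (simp add: S_def)
  then have "finite (S -` {s. poly p s = 0})"
    using poly_roots_finite[OF \<open>p \<noteq> 0\<close>] by (intro finite_vimageI)
  then have ev1: "\<forall>\<^sub>F r in sequentially. poly p (S r) \<noteq> 0"
    unfolding cofinite_eq_sequentially[symmetric] eventually_cofinite by (simp add: vimage_def)
  have nd: "nondegenerate n (grid_weight e c) (grid_base k)"
    using c by (intro nondegenerate_grid) blast
  have ev2: "\<forall>\<^sub>F r in sequentially. transversal n (\<lambda>j. P j (S r))"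
  proof (rule full_rank_open[where e = "k - 1" and k = k and s = 1])
    show "transversal n (\<lambda>j. P j 1)"
      using transversal_grid[of n k] by (simp only: P1[THEN fun_cong])
  qed (intro polynomial_family_pdiff P_fam form_pdiff P_form S; assumption)+
  have ev3: "\<forall>\<^sub>F r in sequentially. nondegenerate n (\<lambda>j l. A j l (S r)) (\<lambda>j. P j (S r))"
  proof (rule full_rank_open[where e = e and k = k and s = 1])
    show "full_rank {1..n} n (\<lambda>i j. A j i 1 + A i j 1) (\<lambda>j. P j 1)"
      using nd by (simp only: P1[THEN fun_cong] A1[THEN fun_cong, THEN fun_cong])
  qed (intro polynomial_family_add A_fam P_fam form_add A_form P_form S; assumption)+
  have ev4: "\<forall>\<^sub>F r in sequentially. singular_only_on_base n (\<lambda>j l. A j l (S r)) (\<lambda>j. P j (S r))"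
  proof (rule singular_only_on_base_open[where e = e and k = k and s = 1])
    show "singular_only_on_base n (\<lambda>j l. A j l 1) (\<lambda>j. P j 1)"
      unfolding A1 P1 by (rule base)
    show "hessian_injective n (\<lambda>j l. A j l 1) (\<lambda>j. P j 1)"
      using hessian_injectiveI[OF transversal_grid nd]
      by (simp only: P1[THEN fun_cong] A1[THEN fun_cong, THEN fun_cong])
  qed (intro A_fam P_fam A_form P_form S; assumption)+
  from eventually_conj[OF ev1 eventually_conj[OF ev2 eventually_conj[OF ev3 ev4]]]
  obtain r where r: "poly p (S r) \<noteq> 0" "transversal n (\<lambda>j. P j (S r))"
    "nondegenerate n (\<lambda>j l. A j l (S r)) (\<lambda>j. P j (S r))"
    "singular_only_on_base n (\<lambda>j l. A j l (S r)) (\<lambda>j. P j (S r))"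
    using eventually_happens'[OF sequentially_bot] by blast
  have P_eq: "(\<lambda>j. P j (S r)) = (\<lambda>j. \<Prod>t<k. L' j t (S r))" by (simp add: P_def)
  interpret nodal_system n k e "\<lambda>j t. L' j t (S r)" "\<lambda>j l. A j l (S r)" "\<lambda>j. \<Prod>t<k. L' j t (S r)"
    by unfold_locales (use n L'_form A_form r(2-4) in \<open>simp_all only: P_def\<close>)
  have F_eq: "F (S r) = quadric n (\<lambda>j l. A j l (S r)) (\<lambda>j. \<Prod>t<k. L' j t (S r))"
    unfolding F_def P_eq ..
  have G': "eval_poly G (lookup (F (S r))) \<noteq> 0" using r(1) p by simp
  then have nz: "F (S r) \<noteq> 0" using G0 by metis
  have "form {..n} (e + 2 * k) (F (S r))" unfolding F_eq by (rule form_F)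
  then have "F (S r) \<in> nonzero_vectors (monomials {..n} (e + 2 * k))"
    using nz by (simp add: nonzero_vectors_def form_def)
  moreover have "proj_point (F (S r)) \<in> severi n (e + 2 * k) (k ^ n)"
    using proj_point_in_severi nz unfolding F_eq by blast
  ultimately show ?thesis using G' by blast
qed

section \<open>Vanishing along tangent directions\<close>

text \<open>
  A polynomial in \<open>s\<close> whose coefficients are polynomials in \<open>u\<close>. The two variables play different roles
  below: the order in \<open>s\<close> is estimated for all \<open>u\<close>, and then \<open>u = s\<close> is substituted.
\<close>

definition bipolynomial_function :: "(complex \<times> complex \<Rightarrow> complex) \<Rightarrow> bool" where
  "bipolynomial_function f \<longleftrightarrow> (\<exists>q. \<forall>s u. f (s, u) = poly (poly q [:s:]) u)"

lemma bipolynomial_function_fst: "bipolynomial_function fst"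
  unfolding bipolynomial_function_def by (rule exI[of _ "[:0, 1:]"]) simp

lemma bipolynomial_function_snd: "bipolynomial_function snd"
  unfolding bipolynomial_function_def by (rule exI[of _ "[:[:0, 1:]:]"]) simp

interpretation bipolynomial_function: function_ring bipolynomial_function
proof
  show "bipolynomial_function (\<lambda>s. c)" for c
    unfolding bipolynomial_function_def by (rule exI[of _ "[:[:c:]:]"]) simp
  show "bipolynomial_function (\<lambda>s. f s + g s)" if "bipolynomial_function f" "bipolynomial_function g" for f g
    using that unfolding bipolynomial_function_def by (metis poly_add)
  show "bipolynomial_function (\<lambda>s. f s * g s)" if "bipolynomial_function f" "bipolynomial_function g" for f g
    using that unfolding bipolynomial_function_def by (metis poly_mult)
qed

lemma poly_partial_evaluation:
  "poly (map_poly (\<lambda>w. poly w u) q) s = poly (poly q [:s:]) (u :: 'a::comm_ring_1)"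
  by (induction q) (simp_all add: map_poly_pCons algebra_simps)

lemma poly_eq_0_of_nonzero_args:
  fixes p :: "complex poly"
  assumes "\<And>s. s \<noteq> 0 \<Longrightarrow> poly p s = 0"
  shows "p = 0"
proof (rule ccontr)
  assume "p \<noteq> 0"
  then have "finite {s. poly p s = 0}" by (rule poly_roots_finite)
  moreover have "UNIV - {0} \<subseteq> {s. poly p s = 0}" using assms by auto
  ultimately have "finite (UNIV - {0 :: complex})" by (rule rev_finite_subset)
  then show False using infinite_UNIV_char_0[where 'a = complex] by simp
qed

lemma diagonal_vanishing_leading_coeff:
  fixes q :: "complex poly poly"
  assumes diag: "\<And>s. poly (poly q [:s:]) s = 0" and low: "\<And>i. i < r \<Longrightarrow> coeff q i = 0"
  shows "poly (coeff q r) 0 = 0"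
proof -
  have "monom 1 r dvd q" using low by (simp add: monom_1_dvd_iff')
  then obtain p where p: "q = monom 1 r * p" by (elim dvdE)
  have *: "poly (poly p [:s:]) s = poly (poly p [:0, 1:]) s" for s
    by (induction p) simp_all
  have "poly (poly p [:0, 1:]) s = 0" if "s \<noteq> 0" for s
    using diag[of s] that unfolding p by (simp add: poly_monom *[symmetric])
  then have "poly p [:0, 1:] = 0" by (rule poly_eq_0_of_nonzero_args)
  then have "poly (poly p [:0:]) 0 = 0" using *[of 0] by simp
  moreover have "coeff q r = coeff p 0" unfolding p by (simp add: coeff_monom_mult)
  ultimately show ?thesis by (simp add: poly_0_coeff_0)
qed

text \<open>
  Suppose that through \<open>F\<^sub>0\<close> there is, for every direction \<open>E\<close> in the space \<open>V\<close>, a curve on which \<open>\<Psi>\<close>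
  vanishes. If the Taylor expansion of \<open>\<Psi>\<close> along \<open>V\<close> at \<open>F\<^sub>0\<close> started with a nonzero form of degree \<open>r\<close>, the
  restriction of \<open>\<Psi>\<close> to the curve with direction \<open>E\<close> would start with the value of this form at \<open>E\<close> times
  \<open>s^r\<close>; so the form is zero at every \<open>E\<close>, a contradiction. The induction is on \<open>r\<close>. Writing the curve as
  \<open>F\<^sub>0 + s (E + u Q + u^2 R)\<close> with \<open>u = s\<close> separates the order in \<open>s\<close> from the dependence of the direction
  on the parameter. Curves of degree three suffice for the application.
\<close>

theorem polynomial_vanishes_by_tangent_directions:
  fixes \<Psi> :: "'i cpoly \<Rightarrow> complex" and F\<^sub>0 :: "'i cpoly"
  assumes \<Psi>: "\<And>F. \<Psi> F = eval_poly G (lookup (subst_poly F y))"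
    and V_add: "\<And>E E'. V E \<Longrightarrow> V E' \<Longrightarrow> V (E + E')" and V_scale: "\<And>c E. V E \<Longrightarrow> V (const_poly c * E)"
    and curves: "\<And>E. V E \<Longrightarrow> \<exists>Q R. V Q \<and> V R \<and> (\<forall>s. \<Psi> (F\<^sub>0 + const_poly s * E + const_poly (s ^ 2) * Q + const_poly (s ^ 3) * R) = 0)"
    and E: "V E"
  shows "\<Psi> (F\<^sub>0 + E) = 0"
proof -
  have poly_ex: "\<exists>p. \<forall>s. \<Psi> (F\<^sub>0 + const_poly s * E) = poly p s" for E
  proof -
    have "polynomial_function (\<lambda>s. eval_poly G (lookup (subst_poly F\<^sub>0 y + const_poly s * subst_poly E y)))"
      by (intro polynomial_function.eval_poly polynomial_function_lookup polynomial_family_add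
          polynomial_family_mult polynomial_family_const polynomial_family_param)
    then show ?thesis by (simp add: polynomial_function_def \<Psi> subst_poly.homs)
  qed
  have "\<forall>E p. V E \<longrightarrow> (\<forall>s. \<Psi> (F\<^sub>0 + const_poly s * E) = poly p s) \<longrightarrow> (\<forall>i<r. coeff p i = 0)" for r
  proof (induction r)
    case (Suc r)
    show ?case
    proof (intro allI impI)
      fix E p i
      assume E: "V E" and p: "\<forall>s. \<Psi> (F\<^sub>0 + const_poly s * E) = poly p s" and i: "i < Suc r"
      obtain Q R where Q: "V Q" and R: "V R"
        and curve: "\<And>s. \<Psi> (F\<^sub>0 + const_poly s * E + const_poly (s ^ 2) * Q + const_poly (s ^ 3) * R) = 0"
        using curves[OF E] by blast
      define W where "W s u = \<Psi> (F\<^sub>0 + const_poly s * (E + const_poly u * Q + const_poly (u ^ 2) * R))" for s u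
      have "bipolynomial_function (\<lambda>z. eval_poly G (\<lambda>a. lookup (subst_poly F\<^sub>0 y) a +
          fst z * (lookup (subst_poly E y) a + snd z * lookup (subst_poly Q y) a +
            snd z ^ 2 * lookup (subst_poly R y) a)))"
        by (intro bipolynomial_function.eval_poly bipolynomial_function.add bipolynomial_function.mult
            bipolynomial_function.power bipolynomial_function.const bipolynomial_function_fst
            bipolynomial_function_snd)
      moreover have "lookup (subst_poly (F\<^sub>0 + const_poly s * (E + const_poly u * Q + const_poly (u ^ 2) * R)) y)
        = (\<lambda>a. lookup (subst_poly F\<^sub>0 y) a + s * (lookup (subst_poly E y) a + u * lookup (subst_poly Q y) a +
            u ^ 2 * lookup (subst_poly R y) a))" for s u
        by (rule ext) (simp add: subst_poly.hom_add subst_poly.hom_mult lookup_add lookup_const_times)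
      ultimately obtain q where q: "\<And>s u. W s u = poly (poly q [:s:]) u"
        unfolding bipolynomial_function_def W_def \<Psi> by auto
      have low: "coeff q t = 0" if "t < r" for t
      proof -
        have "poly (coeff q t) u = 0" for u
        proof -
          have "V (E + const_poly u * Q + const_poly (u ^ 2) * R)"
            by (intro V_add V_scale E Q R)
          moreover have "\<forall>s. \<Psi> (F\<^sub>0 + const_poly s * (E + const_poly u * Q + const_poly (u ^ 2) * R))
              = poly (map_poly (\<lambda>w. poly w u) q) s"
            using q unfolding W_def poly_partial_evaluation by blast
          ultimately have "coeff (map_poly (\<lambda>w. poly w u) q) t = 0" using Suc.IH that by blast
          then show ?thesis by (simp add: coeff_map_poly)
        qed
        then show ?thesis by (intro poly_eq_0_of_nonzero_args) blast
      qed
      have "poly (poly q [:s:]) s = 0" for s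
      proof -
        have eq: "F\<^sub>0 + const_poly s * (E + const_poly s * Q + const_poly (s ^ 2) * R)
          = F\<^sub>0 + const_poly s * E + const_poly (s ^ 2) * Q + const_poly (s ^ 3) * R"
          by (simp add: distrib_left const_poly.homs power2_eq_square power3_eq_cube mult.assoc)
        show ?thesis using curve[of s] unfolding q[symmetric] W_def eq .
      qed
      from diagonal_vanishing_leading_coeff[OF this low] have lead: "poly (coeff q r) 0 = 0" .
      have "poly p s = poly (map_poly (\<lambda>w. poly w 0) q) s" for s
        unfolding poly_partial_evaluation q[symmetric] W_def using p by (simp add: const_poly.homs)
      then have "poly p = poly (map_poly (\<lambda>w. poly w 0) q)" by (rule ext)
      then have "p = map_poly (\<lambda>w. poly w 0) q" by (rule poly_eq_poly_eq_iff[THEN iffD1])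
      then have "coeff p t = poly (coeff q t) 0" for t by (simp add: coeff_map_poly)
      then show "coeff p i = 0" using i low lead by (cases "i = r") auto
    qed
  qed simp
  moreover obtain p where p: "\<forall>s. \<Psi> (F\<^sub>0 + const_poly s * E) = poly p s" using poly_ex by blast
  ultimately have "coeff p i = 0" for i using E by blast
  then have "p = 0" by (simp add: poly_eq_iff)
  then show ?thesis using p[rule_format, of 1] by (simp add: const_poly.homs)
qed

section \<open>Forms of given order at a point\<close>

text \<open>
  Forms of degree \<open>d\<close> that vanish to order at least \<open>r\<close> at \<open>[1:0:...:0]\<close>.
\<close>

definition order_form :: "nat \<Rightarrow> nat \<Rightarrow> nat \<Rightarrow> nat cpoly \<Rightarrow> bool" where
  "order_form n d r F \<longleftrightarrow> (\<forall>a\<in>keys F. a \<in> monomials {..n} d \<and> r \<le> (\<Sum>j=1..n. lookup a j))"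

lemma order_form_imp_form: "order_form n d r F \<Longrightarrow> form {..n} d F"
  by (auto simp: order_form_def form_def)

lemma order_form_zero: "order_form n d r 0"
  by (simp add: order_form_def)

lemma order_form_add: "order_form n d r F \<Longrightarrow> order_form n d r G \<Longrightarrow> order_form n d r (F + G)"
  unfolding order_form_def using keys_add[of F G] by blast

lemma order_form_mult:
  assumes "order_form n d r F" "order_form n e t G"
  shows "order_form n (d + e) (r + t) (F * G)"
  unfolding order_form_def
proof
  fix c assume "c \<in> keys (F * G)"
  then obtain a b where "c = a + b" "a \<in> keys F" "b \<in> keys G"
    using keys_mult[of F G] by blast
  then show "c \<in> monomials {..n} (d + e) \<and> r + t \<le> (\<Sum>j=1..n. lookup c j)"
    using assms unfolding order_form_def monomials_def
    by (auto simp: keys_add_nat mdeg_add lookup_add sum.distrib intro!: add_mono)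
qed

lemma order_form_const_mult: "order_form n d r F \<Longrightarrow> order_form n d r (const_poly c * F)"
  unfolding order_form_def by (auto simp: in_keys_iff lookup_const_times)

lemma order_form_one: "order_form n 0 0 1"
  by (simp add: order_form_def monomials_def)

lemma order_form_sum: "(\<And>x. x \<in> A \<Longrightarrow> order_form n d r (f x)) \<Longrightarrow> order_form n d r (sum f A)"
  by (induction A rule: infinite_finite_induct) (simp_all add: order_form_zero order_form_add)

lemma order_form_prod:
  "(\<And>x. x \<in> A \<Longrightarrow> order_form n (d x) (r x) (f x)) \<Longrightarrow> order_form n (sum d A) (sum r A) (prod f A)"
  by (induction A rule: infinite_finite_induct) (simp_all add: order_form_one order_form_mult)

lemma order_form_power: "order_form n d r F \<Longrightarrow> order_form n (k * d) (k * r) (F ^ k)"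
  by (induction k) (simp_all add: order_form_one order_form_mult)

lemma order_form_single:
  "a \<in> monomials {..n} d \<Longrightarrow> r \<le> (\<Sum>j=1..n. lookup a j) \<Longrightarrow> order_form n d r (Poly_Mapping.single a c)"
  by (simp add: order_form_def)

lemma order_form_var:
  assumes "j \<in> {1..n}"
  shows "order_form n 1 1 (var_poly j)"
proof -
  have "(\<Sum>l=1..n. lookup (Poly_Mapping.single j (1::nat)) l) = 1"
    using assms by (simp add: lookup_single when_def)
  then show ?thesis
    unfolding var_poly_def using assms by (intro order_form_single) (auto simp: monomials_def)
qed

lemma order_form_var_0: "order_form n 1 0 (var_poly 0)"
  unfolding var_poly_def by (intro order_form_single) (auto simp: monomials_def)

lemma order_form_var_power: "j \<in> {1..n} \<Longrightarrow> order_form n k k (var_poly j ^ k)"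
  using order_form_power[OF order_form_var, of j n k] by simp

lemma sum_coordinates:
  fixes a :: "nat \<Rightarrow>\<^sub>0 nat"
  assumes "a \<in> monomials {..n} d"
  shows "lookup a 0 + (\<Sum>j=1..n. lookup a j) = d"
proof -
  have "d = (\<Sum>j\<le>n. lookup a j)"
    using assms mdeg_superset[of "{..n}" a] by (simp add: monomials_def)
  also have "{..n} = insert 0 {1..n}" by auto
  finally show ?thesis by simp
qed

lemma prod_singles:
  "(\<Prod>j\<in>A. Poly_Mapping.single (b j) 1) = (Poly_Mapping.single (\<Sum>j\<in>A. b j) 1 :: 'i cpoly)"
  by (induction A rule: infinite_finite_induct) (simp_all add: mult_single)

lemma var_poly_power: "var_poly i ^ k = Poly_Mapping.single (Poly_Mapping.single i k) 1"
  by (induction k) (simp_all add: var_poly_def mult_single single_add[symmetric])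

lemma single_eq_prod_vars:
  fixes a :: "nat \<Rightarrow>\<^sub>0 nat"
  assumes "keys a \<subseteq> {..n}"
  shows "Poly_Mapping.single a 1 = var_poly 0 ^ lookup a 0 * (\<Prod>j=1..n. var_poly j ^ lookup a j)"
proof -
  have "Poly_Mapping.single a 1 = monomial_value var_poly a"
    using subst_var_polys[of "Poly_Mapping.single a 1"]
    by (simp add: subst_poly_single const_poly.hom_one)
  also have "\<dots> = (\<Prod>j\<le>n. var_poly j ^ lookup a j)"
    by (rule monomial_value_superset) (use assms in auto)
  also have "{..n} = insert 0 {1..n}" by auto
  finally show ?thesis by simp
qed

section \<open>Forms of high order as tangent vectors\<close>

definition pair_sum :: "nat \<Rightarrow> (nat \<Rightarrow> nat \<Rightarrow> 'i cpoly) \<Rightarrow> 'i cpoly" where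
  "pair_sum n f = (\<Sum>i=1..n. \<Sum>j=1..n. f i j)"

lemma pair_sum_add: "pair_sum n (\<lambda>i j. f i j + g i j) = pair_sum n f + pair_sum n g"
  by (simp add: pair_sum_def sum.distrib)

lemma order_form_pair_sum:
  "(\<And>i j. i \<in> {1..n} \<Longrightarrow> j \<in> {1..n} \<Longrightarrow> order_form n d r (f i j)) \<Longrightarrow> order_form n d r (pair_sum n f)"
  unfolding pair_sum_def by (intro order_form_sum)

text \<open>
  The coefficient of \<open>s\<close> is the differential of \<open>quadric n\<close> at \<open>(D, X)\<close> in direction \<open>(A, Y)\<close>.
\<close>

lemma quadric_curve:
  "quadric n (\<lambda>i j. D i j + const_poly s * A i j) (\<lambda>j. X j + const_poly s * Y j)
    = quadric n D X
      + const_poly s * pair_sum n (\<lambda>i j. A i j * X i * X j + D i j * (X i * Y j + Y i * X j))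
      + const_poly (s ^ 2) * pair_sum n (\<lambda>i j. D i j * (Y i * Y j) + A i j * (X i * Y j + Y i * X j))
      + const_poly (s ^ 3) * pair_sum n (\<lambda>i j. A i j * (Y i * Y j))"
  unfolding quadric_def pair_sum_def sum_distrib_left sum.distrib[symmetric] const_poly.hom_power
  by (intro sum.cong refl) (simp add: algebra_simps power2_eq_square power3_eq_cube)

lemma single_split:
  fixes a c :: "'i \<Rightarrow>\<^sub>0 nat"
  assumes "\<And>i. lookup c i \<le> lookup a i"
  shows "Poly_Mapping.single a (1::complex) = Poly_Mapping.single c 1 * Poly_Mapping.single (a - c) 1"
proof -
  have "a = c + (a - c)"
    by (intro poly_mapping_eqI) (simp add: lookup_add lookup_minus assms)
  then show ?thesis by (metis mult_single mult_1)
qed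

text \<open>
  If no \<open>x_i^k x_j^k\<close> divides the monomial, all exponents of \<open>x_1, ..., x_n\<close> are at most \<open>k - 1\<close>, except for one
  that is at most \<open>2 k - 1\<close>. Their sum is then at most \<open>(n + 1) k - n \<le> m\<close>, so all these bounds are attained.
\<close>

lemma high_order_monomial_cases:
  fixes a :: "nat \<Rightarrow>\<^sub>0 nat"
  assumes a: "a \<in> monomials {..n} (e + 2 * k)" and m: "m \<le> (\<Sum>j=1..n. lookup a j)" "2 * k \<le> m"
    and high: "(n + 1) * k \<le> m + n" and k: "k \<ge> 1"
  obtains (divisible) i j b where "i \<in> {1..n}" "j \<in> {1..n}" "order_form n e (m - 2 * k) b"
      "Poly_Mapping.single a 1 = b * var_poly i ^ k * var_poly j ^ k"
    | (extremal) i where "i \<in> {1..n}" "m + n = (n + 1) * k"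
      "Poly_Mapping.single a 1 = var_poly 0 ^ (e + 2 * k - m) * var_poly i ^ k * (\<Prod>j=1..n. var_poly j ^ (k - 1))"
proof -
  have key: "keys a \<subseteq> {..n}" "mdeg a = e + 2 * k" using a by (auto simp: monomials_def)
  have split: thesis
    if ij: "i \<in> {1..n}" "j \<in> {1..n}"
      and le: "\<And>l. lookup (Poly_Mapping.single i k + Poly_Mapping.single j k) l \<le> lookup a l" for i j
  proof -
    let ?c = "Poly_Mapping.single i k + Poly_Mapping.single j k"
    have ac: "a = ?c + (a - ?c)"
      by (intro poly_mapping_eqI) (use le in \<open>simp add: lookup_add lookup_minus\<close>)
    have "mdeg a = mdeg ?c + mdeg (a - ?c)"
      using mdeg_add[of ?c "a - ?c"] unfolding ac[symmetric] .
    then have "mdeg a = 2 * k + mdeg (a - ?c)"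
      by (simp add: mdeg_add)
    moreover have "(\<Sum>l=1..n. lookup a l) = 2 * k + (\<Sum>l=1..n. lookup (a - ?c) l)"
    proof -
      have "(\<Sum>l=1..n. lookup a l) = (\<Sum>l=1..n. lookup ?c l) + (\<Sum>l=1..n. lookup (a - ?c) l)"
        using sum.distrib[of "lookup ?c" "lookup (a - ?c)" "{1..n}"]
        unfolding lookup_add[symmetric] ac[symmetric] .
      also have "(\<Sum>l=1..n. lookup ?c l) = 2 * k"
        using ij by (simp add: lookup_add sum.distrib lookup_single when_def)
      finally show ?thesis .
    qed
    moreover have "keys (a - ?c) \<subseteq> {..n}"
      using key(1) by (auto simp: in_keys_iff lookup_minus subset_iff)
    ultimately have "order_form n e (m - 2 * k) (Poly_Mapping.single (a - ?c) 1)"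
      using key m by (intro order_form_single) (auto simp: monomials_def)
    moreover have "Poly_Mapping.single a 1 = Poly_Mapping.single (a - ?c) (1::complex) * var_poly i ^ k * var_poly j ^ k"
      using single_split[OF le] by (simp add: var_poly_power mult_single add_ac)
    ultimately show thesis using ij divisible by blast
  qed
  show thesis
  proof (cases "\<exists>i\<in>{1..n}. 2 * k \<le> lookup a i")
    case True
    then obtain i where i: "i \<in> {1..n}" "2 * k \<le> lookup a i" by blast
    show thesis
      by (rule split[OF i(1) i(1)]) (use i in \<open>auto simp: lookup_add lookup_single when_def\<close>)
  next
    case False
    then have small: "lookup a i \<le> 2 * k - 1" if "i \<in> {1..n}" for i
    proof -
      have "\<not> 2 * k \<le> lookup a i" using False that by blast
      then show ?thesis by linarith
    qed
    show thesis
    proof (cases "\<exists>i\<in>{1..n}. \<exists>j\<in>{1..n}. i \<noteq> j \<and> k \<le> lookup a i \<and> k \<le> lookup a j")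
      case True
      then obtain i j where ij: "i \<in> {1..n}" "j \<in> {1..n}" "i \<noteq> j" "k \<le> lookup a i" "k \<le> lookup a j"
        by blast
      show thesis
        by (rule split[OF ij(1,2)]) (use ij in \<open>auto simp: lookup_add lookup_single when_def\<close>)
    next
      case False
      have "\<exists>i\<in>{1..n}. k \<le> lookup a i"
      proof (rule ccontr)
        assume "\<not> ?thesis"
        then have lt: "\<not> k \<le> lookup a j" if "j \<in> {1..n}" for j using that by blast
        have "lookup a j \<le> k - 1" if "j \<in> {1..n}" for j using lt[OF that] by linarith
        then have "(\<Sum>j=1..n. lookup a j) \<le> (\<Sum>j=1..n. k - 1)" by (intro sum_mono)
        then have "m + n \<le> n * k" using m k by (simp add: algebra_simps)
        then show False using high k by simp
      qed
      then obtain i where i: "i \<in> {1..n}" "k \<le> lookup a i" by blast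
      have others: "lookup a j \<le> k - 1" if "j \<in> {1..n} - {i}" for j
      proof -
        have "\<not> k \<le> lookup a j" using False i that by blast
        then show ?thesis by linarith
      qed
      have n1: "n \<ge> 1" using i by auto
      have sum_i: "(\<Sum>j=1..n. lookup a j) = lookup a i + (\<Sum>j\<in>{1..n} - {i}. lookup a j)"
        using i by (simp add: sum.remove)
      have le: "(\<Sum>j\<in>{1..n} - {i}. lookup a j) \<le> (n - 1) * (k - 1)"
        using sum_mono[of "{1..n} - {i}" "lookup a" "\<lambda>_. k - 1"] others i by simp
      have arith: "(n - 1) * (k - 1) + (2 * k - 1) + n = (n + 1) * k"
      proof -
        obtain n' k' where "n = Suc n'" "k = Suc k'" using n1 k by (cases n; cases k) auto
        then show ?thesis by (simp add: algebra_simps)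
      qed
      have mn: "m + n = (n + 1) * k" and ai: "lookup a i = 2 * k - 1"
        and rest: "(\<Sum>j\<in>{1..n} - {i}. lookup a j) = (n - 1) * (k - 1)" and m_eq: "(\<Sum>j=1..n. lookup a j) = m"
        using sum_i le arith small[OF i(1)] m high by linarith+
      have aj: "lookup a j = k - 1" if j: "j \<in> {1..n} - {i}" for j
      proof (rule ccontr)
        assume "lookup a j \<noteq> k - 1"
        then have "lookup a j < k - 1" using others[OF j] by simp
        then have "(\<Sum>j\<in>{1..n} - {i}. lookup a j) < (\<Sum>j\<in>{1..n} - {i}. k - 1)"
          using j others by (intro sum_strict_mono_ex1) auto
        then show False using rest i by simp
      qed
      have "(\<Prod>j=1..n. var_poly j ^ lookup a j)
          = (var_poly i ^ lookup a i * (\<Prod>j\<in>{1..n} - {i}. var_poly j ^ (k - 1)) :: nat cpoly)"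
        using i aj by (simp add: prod.remove)
      also have "2 * k - 1 = k + (k - 1)" using k by simp
      then have "(var_poly i ^ lookup a i :: nat cpoly) = var_poly i ^ k * var_poly i ^ (k - 1)"
        by (simp only: ai power_add)
      also have "var_poly i ^ k * var_poly i ^ (k - 1) * (\<Prod>j\<in>{1..n} - {i}. var_poly j ^ (k - 1))
          = (var_poly i ^ k * (\<Prod>j=1..n. var_poly j ^ (k - 1)) :: nat cpoly)"
        using i by (simp add: prod.remove mult.assoc)
      finally have "Poly_Mapping.single a 1
          = var_poly 0 ^ lookup a 0 * (var_poly i ^ k * (\<Prod>j=1..n. var_poly j ^ (k - 1)))"
        using single_eq_prod_vars[OF key(1)] by simp
      moreover have "lookup a 0 = e + 2 * k - m" using sum_coordinates[OF a] m_eq by simp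
      ultimately show thesis using extremal i(1) mn by (simp add: mult.assoc)
    qed
  qed
qed

definition cyclic_succ :: "nat \<Rightarrow> nat \<Rightarrow> nat" where
  "cyclic_succ n j = (if j = n then 1 else Suc j)"

text \<open>
  The curves start at the point where \<open>p_j = x_j^k\<close> and \<open>a\<close> is the diagonal matrix \<open>base_weight\<close>. In the extremal
  case its entries are the monomials that turn \<open>base_form i * direction i\<close> into the extremal monomials of
  \<open>high_order_monomial_cases\<close>; otherwise no variation of the \<open>p_j\<close> is needed, and it is zero. A direction keeps
  \<open>k - 1\<close> of the linear factors of \<open>x_j^k\<close> and changes the last one, so that \<open>p_j\<close> stays a product of linear
  forms along the curve.
\<close>

locale high_order =
  fixes n k m e :: nat
  assumes n: "n \<ge> 2" and k: "k \<ge> 1" and m: "2 * k \<le> m" "m \<le> e + 2 * k"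
    and high: "(n + 1) * k \<le> m + n"
begin

definition base_form :: "nat \<Rightarrow> nat cpoly" where
  "base_form j = var_poly j ^ k"

definition direction :: "nat \<Rightarrow> nat cpoly" where
  "direction j = var_poly j ^ (k - 1) * var_poly (cyclic_succ n j)"

definition base_weight :: "nat \<Rightarrow> nat \<Rightarrow> nat cpoly" where
  "base_weight i j = (if i = j then if m + n = (n + 1) * k
     then var_poly 0 ^ (e + 2 * k - m) * var_poly (cyclic_succ n j) ^ (k - 2)
       * (\<Prod>l\<in>{1..n} - {j, cyclic_succ n j}. var_poly l ^ (k - 1)) else 0 else 0)"

lemma cyclic_succ: "j \<in> {1..n} \<Longrightarrow> cyclic_succ n j \<in> {1..n}" "j \<in> {1..n} \<Longrightarrow> cyclic_succ n j \<noteq> j"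
  using n by (auto simp: cyclic_succ_def)

lemma extremal_k: "m + n = (n + 1) * k \<Longrightarrow> k \<ge> 2"
  using m(1) k by (cases "k = 1") auto

lemma order_form_base_form: "j \<in> {1..n} \<Longrightarrow> order_form n k k (base_form j)"
  unfolding base_form_def by (rule order_form_var_power)

lemma order_form_direction:
  assumes "j \<in> {1..n}"
  shows "order_form n k k (direction j)"
proof -
  have "order_form n (k - 1 + 1) (k - 1 + 1) (direction j)"
    unfolding direction_def using assms cyclic_succ
    by (intro order_form_mult order_form_var_power order_form_var)
  then show ?thesis using k by simp
qed

lemma order_form_base_weight:
  assumes "j \<in> {1..n}"
  shows "order_form n e (m - 2 * k) (base_weight i j)"
proof (cases "i = j \<and> m + n = (n + 1) * k")
  case True
  let ?c = "cyclic_succ n j"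
  have "order_form n (\<Sum>l\<in>{1..n} - {j, ?c}. k - 1) (\<Sum>l\<in>{1..n} - {j, ?c}. k - 1)
      (\<Prod>l\<in>{1..n} - {j, ?c}. var_poly l ^ (k - 1))"
    by (intro order_form_prod order_form_var_power) auto
  moreover have "card ({1..n} - {j, ?c}) = n - 2"
    using assms cyclic_succ[OF assms] by (simp add: card_Diff_subset)
  ultimately have p: "order_form n ((n - 2) * (k - 1)) ((n - 2) * (k - 1))
      (\<Prod>l\<in>{1..n} - {j, ?c}. var_poly l ^ (k - 1))"
    by simp
  have z: "order_form n (e + 2 * k - m) 0 (var_poly 0 ^ (e + 2 * k - m))"
    using order_form_power[OF order_form_var_0, of n "e + 2 * k - m"] by simp
  have w: "base_weight i j = var_poly 0 ^ (e + 2 * k - m) * var_poly ?c ^ (k - 2)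
      * (\<Prod>l\<in>{1..n} - {j, ?c}. var_poly l ^ (k - 1))"
    using True by (simp add: base_weight_def)
  have "order_form n (e + 2 * k - m + (k - 2) + (n - 2) * (k - 1)) (0 + (k - 2) + (n - 2) * (k - 1))
      (base_weight i j)"
    unfolding w by (intro order_form_mult p z order_form_var_power cyclic_succ assms)
  moreover have "(k - 2) + (n - 2) * (k - 1) = m - 2 * k"
  proof -
    obtain n' k' where "n = n' + 2" "k = k' + 2"
      using n extremal_k True by (metis le_add_diff_inverse2)
    then show ?thesis using True by (simp add: algebra_simps)
  qed
  moreover have "e + 2 * k - m + (m - 2 * k) = e" using m by simp
  ultimately show ?thesis by (simp add: add.assoc)
next
  case False
  then show ?thesis by (auto simp: base_weight_def order_form_zero)
qed

lemma order_form_pair: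
  "order_form n k k p \<Longrightarrow> order_form n k k q \<Longrightarrow> order_form n (2 * k) (2 * k) (p * q)"
  using order_form_mult[of n k k p k k q] by (simp add: mult_2)

lemma order_form_weighted:
  "order_form n e (m - 2 * k) a \<Longrightarrow> order_form n (2 * k) (2 * k) w \<Longrightarrow> order_form n (e + 2 * k) m (a * w)"
  using order_form_mult[of n e "m - 2 * k" a "2 * k" "2 * k" w] m(1) by simp

lemma base_weight_times_direction:
  assumes i: "i \<in> {1..n}" and ext: "m + n = (n + 1) * k"
  shows "base_weight i i * (base_form i * direction i)
    = var_poly 0 ^ (e + 2 * k - m) * var_poly i ^ k * (\<Prod>j=1..n. var_poly j ^ (k - 1))"
proof -
  let ?c = "cyclic_succ n i"
  have c: "?c \<in> {1..n}" "?c \<noteq> i" using cyclic_succ i by auto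
  have "{1..n} = insert i (insert ?c ({1..n} - {i, ?c}))" using i c by auto
  then have "(\<Prod>j=1..n. var_poly j ^ (k - 1))
      = (\<Prod>j\<in>insert i (insert ?c ({1..n} - {i, ?c})). var_poly j ^ (k - 1) :: nat cpoly)"
    by simp
  also have "\<dots> = var_poly i ^ (k - 1) * (var_poly ?c ^ (k - 1) * (\<Prod>j\<in>{1..n} - {i, ?c}. var_poly j ^ (k - 1)))"
    using c by simp
  also have "var_poly ?c ^ (k - 1) = (var_poly ?c ^ (k - 2) * var_poly ?c :: nat cpoly)"
  proof -
    have "k - 1 = Suc (k - 2)" using extremal_k[OF ext] by simp
    then show ?thesis by (simp only: power_Suc mult.commute)
  qed
  finally show ?thesis
    using ext by (simp add: base_weight_def base_form_def direction_def mult_ac)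
qed

text \<open>
  Multiples of \<open>x_i^k x_j^k\<close> come from varying \<open>a\<close>, extremal monomials from varying the \<open>p_j\<close>.
\<close>

lemma tangent_directions:
  assumes "order_form n (e + 2 * k) m E"
  shows "\<exists>A \<epsilon>. (\<forall>i j. order_form n e (m - 2 * k) (A i j)) \<and>
    E = pair_sum n (\<lambda>i j. A i j * base_form i * base_form j + base_weight i j *
      (base_form i * (const_poly (\<epsilon> j) * direction j) + const_poly (\<epsilon> i) * direction i * base_form j))"
    (is "?T E")
proof (induction E rule: poly_mapping_additive_induct)
  case (single a c)
  show ?case
  proof (cases "c = 0")
    case True
    then show ?thesis
      by (intro exI[of _ "\<lambda>_ _. 0"] exI[of _ "\<lambda>_. 0"])
        (simp add: order_form_zero pair_sum_def const_poly.homs)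
  next
    case False
    then have a: "a \<in> monomials {..n} (e + 2 * k)" "m \<le> (\<Sum>j=1..n. lookup a j)"
      using single assms unfolding order_form_def by blast+
    consider (divisible) i j b where "i \<in> {1..n}" "j \<in> {1..n}" "order_form n e (m - 2 * k) b"
        "Poly_Mapping.single a 1 = b * var_poly i ^ k * var_poly j ^ k"
      | (extremal) i where "i \<in> {1..n}" "m + n = (n + 1) * k"
        "Poly_Mapping.single a 1 = var_poly 0 ^ (e + 2 * k - m) * var_poly i ^ k * (\<Prod>j=1..n. var_poly j ^ (k - 1))"
      by (rule high_order_monomial_cases[OF a m(1) high k])
    then show ?thesis
    proof cases
      case (divisible i j b)
      define A where "A i' j' = (if j' = j then if i' = i then const_poly c * b else 0 else 0)" for i' j'
      have "pair_sum n (\<lambda>i j. A i j * base_form i * base_form j)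
          = const_poly c * b * base_form i * base_form j"
        unfolding pair_sum_def A_def using divisible(1,2)
        by (simp add: if_distrib[of "\<lambda>x. x * _"] cong: if_cong)
      also have "\<dots> = Poly_Mapping.single a c"
        by (subst single_eq_const_times) (simp add: divisible(4) base_form_def mult_ac)
      finally have "Poly_Mapping.single a c = pair_sum n (\<lambda>i j. A i j * base_form i * base_form j)" ..
      then show ?thesis
        by (intro exI[of _ A] exI[of _ "\<lambda>_. 0"])
          (auto simp: A_def order_form_zero const_poly.homs intro: order_form_const_mult divisible(3))
    next
      case (extremal i)
      \<comment> \<open>The factor 1/2 is due to the two equal terms of the derivative of a square.\<close>
      define \<epsilon> where "\<epsilon> j = (if j = i then c / 2 else 0)" for j
      have "pair_sum n (\<lambda>i j. base_weight i j *
          (base_form i * (const_poly (\<epsilon> j) * direction j) + const_poly (\<epsilon> i) * direction i * base_form j))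
        = (\<Sum>l=1..n. \<Sum>j=1..n. if j = i then if l = i then const_poly c * (base_weight i i * (base_form i * direction i)) else 0 else 0)"
        unfolding pair_sum_def
      proof (intro sum.cong refl)
        fix l j
        have "const_poly c = const_poly (c / 2) + (const_poly (c / 2) :: nat cpoly)"
          by (simp flip: const_poly.hom_add)
        then show "base_weight l j * (base_form l * (const_poly (\<epsilon> j) * direction j) +
            const_poly (\<epsilon> l) * direction l * base_form j)
          = (if j = i then if l = i then const_poly c * (base_weight i i * (base_form i * direction i)) else 0 else 0)"
          by (auto simp: base_weight_def \<epsilon>_def const_poly.homs algebra_simps)
      qed
      also have "\<dots> = const_poly c * (base_weight i i * (base_form i * direction i))"
        using extremal(1) by simp
      also have "\<dots> = Poly_Mapping.single a c"
        unfolding base_weight_times_direction[OF extremal(1,2)]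
        by (subst single_eq_const_times) (simp only: extremal(3))
      finally show ?thesis
        by (intro exI[of _ "\<lambda>_ _. 0"] exI[of _ \<epsilon>]) (simp add: order_form_zero)
    qed
  qed
next
  case (add E E')
  then obtain A \<epsilon> A' \<epsilon>' where A: "\<forall>i j. order_form n e (m - 2 * k) (A i j)"
    "\<forall>i j. order_form n e (m - 2 * k) (A' i j)"
    and E: "E = pair_sum n (\<lambda>i j. A i j * base_form i * base_form j + base_weight i j *
      (base_form i * (const_poly (\<epsilon> j) * direction j) + const_poly (\<epsilon> i) * direction i * base_form j))"
    "E' = pair_sum n (\<lambda>i j. A' i j * base_form i * base_form j + base_weight i j *
      (base_form i * (const_poly (\<epsilon>' j) * direction j) + const_poly (\<epsilon>' i) * direction i * base_form j))"
    by (elim exE conjE) (rule that)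
  show ?case
    unfolding E pair_sum_add[symmetric] using A
    by (intro exI[of _ "\<lambda>i j. A i j + A' i j"] exI[of _ "\<lambda>j. \<epsilon> j + \<epsilon>' j"] conjI)
      (simp_all add: order_form_add const_poly.homs algebra_simps)
qed

theorem reached_by_product_quadrics:
  assumes F: "order_form n (e + 2 * k) m F" and y: "\<forall>j\<le>n. form {..n} 1 (y j)"
    and G: "eval_poly G (lookup (subst_poly F y)) \<noteq> 0"
  shows "\<exists>L a. (\<forall>j\<in>{1..n}. \<forall>t. form {..n} 1 (L j t)) \<and>
    (\<forall>j\<in>{1..n}. \<forall>l\<in>{1..n}. form {..n} e (a j l)) \<and>
    eval_poly G (lookup (quadric n a (\<lambda>j. \<Prod>t<k. L j t))) \<noteq> 0"
proof (rule ccontr)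
  assume "\<not> ?thesis"
  then have vanish: "eval_poly G (lookup (quadric n a (\<lambda>j. \<Prod>t<k. L j t))) = 0"
    if "\<forall>j\<in>{1..n}. \<forall>t. form {..n} 1 (L j t)"
      "\<forall>j\<in>{1..n}. \<forall>l\<in>{1..n}. form {..n} e (a j l)" for L a
    using that by blast
  define \<Psi> where "\<Psi> F = eval_poly G (lookup (subst_poly F y))" for F
  let ?F\<^sub>0 = "quadric n base_weight base_form"
  have F0: "order_form n (e + 2 * k) m ?F\<^sub>0"
    unfolding quadric_def mult.assoc
    by (intro order_form_sum order_form_weighted order_form_pair order_form_base_weight order_form_base_form)
  have "\<Psi> (?F\<^sub>0 + (F + const_poly (- 1) * ?F\<^sub>0)) = 0"
  proof (rule polynomial_vanishes_by_tangent_directions[where V = "order_form n (e + 2 * k) m", OF \<Psi>_def])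
    show "order_form n (e + 2 * k) m (F + const_poly (- 1) * ?F\<^sub>0)"
      by (intro order_form_add order_form_const_mult F F0)
    fix E assume "order_form n (e + 2 * k) m E"
    from tangent_directions[OF this] obtain A \<epsilon> where A: "\<forall>i j. order_form n e (m - 2 * k) (A i j)"
      and E: "E = pair_sum n (\<lambda>i j. A i j * base_form i * base_form j + base_weight i j *
        (base_form i * (const_poly (\<epsilon> j) * direction j) + const_poly (\<epsilon> i) * direction i * base_form j))"
      by (elim exE conjE)
    define Y where "Y j = const_poly (\<epsilon> j) * direction j" for j
    have Y: "order_form n k k (Y j)" if "j \<in> {1..n}" for j
      unfolding Y_def using that by (intro order_form_const_mult order_form_direction)
    define Q where "Q = pair_sum n (\<lambda>i j. base_weight i j * (Y i * Y j)
      + A i j * (base_form i * Y j + Y i * base_form j))"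
    define R where "R = pair_sum n (\<lambda>i j. A i j * (Y i * Y j))"
    have "order_form n (e + 2 * k) m Q" "order_form n (e + 2 * k) m R"
      unfolding Q_def R_def using A
      by (auto intro!: order_form_pair_sum order_form_add[of _ "e + 2 * k"] order_form_weighted
          order_form_add[of _ "2 * k"] order_form_pair order_form_base_weight order_form_base_form Y)
    moreover have "\<Psi> (?F\<^sub>0 + const_poly s * E + const_poly (s ^ 2) * Q + const_poly (s ^ 3) * R) = 0" for s
    proof -
      define L where "L j t = (if t = k - 1 then y j + const_poly (s * \<epsilon> j) * y (cyclic_succ n j) else y j)" for j t
      have "subst_poly (base_form j + const_poly s * Y j) y = (\<Prod>t<k. L j t)" for j
      proof -
        have Suc: "k = Suc (k - 1)" using k by simp
        have "(\<Prod>t<k. L j t) = (\<Prod>t<k - 1. L j t) * L j (k - 1)"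
          by (subst Suc) (rule prod.lessThan_Suc)
        also have "(\<Prod>t<k - 1. L j t) = y j ^ (k - 1)" by (simp add: L_def)
        finally have "(\<Prod>t<k. L j t) = y j ^ (k - 1) * (y j + const_poly (s * \<epsilon> j) * y (cyclic_succ n j))"
          by (simp add: L_def)
        moreover have "base_form j = var_poly j ^ (k - 1) * var_poly j"
          unfolding base_form_def by (subst Suc) (rule power_Suc2)
        ultimately show ?thesis
          by (simp add: direction_def Y_def subst_poly.homs const_poly.homs algebra_simps)
      qed
      then have "subst_poly (quadric n (\<lambda>i j. base_weight i j + const_poly s * A i j)
          (\<lambda>j. base_form j + const_poly s * Y j)) y
        = quadric n (\<lambda>i j. subst_poly (base_weight i j + const_poly s * A i j) y) (\<lambda>j. \<Prod>t<k. L j t)"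
        unfolding subst_quadric by simp
      moreover have "form {..n} e (subst_poly (base_weight i j + const_poly s * A i j) y)" if "j \<in> {1..n}" for i j
        using A that by (intro form_subst[where I = "{..n}"] form_add form_const_mult y[rule_format]
            order_form_imp_form[of _ _ "m - 2 * k"] order_form_base_weight) auto
      moreover have "form {..n} 1 (L j t)" if "j \<in> {1..n}" for j t
      proof -
        have "form {..n} 1 (y j)" "form {..n} 1 (y (cyclic_succ n j))"
          by (rule y[rule_format], use that cyclic_succ(1)[OF that] in simp)+
        then show ?thesis
          unfolding L_def by (simp del: One_nat_def add: form_add form_const_mult)
      qed
      ultimately have "eval_poly G (lookup (subst_poly (quadric n (\<lambda>i j. base_weight i j + const_poly s * A i j)
          (\<lambda>j. base_form j + const_poly s * Y j)) y)) = 0"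
        using vanish by simp
      then show ?thesis
        unfolding quadric_curve \<Psi>_def E Q_def R_def Y_def by simp
    qed
    ultimately show "\<exists>Q R. order_form n (e + 2 * k) m Q \<and> order_form n (e + 2 * k) m R \<and>
      (\<forall>s. \<Psi> (?F\<^sub>0 + const_poly s * E + const_poly (s ^ 2) * Q + const_poly (s ^ 3) * R) = 0)"
      by blast
  qed (auto intro: order_form_add order_form_const_mult)
  then have "\<Psi> F = 0" by (simp add: const_poly.homs)
  then show False using G by (simp add: \<Psi>_def)
qed

end

section \<open>Adapted coordinates\<close>

lemma mdeg_sum: "mdeg (\<Sum>j\<in>A. b j) = (\<Sum>j\<in>A. mdeg (b j))"
  by (induction A rule: infinite_finite_induct) (simp_all add: mdeg_add)

text \<open>
  Dehomogenising with respect to \<open>x_0\<close> and renaming the other variables by \<open>\<sigma>\<close>. As the degree of the form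
  is known, no information is lost, and the multiplicity at the origin bounds the exponents from below.
\<close>

context
  fixes n :: nat and \<sigma> :: "nat \<Rightarrow> nat"
  assumes inj: "inj \<sigma>"
begin

definition dehomogenize :: "nat \<Rightarrow> nat cpoly" where
  "dehomogenize j = (if j = 0 then 1 else var_poly (\<sigma> j))"

definition affine_exponent :: "(nat \<Rightarrow>\<^sub>0 nat) \<Rightarrow> (nat \<Rightarrow>\<^sub>0 nat)" where
  "affine_exponent a = (\<Sum>j=1..n. Poly_Mapping.single (\<sigma> j) (lookup a j))"

lemma lookup_affine_exponent: "j \<in> {1..n} \<Longrightarrow> lookup (affine_exponent a) (\<sigma> j) = lookup a j"
  using inj by (simp add: affine_exponent_def lookup_sum lookup_single when_def inj_eq)

lemma mdeg_affine_exponent: "mdeg (affine_exponent a) = (\<Sum>j=1..n. lookup a j)"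
  by (simp add: affine_exponent_def mdeg_sum)

lemma inj_on_affine_exponent: "inj_on affine_exponent (monomials {..n} d)"
proof (rule inj_onI, rule poly_mapping_eqI)
  fix a b j
  assume a: "a \<in> monomials {..n} d" and b: "b \<in> monomials {..n} d"
    and eq: "affine_exponent a = affine_exponent b"
  have pos: "lookup a j = lookup b j" if "j \<in> {1..n}" for j
    using lookup_affine_exponent[OF that] eq by metis
  then have "(\<Sum>j=1..n. lookup a j) = (\<Sum>j=1..n. lookup b j)" by (rule sum.cong[OF refl])
  then have zero: "lookup a 0 = lookup b 0" using sum_coordinates[OF a] sum_coordinates[OF b] by simp
  consider "j = 0" | "j \<in> {1..n}" | "j \<notin> {..n}" by fastforce
  then show "lookup a j = lookup b j"
  proof cases
    case 3
    then have "j \<notin> keys a" "j \<notin> keys b" using a b by (auto simp: monomials_def)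
    then show ?thesis by (simp add: in_keys_iff)
  qed (use pos zero in auto)
qed

lemma lookup_dehomogenize:
  assumes F: "form {..n} d F" and a: "a \<in> monomials {..n} d"
  shows "lookup (subst_poly F dehomogenize) (affine_exponent a) = lookup F a"
proof -
  have mono_val: "monomial_value dehomogenize b = Poly_Mapping.single (affine_exponent b) 1"
    if "keys b \<subseteq> {..n}" for b
  proof -
    have "monomial_value dehomogenize b = (\<Prod>j\<le>n. dehomogenize j ^ lookup b j)"
      by (rule monomial_value_superset) (use that in auto)
    also have "{..n} = insert 0 {1..n}" by auto
    also have "(\<Prod>j\<in>insert 0 {1..n}. dehomogenize j ^ lookup b j)
        = (\<Prod>j=1..n. Poly_Mapping.single (Poly_Mapping.single (\<sigma> j) (lookup b j)) 1)"
      by (simp add: dehomogenize_def var_poly_power)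
    finally show ?thesis by (simp only: prod_singles affine_exponent_def)
  qed
  have keys: "b \<in> monomials {..n} d" if "b \<in> keys F" for b
    using F that by (auto simp: form_def)
  have "subst_poly F dehomogenize
      = (\<Sum>b\<in>keys F. const_poly (lookup F b) * Poly_Mapping.single (affine_exponent b) 1)"
    unfolding subst_poly_evaluate evaluate_def
    using keys mono_val by (intro sum.cong refl) (simp add: monomials_def)
  then have "lookup (subst_poly F dehomogenize) (affine_exponent a)
      = (\<Sum>b\<in>keys F. lookup F b * (1 when affine_exponent b = affine_exponent a))"
    by (simp add: lookup_sum lookup_const_times lookup_single)
  also have "\<dots> = (\<Sum>b\<in>keys F. if b = a then lookup F a else 0)"
    using keys a inj_on_affine_exponent[of d]
    by (intro sum.cong refl) (auto simp: when_def inj_on_def)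
  also have "\<dots> = lookup F a" by (simp add: in_keys_iff)
  finally show ?thesis .
qed

lemma order_form_of_mult_at_origin:
  assumes F: "form {..n} d F" and m: "mult_at_origin (subst_poly F dehomogenize) = m"
  shows "order_form n d m F"
  unfolding order_form_def
proof
  fix a assume a: "a \<in> keys F"
  then have mon: "a \<in> monomials {..n} d" using F by (auto simp: form_def)
  have "lookup (hom_part (\<Sum>j=1..n. lookup a j) (subst_poly F dehomogenize)) (affine_exponent a) \<noteq> 0"
    using a lookup_dehomogenize[OF F mon] by (simp add: lookup_hom_part mdeg_affine_exponent in_keys_iff)
  then have "hom_part (\<Sum>j=1..n. lookup a j) (subst_poly F dehomogenize) \<noteq> 0" by auto
  then have "m \<le> (\<Sum>j=1..n. lookup a j)"
    unfolding m[symmetric] mult_at_origin_def by (rule Least_le)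
  then show "a \<in> monomials {..n} d \<and> m \<le> (\<Sum>j=1..n. lookup a j)" using mon by blast
qed

end

text \<open>
  The new coordinates are \<open>y_0 = x_i\<close> and \<open>x_l - (p_l / p_i) x_i\<close> for \<open>l \<noteq> i\<close>, in which the point becomes
  \<open>[1:0:...:0]\<close>. Exchanging the indices \<open>0\<close> and \<open>i\<close> numbers the latter by \<open>1, ..., n\<close>.
\<close>

lemma adapted_coordinates:
  assumes F: "form {..n} d F" and i: "i \<le> n" and m: "mult_at_origin (local_equation F p i) = m"
  shows "\<exists>H y. order_form n d m H \<and> (\<forall>j\<le>n. form {..n} 1 (y j)) \<and> F = subst_poly H y"
proof -
  define q where "q j = lookup p j / lookup p i" for j
  define \<sigma> where "\<sigma> = Transposition.transpose 0 i"
  have inj: "inj \<sigma>" by (simp add: \<sigma>_def)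
  have \<sigma>\<sigma>: "\<sigma> (\<sigma> r) = r" for r by (simp add: \<sigma>_def)
  have \<sigma>0: "\<sigma> r = 0 \<longleftrightarrow> r = i" for r
    by (auto simp: \<sigma>_def Transposition.transpose_def)
  have \<sigma>n: "\<sigma> r \<le> n" if "r \<le> n" for r
    using that i by (simp add: \<sigma>_def Transposition.transpose_def)
  define x where "x r = (if r = i then var_poly 0 else var_poly (\<sigma> r) + const_poly (q r) * var_poly 0)" for r
  define y where "y j = (if j = 0 then var_poly i else var_poly (\<sigma> j) - const_poly (q (\<sigma> j)) * var_poly i)" for j
  define H where "H = subst_poly F x"
  have H: "form {..n} d H"
    unfolding H_def
  proof (rule form_subst[OF F])
    fix r assume "r \<in> {..n}"
    then have "\<sigma> r \<in> {..n}" "0 \<in> {..n}" using \<sigma>n by simp_all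
    from this[THEN form_var] show "form {..n} 1 (x r)"
      unfolding x_def by (simp add: form_add form_const_mult del: One_nat_def)
  qed
  have y: "form {..n} 1 (y j)" if "j \<le> n" for j
  proof -
    have "\<sigma> j \<in> {..n}" "i \<in> {..n}" using \<sigma>n[OF that] i by simp_all
    from this[THEN form_var] show ?thesis
      unfolding y_def by (simp add: form_diff form_const_mult del: One_nat_def)
  qed
  have "subst_poly (x r) y = var_poly r" for r
    by (cases "r = i") (simp_all add: x_def subst_poly.homs y_def \<sigma>0 \<sigma>\<sigma>)
  then have F_eq: "F = subst_poly H y"
    by (simp add: H_def subst_subst_poly subst_var_polys)
  have "subst_poly (x r) (dehomogenize \<sigma>) = (if r = i then 1 else var_poly r + const_poly (q r))" for r
    by (simp add: x_def subst_poly.homs dehomogenize_def[OF inj] \<sigma>0 \<sigma>\<sigma>)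
  then have "local_equation F p i = subst_poly H (dehomogenize \<sigma>)"
    unfolding H_def subst_subst_poly local_equation_def q_def[symmetric] by simp
  then have "order_form n d m H"
    using order_form_of_mult_at_origin[OF inj H] m by simp
  then show ?thesis using y F_eq by blast
qed

section \<open>Degenerating nodal hypersurfaces to a multiple point\<close>

text \<open>
  The bound \<open>(n + 1) k \<le> m + n\<close> also gives \<open>2 k \<le> m\<close>, so that \<open>e = d - 2 k\<close> is not truncated.
\<close>

lemma high_multiplicity_in_severi_closure:
  assumes n: "n \<ge> 2" and m: "m \<le> d" "m > 1"
    and F: "F \<in> nonzero_vectors (monomials {..n} d)"
    and i: "i \<le> n" "mult_at_origin (local_equation F p i) = m"
  shows "proj_point F \<in> severi_closure n d (((m + n) div (n + 1)) ^ n)"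
proof -
  define k where "k = (m + n) div (n + 1)"
  have high: "(n + 1) * k \<le> m + n" unfolding k_def by (rule times_div_less_eq_dividend)
  have k: "k \<ge> 1"
    unfolding k_def using m by (simp add: Suc_le_eq div_greater_zero_iff)
  have km: "2 * k \<le> m"
  proof (cases "k = 1")
    case False
    then have "k = k - 2 + 2" using k by simp
    then obtain k' where k': "k = k' + 2" by blast
    have "n = n - 2 + 2" using n by simp
    then obtain n' where n': "n = n' + 2" by blast
    show ?thesis using high unfolding k' n' by (simp add: algebra_simps)
  qed (use m in simp)
  define e where "e = d - 2 * k"
  have d: "d = e + 2 * k" using km m by (simp add: e_def)
  interpret high_order n k m e
    using n k km m high d by unfold_locales auto
  have F_form: "form {..n} (e + 2 * k) F" using F d by (simp add: nonzero_vectors_def form_def)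
  from adapted_coordinates[OF F_form i]
  obtain H y where H: "order_form n (e + 2 * k) m H" and y: "\<forall>j\<le>n. form {..n} 1 (y j)"
    and F_eq: "F = subst_poly H y"
    by (elim exE conjE)
  show ?thesis
    unfolding severi_closure_def k_def[symmetric]
  proof (rule in_zariski_closureI[OF F])
    fix G assume G: "eval_poly G (lookup F) \<noteq> 0" "eval_poly G (lookup 0) = 0"
    from G(1) have "eval_poly G (lookup (subst_poly H y)) \<noteq> 0" by (simp flip: F_eq)
    from reached_by_product_quadrics[OF H y this]
    obtain L a where L: "\<forall>j\<in>{1..n}. \<forall>t. form {..n} 1 (L j t)"
      and a: "\<forall>j\<in>{1..n}. \<forall>l\<in>{1..n}. form {..n} e (a j l)"
      and nz: "eval_poly G (lookup (quadric n a (\<lambda>j. \<Prod>t<k. L j t))) \<noteq> 0"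
      by (elim exE conjE)
    have "\<exists>F. F \<in> nonzero_vectors (monomials {..n} (e + 2 * k)) \<and> eval_poly G (lookup F) \<noteq> 0 \<and>
        proj_point F \<in> severi n (e + 2 * k) (k ^ n)"
      by (rule product_quadric_nearby_severi[OF _ k _ _ G(2) nz])
        (use n in simp, use L in blast, use a in blast)
    then show "\<exists>w\<in>nonzero_vectors (monomials {..n} d). eval_poly G (lookup w) \<noteq> 0 \<and>
        proj_point w \<in> severi n d (k ^ n)"
      unfolding d by (elim exE conjE) (intro bexI conjI)
  qed
qed

theorem theorem1p3:
  fixes d m n \<delta> :: nat
  assumes "n \<ge> 3" and "d \<ge> m" and "m > 1"
    and "\<delta> = nat (\<lfloor>real (m + n) / real (n + 1)\<rfloor> ^ n)"
  shows "ordinary_locus n d m \<subseteq> severi_closure n d \<delta> \<and>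
         (\<forall>X\<in>ordinary_locus n d m. max_nodes n d X \<ge> enat \<delta>)"
proof -
  have \<delta>: "\<delta> = ((m + n) div (n + 1)) ^ n"
    unfolding assms(4) floor_divide_of_nat_eq by (simp only: nat_power_eq[OF of_nat_0_le_iff] nat_int)
  have closure: "X \<in> severi_closure n d \<delta>" if "X \<in> ordinary_locus n d m" for X
  proof -
    obtain F P where X: "X = proj_point F" and F: "F \<in> nonzero_vectors (monomials {..n} d)"
      and P: "ordinary_point n m F P"
      using \<open>X \<in> ordinary_locus n d m\<close> unfolding ordinary_locus_def by blast
    obtain p i where p: "p \<in> P" "i \<in> keys p" "mult_at_origin (local_equation F p i) = m"
      using P unfolding ordinary_point_def by blast
    obtain v where v: "P = proj_point v" "v \<in> nonzero_vectors {..n}"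
      using P unfolding ordinary_point_def singular_locus_def by blast
    obtain c where "p = Poly_Mapping.map ((*) c) v"
      using p(1) unfolding v(1) proj_point_def by blast
    then have "i \<in> keys v" using p(2) by (simp add: in_keys_iff)
    then have "i \<le> n" using v(2) by (auto simp: nonzero_vectors_def)
    then show ?thesis
      unfolding X \<delta> using high_multiplicity_in_severi_closure[OF _ assms(2,3) F _ p(3)] assms(1) by simp
  qed
  moreover have "enat \<delta> \<le> max_nodes n d X" if "X \<in> severi_closure n d \<delta>" for X
    unfolding max_nodes_def using that by (intro SUP_upper) simp
  ultimately show ?thesis by blast
qed

end
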